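(* Let $k\geqslant 1$, let $0\leqslant r\leqslant t$, and let $a_{-r},a_{-r+1},\dots,a_{-r+t}$ be elements of a commutative ring $\mathcal R$ with unity; let $x$ be an indeterminate. Then for all $n\geqslant 1$: \[ R\Bigl(x;\Bigl(\sum_{i=0}^{t}a_{-r+i}T_n^{(-r+i)}\Bigr)\otimes J_k\Bigr)=\sum_{\substack{\overline\gamma\in\bigcup_{l=rk}^{kt}G_{l,t}^{[k]}\\ \{\overline\gamma\}\supseteq\{1^{\langle k\rangle},2^{\langle k\rangle},\dots,r^{\langle k\rangle}\}}}\bigl(K_t^{[k]}(a_{-r}x,a_{-r+1}x,\dots,a_{-r+t}x)\bigr)^n\bigl[\mathbf L(1^{\langle k\rangle},\dots,r^{\langle k\rangle})\mid\mathbf L(\overline\gamma)\bigr], \] \[ \operatorname{per}\Bigl(\Bigl(\sum_{i=0}^{t}a_{-r+i}T_n^{(-r+i)}\Bigr)\otimes J_k\Bigr)=\bigl(\Pi_{rk,t}^{[k]}(a_{-r},\dots,a_{-r+t})\bigr)^n\bigl[\mathbf L(1^{\langle k\rangle},\dots,r^{\langle k\rangle})\mid\mathbf L(1^{\langle k\rangle},\dots,r^{\langle k\rangle})\bigr], \] \[ R\Bigl(x;\Bigl(\sum_{i=0}^{t}a_{-r+i}P_n^{-r+i}\Bigr)\otimes J_k\Bigr)=\operatorname{Tr}\Bigl(\bigl(K_t^{[k]}(a_{-r}x,\dots,a_{-r+t}x)\bigr)^n\Bigr), \] \[ \operatorname{per}\Bigl(\Bigl(\sum_{i=0}^{t}a_{-r+i}x^iP_n^{-r+i}\Bigr)\otimes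 J_k\Bigr)=\sum_{l=0}^{kt}\operatorname{Tr}\Bigl(\bigl(\Pi_{l,t}^{[k]}(a_{-r},\dots,a_{-r+t})\bigr)^n\Bigr)x^{ln}. \]
   Context: For $s\in\mathbb Z$, $T_n^{(s)}=(b_{i,j})_{1\le i,j\le n}$ with $b_{i,j}=1$ if $j-i=s$ and $0$ otherwise. $P_n=(c_{i,j})_{1\le i,j\le n}$ with $c_{i,j}=1$ if $j-i\equiv 1\pmod n$ and $0$ otherwise (a permutation matrix; negative powers are powers of its inverse). $J_k$ is the $k\times k$ all-ones matrix, $\otimes$ the Kronecker product. For an $m\times n$ matrix $A=(a_{i,j})$ with $m\le n$, $N_m=\{1,\dots,m\}$, the rook polynomial is $R(x;A)=1+\sum_{j=1}^m x^j\sum_{S\subseteq N_m,|S|=j}\sum_{\sigma}\prod_{i\in S}a_{i,\sigma(i)}$, the inner sum over injections $\sigma:S\to N_n$; $\operatorname{per}$ is the permanent. Notation: $i^{\langle l\rangle}$ denotes $i$ repeated $l$ times. $G_t^{[k]}=\{(1^{\langle l_1\rangle},2^{\langle l_2\rangle},\dots,t^{\langle l_t\rangle}):0\le l_i\le k\}$ and $G_{r,t}^{[k]}$ is its subset with $\sum l_i=r$ ($G_0^{[k]}=G_{0,0}^{[k]}=\{()\}$). For a vector $\overline\alpha$, $\{\overline\alpha\}$ is the multiset of its components, and $\supseteq$ is multiset inclusion. For a finite index set $X$ of size $N$, $\mathbf L$ denotes a fixed bijection $X\to N_N$, and for a matrix $M$ indexed by $X$, $M[i\mid j]$ is its $(i,j)$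 entry. The matrix $K_t^{[k]}(a_0,\dots,a_t)$, indexed by $G_t^{[k]}$: for $t=0$ it is the $1\times1$ matrix $\sum_{d=0}^k d!\binom kd^2a_0^d$. For $t\ge1$ and $\overline\alpha=(1^{\langle l_1\rangle},\dots,t^{\langle l_t\rangle})$, the entry $(\overline\alpha,\overline\beta)$ equals $\binom{l_1}{p_1}\cdots\binom{l_{t-1}}{p_{t-1}}\binom{k}{v-\sum_{i=1}^{t-1}p_i}a_0^{v-\sum p_i}a_1^{p_1}\cdots a_{t-1}^{p_{t-1}}\sum_{d=0}^{\min(l_t,k-v)}(d+v)!\binom{k}{d+v}\binom{l_t}{d}a_t^d$ if $\overline\beta=(1^{\langle k-v+\sum_{i=1}^{t-1}p_i\rangle},2^{\langle l_1-p_1\rangle},\dots,t^{\langle l_{t-1}-p_{t-1}\rangle})$ for some integers $0\le p_i\le l_i$ ($1\le i\le t-1$) and $\sum_{i=1}^{t-1}p_i\le v\le k$, and $0$ otherwise. The matrix $\Pi_{r,t}^{[k]}(a_0,\dots,a_t)$, indexed by $G_{r,t}^{[k]}$: $\Pi_{0,0}^{[k]}=k!\,a_0^k$; for $t\ge1$ and $\overline\alpha=(1^{\langle l_1\rangle},\dots,t^{\langle l_t\rangle})\in G_{r,t}^{[k]}$, the entry $(\overline\alpha,\overline\beta)$ equals $k!\binom{k}{l_t+\sum_{i=1}^{t-1}p_i}\binom{l_1}{p_1}\cdots\binom{l_{t-1}}{p_{t-1}}a_0^{k-l_t-\sum p_i}a_1^{p_1}\cdots a_{t-1}^{p_{t-1}}a_t^{l_t}$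 if $\overline\beta=(1^{\langle l_t+\sum_{i=1}^{t-1}p_i\rangle},2^{\langle l_1-p_1\rangle},\dots,t^{\langle l_{t-1}-p_{t-1}\rangle})$ with $0\le p_i\le l_i$ and $\sum_{i=1}^{t-1}p_i\le k-l_t$, and $0$ otherwise. *)

theory Defs
  imports "Jordan_Normal_Form.Matrix" "HOL-Computational_Algebra.Polynomial"
    "HOL-Library.Multiset" "HOL-Library.FuncSet" "HOL-Combinatorics.Permutations"
begin

text \<open>
  Matrices are those of \<^theory>\<open>Jordan_Normal_Form.Matrix\<close>, with rows and columns counted
  from \<open>0\<close>. The components of the vectors in \<open>G_set\<close> and the indices of the
  multiplicities \<open>l\<close> and of the \<open>p\<close> below start at \<open>1\<close>.
\<close>

section \<open>Banded and circulant matrices, permanents, rook polynomials\<close>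

definition T_mat :: "nat \<Rightarrow> int \<Rightarrow> 'a::comm_ring_1 mat" where
  "T_mat n s = mat n n (\<lambda>(i, j). if int j - int i = s then 1 else 0)"

definition P_mat :: "nat \<Rightarrow> 'a::comm_ring_1 mat" where
  "P_mat n = mat n n (\<lambda>(i, j). if (int j - int i) mod int n = 1 mod int n then 1 else 0)"

text \<open>
  Integer powers are those of the monoid of \<open>n \<times> n\<close> matrices; for negative exponents they
  involve the inverse in that monoid.
\<close>

definition P_pow :: "nat \<Rightarrow> int \<Rightarrow> 'a::comm_ring_1 mat" where
  "P_pow n s = P_mat n [^]\<^bsub>ring_mat TYPE('a) n ()\<^esub> s"

definition J_mat :: "nat \<Rightarrow> 'a::comm_ring_1 mat" where
  "J_mat k = mat k k (\<lambda>_. 1)"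

definition kronecker :: "'a::comm_ring_1 mat \<Rightarrow> 'a mat \<Rightarrow> 'a mat" (infixl "\<otimes>\<^sub>K" 70) where
  "A \<otimes>\<^sub>K B = mat (dim_row A * dim_row B) (dim_col A * dim_col B)
     (\<lambda>(i, j). A $$ (i div dim_row B, j div dim_col B) * B $$ (i mod dim_row B, j mod dim_col B))"

text \<open>Only meant for square matrices.\<close>

definition per :: "'a::comm_ring_1 mat \<Rightarrow> 'a" where
  "per A = (\<Sum>\<sigma> | \<sigma> permutes {..<dim_row A}. \<Prod>i<dim_row A. A $$ (i, \<sigma> i))"

definition trace_mat :: "'a::comm_ring_1 mat \<Rightarrow> 'a" where
  "trace_mat A = (\<Sum>i<dim_row A. A $$ (i, i))"

definition rook_poly :: "'a::comm_ring_1 mat \<Rightarrow> 'a poly" where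
  "rook_poly A = 1 + (\<Sum>j = 1..dim_row A.
     monom (\<Sum>S | S \<subseteq> {..<dim_row A} \<and> card S = j.
              \<Sum>\<sigma> | \<sigma> \<in> S \<rightarrow>\<^sub>E {..<dim_col A} \<and> inj_on \<sigma> S. \<Prod>i\<in>S. A $$ (i, \<sigma> i)) j)"

section \<open>Index sets\<close>

text \<open>\<open>rep_vec t l\<close> is the vector in which \<open>1, \<dots>, t\<close> are repeated \<open>l 1, \<dots>, l t\<close> times.\<close>

definition rep_vec :: "nat \<Rightarrow> (nat \<Rightarrow> nat) \<Rightarrow> nat list" where
  "rep_vec t l = concat (map (\<lambda>i. replicate (l i) i) [1..<Suc t])"

definition G_set :: "nat \<Rightarrow> nat \<Rightarrow> nat list set" where
  "G_set t k = {rep_vec t l | l. \<forall>i\<in>{1..t}. l i \<le> k}"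

definition G_sub :: "nat \<Rightarrow> nat \<Rightarrow> nat \<Rightarrow> nat list set" where
  "G_sub r t k = {rep_vec t l | l. (\<forall>i\<in>{1..t}. l i \<le> k) \<and> (\<Sum>i=1..t. l i) = r}"

text \<open>The matrix with entries \<open>f \<alpha> \<beta>\<close> for \<open>\<alpha>, \<beta> \<in> X\<close>, where \<open>L\<close> numbers the elements of \<open>X\<close>.\<close>

definition indexed_mat :: "('i \<Rightarrow> nat) \<Rightarrow> 'i set \<Rightarrow> ('i \<Rightarrow> 'i \<Rightarrow> 'a) \<Rightarrow> 'a mat" where
  "indexed_mat L X f =
     mat (card X) (card X) (\<lambda>(i, j). f (inv_into X L i) (inv_into X L j))"

section \<open>The matrices K and Pi\<close>

text \<open>
  The description of an entry in terms of \<open>p\<close> and \<open>v\<close> is unambiguous: \<open>\<beta>\<close> determines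
  \<open>p\<close> on \<open>{1..<t}\<close>, and \<open>v\<close>. This is proved below (\<open>K_entry_eq\<close>, \<open>Pi_entry_eq\<close>) and makes
  the definite descriptions in \<open>K_entry\<close> and \<open>Pi_entry\<close> meaningful.
\<close>

definition K_cond ::
    "nat \<Rightarrow> nat \<Rightarrow> nat list \<Rightarrow> nat list \<Rightarrow> (nat \<Rightarrow> nat) \<Rightarrow> nat \<Rightarrow> bool" where
  "K_cond k t \<alpha> \<beta> p v \<longleftrightarrow>
     (\<forall>i\<in>{1..<t}. p i \<le> count_list \<alpha> i) \<and> (\<Sum>i=1..<t. p i) \<le> v \<and> v \<le> k \<and>
     \<beta> = rep_vec t (\<lambda>i. if i = 1 then k - v + (\<Sum>j=1..<t. p j)
                        else count_list \<alpha> (i - 1) - p (i - 1))"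

definition K_val ::
    "nat \<Rightarrow> nat \<Rightarrow> (nat \<Rightarrow> 'a::comm_ring_1) \<Rightarrow> nat list \<Rightarrow> (nat \<Rightarrow> nat) \<Rightarrow> nat \<Rightarrow> 'a" where
  "K_val k t a \<alpha> p v =
     (\<Prod>i=1..<t. of_nat (count_list \<alpha> i choose p i)) *
     of_nat (k choose (v - (\<Sum>i=1..<t. p i))) *
     a 0 ^ (v - (\<Sum>i=1..<t. p i)) * (\<Prod>i=1..<t. a i ^ p i) *
     (\<Sum>d=0..min (count_list \<alpha> t) (k - v).
        of_nat (fact (d + v) * (k choose (d + v)) * (count_list \<alpha> t choose d)) * a t ^ d)"

definition K_entry ::
    "nat \<Rightarrow> nat \<Rightarrow> (nat \<Rightarrow> 'a::comm_ring_1) \<Rightarrow> nat list \<Rightarrow> nat list \<Rightarrow> 'a" where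
  "K_entry k t a \<alpha> \<beta> =
     (if t = 0 then \<Sum>d=0..k. of_nat (fact d * (k choose d) ^ 2) * a 0 ^ d
      else if \<exists>p v. K_cond k t \<alpha> \<beta> p v
        then THE y. \<exists>p v. K_cond k t \<alpha> \<beta> p v \<and> y = K_val k t a \<alpha> p v
      else 0)"

definition K_mat :: "(nat list set \<Rightarrow> nat list \<Rightarrow> nat) \<Rightarrow> nat \<Rightarrow> nat \<Rightarrow>
    (nat \<Rightarrow> 'a::comm_ring_1) \<Rightarrow> 'a mat" where
  "K_mat L k t a = indexed_mat (L (G_set t k)) (G_set t k) (K_entry k t a)"

definition Pi_cond :: "nat \<Rightarrow> nat \<Rightarrow> nat list \<Rightarrow> nat list \<Rightarrow> (nat \<Rightarrow> nat) \<Rightarrow> bool" where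
  "Pi_cond k t \<alpha> \<beta> p \<longleftrightarrow>
     (\<forall>i\<in>{1..<t}. p i \<le> count_list \<alpha> i) \<and> (\<Sum>i=1..<t. p i) \<le> k - count_list \<alpha> t \<and>
     \<beta> = rep_vec t (\<lambda>i. if i = 1 then count_list \<alpha> t + (\<Sum>j=1..<t. p j)
                        else count_list \<alpha> (i - 1) - p (i - 1))"

definition Pi_val ::
    "nat \<Rightarrow> nat \<Rightarrow> (nat \<Rightarrow> 'a::comm_ring_1) \<Rightarrow> nat list \<Rightarrow> (nat \<Rightarrow> nat) \<Rightarrow> 'a" where
  "Pi_val k t a \<alpha> p =
     of_nat (fact k * (k choose (count_list \<alpha> t + (\<Sum>i=1..<t. p i)))) *
     (\<Prod>i=1..<t. of_nat (count_list \<alpha> i choose p i)) *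
     a 0 ^ (k - count_list \<alpha> t - (\<Sum>i=1..<t. p i)) *
     (\<Prod>i=1..<t. a i ^ p i) * a t ^ count_list \<alpha> t"

definition Pi_entry ::
    "nat \<Rightarrow> nat \<Rightarrow> (nat \<Rightarrow> 'a::comm_ring_1) \<Rightarrow> nat list \<Rightarrow> nat list \<Rightarrow> 'a" where
  "Pi_entry k t a \<alpha> \<beta> =
     (if t = 0 then of_nat (fact k) * a 0 ^ k
      else if \<exists>p. Pi_cond k t \<alpha> \<beta> p
        then THE y. \<exists>p. Pi_cond k t \<alpha> \<beta> p \<and> y = Pi_val k t a \<alpha> p
      else 0)"

definition Pi_mat :: "(nat list set \<Rightarrow> nat list \<Rightarrow> nat) \<Rightarrow> nat \<Rightarrow> nat \<Rightarrow> nat \<Rightarrow>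
    (nat \<Rightarrow> 'a::comm_ring_1) \<Rightarrow> 'a mat" where
  "Pi_mat L k r t a = indexed_mat (L (G_sub r t k)) (G_sub r t k) (Pi_entry k t a)"

section \<open>Well-definedness of the entries\<close>

lemma count_list_rep_vec:
  assumes "1 \<le> i" "i \<le> t"
  shows "count_list (rep_vec t l) i = l i"
proof -
  have rep: "count_list (replicate m x) i = (if x = i then m else 0)" for m x
    by (induction m) auto
  have "count_list (rep_vec t l) i = (if 1 \<le> i \<and> i \<le> t then l i else 0)"
    unfolding rep_vec_def by (induction t) (auto simp: rep)
  then show ?thesis using assms by simp
qed

lemma rep_vec_eqD:
  assumes "rep_vec t l = rep_vec t l'" "1 \<le> i" "i \<le> t"
  shows "l i = l' i"
  using assms count_list_rep_vec by metis

lemma K_cond_unique: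
  assumes "K_cond k t \<alpha> \<beta> p v" "K_cond k t \<alpha> \<beta> p' v'" "t > 0"
  shows "\<forall>i\<in>{1..<t}. p i = p' i" "v = v'"
proof -
  let ?l = "\<lambda>p v i. if i = 1 then k - v + (\<Sum>j=1..<t. p j)
                        else count_list \<alpha> (i - 1) - p (i - 1)"
  have eq: "rep_vec t (?l p v) = rep_vec t (?l p' v')"
    using assms unfolding K_cond_def by metis
  show p: "\<forall>i\<in>{1..<t}. p i = p' i"
  proof
    fix i assume i: "i \<in> {1..<t}"
    have "?l p v (i + 1) = ?l p' v' (i + 1)"
      by (rule rep_vec_eqD[OF eq]) (use i in auto)
    moreover have "p i \<le> count_list \<alpha> i" "p' i \<le> count_list \<alpha> i"
      using assms i unfolding K_cond_def by auto
    ultimately show "p i = p' i" using i by simp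
  qed
  have "?l p v 1 = ?l p' v' 1"
    by (rule rep_vec_eqD[OF eq]) (use assms in auto)
  moreover have "(\<Sum>j=1..<t. p j) = (\<Sum>j=1..<t. p' j)"
    by (rule sum.cong) (use p in auto)
  moreover have "v \<le> k" "v' \<le> k" using assms unfolding K_cond_def by auto
  ultimately show "v = v'" by simp
qed

lemma K_val_cong:
  assumes "\<forall>i\<in>{1..<t}. p i = p' i"
  shows "K_val k t a \<alpha> p v = K_val k t a \<alpha> p' v"
proof -
  have "(\<Sum>i=1..<t. p i) = (\<Sum>i=1..<t. p' i)"
    by (rule sum.cong) (use assms in auto)
  moreover have "(\<Prod>i=1..<t. of_nat (count_list \<alpha> i choose p i)) =
      (\<Prod>i=1..<t. of_nat (count_list \<alpha> i choose p' i) :: 'a)"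
    by (rule prod.cong) (use assms in auto)
  moreover have "(\<Prod>i=1..<t. a i ^ p i) = (\<Prod>i=1..<t. a i ^ p' i)"
    by (rule prod.cong) (use assms in auto)
  ultimately show ?thesis unfolding K_val_def by simp
qed

lemma K_entry_eq:
  assumes "K_cond k t \<alpha> \<beta> p v" "t > 0"
  shows "K_entry k t a \<alpha> \<beta> = K_val k t a \<alpha> p v"
proof -
  have "(THE y. \<exists>p v. K_cond k t \<alpha> \<beta> p v \<and> y = K_val k t a \<alpha> p v) = K_val k t a \<alpha> p v"
  proof (rule the_equality)
    show "\<exists>p' v'. K_cond k t \<alpha> \<beta> p' v' \<and> K_val k t a \<alpha> p v = K_val k t a \<alpha> p' v'"
      using assms by blast
    fix y assume "\<exists>p v. K_cond k t \<alpha> \<beta> p v \<and> y = K_val k t a \<alpha> p v"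
    then obtain p' v' where "K_cond k t \<alpha> \<beta> p' v'" "y = K_val k t a \<alpha> p' v'" by blast
    then show "y = K_val k t a \<alpha> p v"
      using K_cond_unique[OF assms(1) _ assms(2)] K_val_cong[of t p p' k a \<alpha> v] by simp
  qed
  then show ?thesis using assms unfolding K_entry_def by auto
qed

lemma Pi_cond_unique:
  assumes "Pi_cond k t \<alpha> \<beta> p" "Pi_cond k t \<alpha> \<beta> p'"
  shows "\<forall>i\<in>{1..<t}. p i = p' i"
proof
  let ?l = "\<lambda>p i. if i = 1 then count_list \<alpha> t + (\<Sum>j=1..<t. p j)
                        else count_list \<alpha> (i - 1) - p (i - 1)"
  have eq: "rep_vec t (?l p) = rep_vec t (?l p')"
    using assms unfolding Pi_cond_def by metis
  fix i assume i: "i \<in> {1..<t}"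
  have "?l p (i + 1) = ?l p' (i + 1)"
    by (rule rep_vec_eqD[OF eq]) (use i in auto)
  moreover have "p i \<le> count_list \<alpha> i" "p' i \<le> count_list \<alpha> i"
    using assms i unfolding Pi_cond_def by auto
  ultimately show "p i = p' i" using i by simp
qed

lemma Pi_val_cong:
  assumes "\<forall>i\<in>{1..<t}. p i = p' i"
  shows "Pi_val k t a \<alpha> p = Pi_val k t a \<alpha> p'"
proof -
  have "(\<Sum>i=1..<t. p i) = (\<Sum>i=1..<t. p' i)"
    by (rule sum.cong) (use assms in auto)
  moreover have "(\<Prod>i=1..<t. of_nat (count_list \<alpha> i choose p i)) =
      (\<Prod>i=1..<t. of_nat (count_list \<alpha> i choose p' i) :: 'a)"
    by (rule prod.cong) (use assms in auto)
  moreover have "(\<Prod>i=1..<t. a i ^ p i) = (\<Prod>i=1..<t. a i ^ p' i)"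
    by (rule prod.cong) (use assms in auto)
  ultimately show ?thesis unfolding Pi_val_def by simp
qed

lemma Pi_entry_eq:
  assumes "Pi_cond k t \<alpha> \<beta> p" "t > 0"
  shows "Pi_entry k t a \<alpha> \<beta> = Pi_val k t a \<alpha> p"
proof -
  have "(THE y. \<exists>p. Pi_cond k t \<alpha> \<beta> p \<and> y = Pi_val k t a \<alpha> p) = Pi_val k t a \<alpha> p"
  proof (rule the_equality)
    show "\<exists>p'. Pi_cond k t \<alpha> \<beta> p' \<and> Pi_val k t a \<alpha> p = Pi_val k t a \<alpha> p'"
      using assms by blast
    fix y assume "\<exists>p. Pi_cond k t \<alpha> \<beta> p \<and> y = Pi_val k t a \<alpha> p"
    then obtain p' where "Pi_cond k t \<alpha> \<beta> p'" "y = Pi_val k t a \<alpha> p'" by blast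
    then show "y = Pi_val k t a \<alpha> p"
      using Pi_cond_unique[OF assms(1)] Pi_val_cong by metis
  qed
  then show ?thesis using assms unfolding Pi_entry_def by auto
qed

end

theory Submission
  imports Defs "HOL-Number_Theory.Cong"
begin

text \<open>
  Rows and columns are grouped in blocks of size \<open>k\<close>, and only the number of free columns in
  each block matters. Expanding along a block row amounts to applying the operator
  \<open>(u + \<Sum> c\<^sub>i D\<^sub>i)\<^sup>k\<close>, where \<open>D\<^sub>i\<close> uses up one column of a block; in normal order
  this is a sum over the numbers \<open>q\<^sub>i\<close> of columns taken from each block. For a band matrix the
  blocks that are partly used form a window of width \<open>t\<close>, so that the process is governed by a
  transfer matrix on the vectors of free column numbers, which is \<open>K\<close> for rook sums and, split
  by the total number of free columns, \<open>\<Pi>\<close> for permanents.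
  In the circulant case the choices \<open>q\<close> determine the closed walk, and its weight agrees with
  that of the row expansion because products of binomial coefficients along a column block
  are multinomial coefficients and do not depend on the order of the steps.
\<close>

section \<open>Rook sums and their row expansion\<close>

text \<open>The claim covers every n >= 1, and the case n <= t shapes the proof. Distinct shifts may
  then agree modulo n, so a block row reaches one column block by several edges, and a state of the
  circulant process lists the same block several times, possibly with different counts. Edges, not
  column blocks, are therefore the units of bookkeeping. The picture behind the circulant case is
  the periodic lift to the integers: a lifted block stays in reach for t + 1 rows and is used once
  by each edge. Its class modulo n is used by the same t + 1 pairs of row and edge, but in the
  cyclic order cut at row 0. As the ring has no division, independence of this order is shown for
  natural numbers, where factorials can be cancelled, and only then mapped into the ring.

  The factor (d + v)! (k choose d + v) of \<open>K\<close> comes from the normal order. Splitting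
  the rows among the edges gives a multinomial coefficient, matching q rows with q columns gives q!,
  and these factorials cancel the denominators; what remains is the number of injections from the
  used columns into the k rows.\<close>

lemma sum_PiE_insert:
  assumes "x \<notin> A"
  shows "(\<Sum>q\<in>PiE (insert x A) B. f q) = (\<Sum>m\<in>B x. \<Sum>q\<in>PiE A B. f (q(x := m)))"
proof -
  have "(\<Sum>q\<in>PiE (insert x A) B. f q)
      = (\<Sum>(m, q)\<in>B x \<times> PiE A B. f (q(x := m)))"
    unfolding PiE_insert_eq using inj_combinator[OF assms, of B]
    by (subst sum.reindex) (auto simp: case_prod_unfold)
  then show ?thesis by (simp add: sum.cartesian_product)
qed

definition inj_maps :: "'i set \<Rightarrow> 'j set \<Rightarrow> ('i \<Rightarrow> 'j) set" where
  "inj_maps S J = {\<sigma>. \<sigma> \<in> S \<rightarrow>\<^sub>E J \<and> inj_on \<sigma> S}"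

lemma finite_inj_maps [simp]: "finite S \<Longrightarrow> finite J \<Longrightarrow> finite (inj_maps S J)"
  unfolding inj_maps_def by (rule finite_subset[OF _ finite_PiE[of S "\<lambda>_. J"]]) auto

lemma sum_inj_maps_insert:
  assumes "finite S" "finite J" "i \<notin> S"
  shows "(\<Sum>\<sigma>\<in>inj_maps (insert i S) J. f \<sigma>)
    = (\<Sum>j\<in>J. \<Sum>\<sigma>\<in>inj_maps S (J - {j}). f (\<sigma>(i := j)))"
proof -
  have "(\<Sum>\<sigma>\<in>inj_maps (insert i S) J. f \<sigma>)
      = (\<Sum>(j, \<sigma>)\<in>(SIGMA j:J. inj_maps S (J - {j})). f (\<sigma>(i := j)))"
  proof (rule sum.reindex_bij_witness[where
        j = "\<lambda>\<sigma>. (\<sigma> i, \<sigma>(i := undefined))" and i = "\<lambda>p. (snd p)(i := fst p)"])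
    fix \<sigma> assume s: "\<sigma> \<in> inj_maps (insert i S) J"
    then have ext: "\<sigma> \<in> insert i S \<rightarrow>\<^sub>E J" and inj: "inj_on \<sigma> S" "\<sigma> i \<notin> \<sigma> ` S"
      using assms by (auto simp: inj_maps_def)
    have "\<sigma>(i := undefined) \<in> S \<rightarrow>\<^sub>E (J - {\<sigma> i})"
      using ext inj(2) assms(3) by (intro PiE_I) (auto simp: PiE_iff extensional_def image_iff)
    moreover have "inj_on (\<sigma>(i := undefined)) S"
      using inj(1) assms(3) by (auto simp: inj_on_def)
    ultimately show "(\<sigma> i, \<sigma>(i := undefined)) \<in> (SIGMA j:J. inj_maps S (J - {j}))"
      using ext by (auto simp: inj_maps_def)
  next
    fix p assume p: "p \<in> (SIGMA j:J. inj_maps S (J - {j}))"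
    obtain j \<sigma> where [simp]: "p = (j, \<sigma>)" by fastforce
    have j: "j \<in> J" and ext: "\<sigma> \<in> S \<rightarrow>\<^sub>E (J - {j})" and inj: "inj_on \<sigma> S"
      using p by (auto simp: inj_maps_def)
    have "\<sigma>(i := j) \<in> insert i S \<rightarrow>\<^sub>E J"
      using j ext by (intro PiE_I) (auto simp: PiE_iff extensional_def)
    moreover have "inj_on (\<sigma>(i := j)) (insert i S)"
      using inj ext assms(3) by (auto simp: inj_on_def PiE_iff)
    ultimately show "(snd p)(i := fst p) \<in> inj_maps (insert i S) J"
      by (simp add: inj_maps_def)
    have "\<sigma> i = undefined" using ext assms(3) by (auto simp: PiE_iff extensional_def)
    then show "(((snd p)(i := fst p)) i, ((snd p)(i := fst p))(i := undefined)) = p"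
      by auto
  qed (auto simp: case_prod_unfold)
  also have "\<dots> = (\<Sum>j\<in>J. \<Sum>\<sigma>\<in>inj_maps S (J - {j}). f (\<sigma>(i := j)))"
    using assms by (subst sum.Sigma) auto
  finally show ?thesis .
qed

text \<open>The two marks make the rook polynomial and the permanent instances of one sum: if both
  are 1, every partial placement counts, and if both are 0, the convention \<open>0 ^ 0 = 1\<close>
  keeps only the placements that fill all rows and columns.\<close>

definition rook_sum ::
    "'b \<Rightarrow> 'b \<Rightarrow> 'i set \<Rightarrow> 'j set \<Rightarrow> ('i \<Rightarrow> 'j \<Rightarrow> 'b) \<Rightarrow> 'b::comm_ring_1" where
  "rook_sum u v I J b = (\<Sum>S\<in>Pow I. \<Sum>\<sigma>\<in>inj_maps S J.
     u ^ card (I - S) * v ^ card (J - \<sigma> ` S) * (\<Prod>i\<in>S. b i (\<sigma> i)))"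

lemma inj_maps_empty [simp]: "inj_maps {} J = {\<lambda>_. undefined}"
  by (auto simp: inj_maps_def)

lemma rook_sum_empty: "rook_sum u v {} J b = v ^ card J"
  by (simp add: rook_sum_def)

text \<open>A placement leaves row \<open>i\<close> empty or puts a rook on some column
  \<open>j\<close>. In the second case \<open>j\<close> disappears from the column set, so
  \<open>v\<close> still marks the right columns.\<close>

lemma rook_sum_insert:
  assumes fin: "finite I" "finite J" and i: "i \<notin> I"
  shows "rook_sum u v (insert i I) J b
    = u * rook_sum u v I J b + (\<Sum>j\<in>J. b i j * rook_sum u v I (J - {j}) b)"
proof -
  let ?g = "\<lambda>I J S \<sigma>. u ^ card (I - S) * v ^ card (J - \<sigma> ` S) * (\<Prod>i\<in>S. b i (\<sigma> i))"
  have inj: "inj_on (insert i) (Pow I)" using i by (auto simp: inj_on_def)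
  have disj: "Pow I \<inter> insert i ` Pow I = {}" using i by auto
  have "rook_sum u v (insert i I) J b
      = (\<Sum>S\<in>Pow I. \<Sum>\<sigma>\<in>inj_maps S J. ?g (insert i I) J S \<sigma>)
      + (\<Sum>S\<in>insert i ` Pow I. \<Sum>\<sigma>\<in>inj_maps S J. ?g (insert i I) J S \<sigma>)"
    unfolding rook_sum_def Pow_insert by (rule sum.union_disjoint) (use fin disj in auto)
  also have "(\<Sum>S\<in>Pow I. \<Sum>\<sigma>\<in>inj_maps S J. ?g (insert i I) J S \<sigma>) = u * rook_sum u v I J b"
    unfolding rook_sum_def sum_distrib_left
  proof (intro sum.cong refl)
    fix S \<sigma> assume "S \<in> Pow I"
    then have "insert i I - S = insert i (I - S)" using i by auto
    then show "?g (insert i I) J S \<sigma> = u * ?g I J S \<sigma>" using fin i by simp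
  qed
  also have "(\<Sum>S\<in>insert i ` Pow I. \<Sum>\<sigma>\<in>inj_maps S J. ?g (insert i I) J S \<sigma>)
      = (\<Sum>S\<in>Pow I. \<Sum>j\<in>J. \<Sum>\<sigma>\<in>inj_maps S (J - {j}). b i j * ?g I (J - {j}) S \<sigma>)"
  proof (subst sum.reindex[OF inj], rule sum.cong[OF refl], unfold o_def)
    fix S assume S: "S \<in> Pow I"
    then have fS: "finite S" "i \<notin> S" using fin i finite_subset by auto
    show "(\<Sum>\<sigma>\<in>inj_maps (insert i S) J. ?g (insert i I) J (insert i S) \<sigma>)
        = (\<Sum>j\<in>J. \<Sum>\<sigma>\<in>inj_maps S (J - {j}). b i j * ?g I (J - {j}) S \<sigma>)"
      unfolding sum_inj_maps_insert[OF fS(1) fin(2) fS(2)]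
    proof (intro sum.cong refl)
      fix j \<sigma>
      have "insert i I - insert i S = I - S" using i by auto
      moreover have "(\<sigma>(i := j)) ` insert i S = insert j (\<sigma> ` S)" for \<sigma> :: "'a \<Rightarrow> 'b" using fS(2) by (auto simp: fun_upd_image)
      then have "J - (\<sigma>(i := j)) ` insert i S = J - {j} - \<sigma> ` S" by auto
      moreover have "(\<Prod>x\<in>insert i S. b x ((\<sigma>(i := j)) x)) = b i j * (\<Prod>x\<in>S. b x (\<sigma> x))"
        using fS by (auto intro!: arg_cong2[where f = "(*)"] prod.cong)
      ultimately show "?g (insert i I) J (insert i S) (\<sigma>(i := j)) = b i j * ?g I (J - {j}) S \<sigma>"
        by (simp add: mult_ac)
    qed
  qed
  also have "\<dots> = (\<Sum>j\<in>J. b i j * rook_sum u v I (J - {j}) b)"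
    by (subst sum.swap) (simp add: rook_sum_def sum_distrib_left)
  finally show ?thesis .
qed

text \<open>
  The identically labelled columns of a block enter only through the number of those that are
  still free; \<open>row_op\<close> removes one row whose edges \<open>e < T\<close> lead to the column blocks \<open>tgt e\<close>.
\<close>

definition row_op :: "'b \<Rightarrow> nat \<Rightarrow> (nat \<Rightarrow> 'b) \<Rightarrow> (nat \<Rightarrow> nat) \<Rightarrow>
    ((nat \<Rightarrow> nat) \<Rightarrow> 'b) \<Rightarrow> (nat \<Rightarrow> nat) \<Rightarrow> 'b::comm_ring_1" where
  "row_op u T c tgt f s =
     u * f s + (\<Sum>e<T. of_nat (s (tgt e)) * c e * f (s(tgt e := s (tgt e) - 1)))"

text \<open>The operator of the last block row is outermost because rows are removed from the last
  to the first. \<open>Y\<close> lists the blocks whose leftover columns are charged at the end; it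
  may contain blocks without columns.\<close>

primrec block_rook :: "'b \<Rightarrow> 'b \<Rightarrow> nat \<Rightarrow> nat \<Rightarrow> (nat \<Rightarrow> 'b) \<Rightarrow> (nat \<Rightarrow> nat \<Rightarrow> nat) \<Rightarrow> nat set \<Rightarrow>
    nat \<Rightarrow> (nat \<Rightarrow> nat) \<Rightarrow> 'b::comm_ring_1" where
  "block_rook u v k T c tgt Y 0 = (\<lambda>s. v ^ (\<Sum>y\<in>Y. s y))"
| "block_rook u v k T c tgt Y (Suc x) =
     (row_op u T c (tgt x) ^^ k) (block_rook u v k T c tgt Y x)"

definition block_count :: "('j \<Rightarrow> nat) \<Rightarrow> 'j set \<Rightarrow> nat \<Rightarrow> nat" where
  "block_count cb J y = card {j\<in>J. cb j = y}"

lemma block_count_remove: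
  assumes "finite J" "j \<in> J"
  shows "block_count cb (J - {j}) = (block_count cb J)(cb j := block_count cb J (cb j) - 1)"
proof
  fix y
  have "{i \<in> J - {j}. cb i = y} = {i \<in> J. cb i = y} - (if cb j = y then {j} else {})"
    using assms by auto
  then show "block_count cb (J - {j}) y
      = ((block_count cb J)(cb j := block_count cb J (cb j) - 1)) y"
    using assms by (auto simp: block_count_def)
qed

lemma sum_block_count:
  assumes "finite J" "finite Y" "cb ` J \<subseteq> Y"
  shows "(\<Sum>y\<in>Y. block_count cb J y) = card J"
proof -
  have "(\<Sum>y\<in>Y. \<Sum>j\<in>{j\<in>J. cb j = y}. 1) = (\<Sum>j\<in>J. 1 :: nat)"
    by (rule sum.group) (use assms in auto)
  then show ?thesis by (simp add: block_count_def)
qed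

text \<open>Exchanging the two sums counts, for each edge, the free columns of its target. Edges
  with the same target contribute separately, as a matrix entry is the sum of their
  coefficients.\<close>

lemma sum_remove_column:
  fixes c :: "nat \<Rightarrow> 'b::comm_ring_1"
  assumes "finite J"
  shows "(\<Sum>j\<in>J. (\<Sum>e<T. if tgt e = cb j then c e else 0) * f (block_count cb (J - {j})))
    = (\<Sum>e<T. of_nat (block_count cb J (tgt e)) * c e *
         f ((block_count cb J)(tgt e := block_count cb J (tgt e) - 1)))"
proof -
  let ?s = "block_count cb J"
  have "(\<Sum>j\<in>J. (\<Sum>e<T. if tgt e = cb j then c e else 0) * f (block_count cb (J - {j})))
      = (\<Sum>j\<in>J. \<Sum>e<T. if tgt e = cb j then c e * f (?s(tgt e := ?s (tgt e) - 1)) else 0)"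
    by (auto simp: sum_distrib_right block_count_remove assms intro!: sum.cong)
  also have "\<dots> = (\<Sum>e<T. \<Sum>j\<in>J. if cb j = tgt e then c e * f (?s(tgt e := ?s (tgt e) - 1)) else 0)"
    by (subst sum.swap) (auto intro!: sum.cong)
  also have "\<dots> = (\<Sum>e<T. of_nat (?s (tgt e)) * c e * f (?s(tgt e := ?s (tgt e) - 1)))"
    using assms by (intro sum.cong refl) (simp add: sum.inter_filter[symmetric] block_count_def mult.assoc)
  finally show ?thesis .
qed

lemma rook_sum_eq_block_rook:
  fixes c :: "nat \<Rightarrow> 'b::comm_ring_1"
  assumes Y: "finite Y" and J: "finite J" "cb ` J \<subseteq> Y"
    and b: "\<And>i j. i < n * k \<Longrightarrow> b i j = (\<Sum>e<T. if tgt (i div k) e = cb j then c e else 0)"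
  shows "rook_sum u v {..<n * k} J b = block_rook u v k T c tgt Y n (block_count cb J)"
proof -
  \<comment> \<open>A partially removed block: its first \<open>m\<close> rows are left. They all
    have the same targets, so one operator is iterated; the third premise supplies the result for
    the complete blocks below.\<close>
  have *: "rook_sum u v {..<x * k + m} J b
      = (row_op u T c (tgt x) ^^ m) (block_rook u v k T c tgt Y x) (block_count cb J)"
    if "m \<le> k" "x * k + m \<le> n * k"
      "\<And>J. finite J \<Longrightarrow> cb ` J \<subseteq> Y \<Longrightarrow> rook_sum u v {..<x * k} J b
        = block_rook u v k T c tgt Y x (block_count cb J)"
      "finite J" "cb ` J \<subseteq> Y" for x m J
    using that(1,2,4,5)
  proof (induction m arbitrary: J)
    case 0
    then show ?case using that(3) by simp
  next
    case (Suc m)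
    let ?i = "x * k + m" and ?f = "(row_op u T c (tgt x) ^^ m) (block_rook u v k T c tgt Y x)"
    have div: "?i div k = x" using Suc.prems by simp
    have "rook_sum u v (insert ?i {..<?i}) J b = u * rook_sum u v {..<?i} J b
        + (\<Sum>j\<in>J. b ?i j * rook_sum u v {..<?i} (J - {j}) b)"
      by (rule rook_sum_insert) (use Suc.prems in auto)
    also have "rook_sum u v {..<?i} J b = ?f (block_count cb J)"
      using Suc by auto
    also have "(\<Sum>j\<in>J. b ?i j * rook_sum u v {..<?i} (J - {j}) b)
        = (\<Sum>j\<in>J. (\<Sum>e<T. if tgt x e = cb j then c e else 0) * ?f (block_count cb (J - {j})))"
    proof (intro sum.cong refl)
      fix j assume "j \<in> J"
      have "rook_sum u v {..<?i} (J - {j}) b = ?f (block_count cb (J - {j}))"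
        using Suc.prems by (intro Suc.IH) auto
      then show "b ?i j * rook_sum u v {..<?i} (J - {j}) b
          = (\<Sum>e<T. if tgt x e = cb j then c e else 0) * ?f (block_count cb (J - {j}))"
        using b[of ?i j] div Suc.prems by simp
    qed
    also have "\<dots> = (\<Sum>e<T. of_nat (block_count cb J (tgt x e)) * c e *
         ?f ((block_count cb J)(tgt x e := block_count cb J (tgt x e) - 1)))"
      using Suc.prems by (intro sum_remove_column)
    finally show ?case
      by (simp only: funpow.simps o_apply lessThan_Suc add_Suc_right
        row_op_def[of u T c "tgt x" ?f])
  qed
  have "rook_sum u v {..<x * k} J b = block_rook u v k T c tgt Y x (block_count cb J)"
    if "x \<le> n" "finite J" "cb ` J \<subseteq> Y" for x J
    using that
  proof (induction x arbitrary: J)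
    case 0
    then show ?case using Y by (simp add: rook_sum_empty sum_block_count)
  next
    case (Suc x)
    have "Suc x * k \<le> n * k" using Suc.prems(1) by (rule mult_le_mono1)
    then show ?case using *[of k x J] Suc by (simp add: add.commute)
  qed
  then show ?thesis using J by simp
qed

section \<open>Normal ordering of a block of rows\<close>

text \<open>The lowering operators of the edges commute, also for a common target, so the power of a
  row operator can be sorted by edges with the binomial theorem. The last edge claims
  \<open>m\<close> of the \<open>b\<close> rows together with \<open>m\<close> columns in some
  matching, and the other edges share the remaining rows.\<close>

primrec edge_sum :: "'b \<Rightarrow> (nat \<Rightarrow> 'b) \<Rightarrow> (nat \<Rightarrow> nat) \<Rightarrow> ((nat \<Rightarrow> nat) \<Rightarrow> 'b) \<Rightarrow>
    nat \<Rightarrow> nat \<Rightarrow> (nat \<Rightarrow> nat) \<Rightarrow> 'b::comm_ring_1" where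
  "edge_sum u c tgt g 0 b s = u ^ b * g s"
| "edge_sum u c tgt g (Suc T) b s =
     (\<Sum>m\<le>b. of_nat ((b choose m) * (s (tgt T) choose m) * fact m) * c T ^ m *
        edge_sum u c tgt g T (b - m) (s(tgt T := s (tgt T) - m)))"

lemma edge_sum_0: "edge_sum u c tgt g T 0 s = g s"
  by (induction T arbitrary: s) auto

lemma choose_fact_Suc:
  "(s choose Suc m) * fact (Suc m) = s * ((s - 1 choose m) * fact m :: nat)"
proof (cases s)
  case (Suc n)
  have "(Suc n choose Suc m) * (Suc m * fact m) = Suc n * ((n choose m) * fact m)"
    by (metis Suc_times_binomial_eq mult.assoc)
  then show ?thesis using Suc by simp
qed simp

lemma choose_diff_mult: "(s choose m) * (s - m) = s * (s - 1 choose m :: nat)"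
  by (metis binomial_absorb_comp mult.commute)

text \<open>One more row acts on the sorted form exactly like the row operator. The new row either
  belongs to the last edge or is left to the earlier edges, where induction applies; Pascal's rule
  separates the two cases.\<close>

lemma edge_sum_Suc:
  "edge_sum u c tgt g T (Suc b) s = u * edge_sum u c tgt g T b s +
     (\<Sum>e<T. of_nat (s (tgt e)) * c e * edge_sum u c tgt g T b (s(tgt e := s (tgt e) - 1)))"
proof (induction T arbitrary: b s)
  case 0
  show ?case by simp
next
  case (Suc T)
  let ?E = "edge_sum u c tgt g T" and ?y = "tgt T"
  let ?w = "\<lambda>b s m. of_nat ((b choose m) * (s ?y choose m) * fact m) * c T ^ m"
  let ?r = "\<lambda>s y m. s(y := s y - m)"
  have "edge_sum u c tgt g (Suc T) (Suc b) s
      = ?E (Suc b) s + (\<Sum>m\<le>b. ?w (Suc b) s (Suc m) * ?E (b - m) (?r s ?y (Suc m)))"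
    by (simp add: sum.atMost_Suc_shift del: sum.atMost_Suc)
  \<comment> \<open>Pascal's rule: \<open>b choose Suc m\<close> counts the selections that avoid
    the new row, \<open>b choose m\<close> those that contain it.\<close>
  also have "(\<Sum>m\<le>b. ?w (Suc b) s (Suc m) * ?E (b - m) (?r s ?y (Suc m)))
      = (\<Sum>m\<le>b. ?w b s (Suc m) * ?E (b - m) (?r s ?y (Suc m)))
      + (\<Sum>m\<le>b. of_nat ((b choose m) * (s ?y choose Suc m) * fact (Suc m)) * c T ^ Suc m
          * ?E (b - m) (?r s ?y (Suc m)))"
    unfolding sum.distrib[symmetric] by (intro sum.cong refl) (simp add: algebra_simps)
  also have "(\<Sum>m\<le>b. of_nat ((b choose m) * (s ?y choose Suc m) * fact (Suc m)) * c T ^ Suc m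
          * ?E (b - m) (?r s ?y (Suc m)))
      = of_nat (s ?y) * c T * edge_sum u c tgt g (Suc T) b (?r s ?y 1)"
  proof -
    have "of_nat ((b choose m) * (s ?y choose Suc m) * fact (Suc m)) * c T ^ Suc m
          * ?E (b - m) (?r s ?y (Suc m)) = of_nat (s ?y) * c T *
          (?w b (?r s ?y 1) m * ?E (b - m) (?r (?r s ?y 1) ?y m))" for m
    proof -
      have "(b choose m) * (s ?y choose Suc m) * fact (Suc m)
          = s ?y * ((b choose m) * (s ?y - 1 choose m) * fact m)"
        using choose_fact_Suc[of "s ?y" m] by (metis mult.assoc mult.left_commute)
      then have "of_nat ((b choose m) * (s ?y choose Suc m) * fact (Suc m))
          = (of_nat (s ?y) * of_nat ((b choose m) * (s ?y - 1 choose m) * fact m) :: 'a)"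
        by (metis of_nat_mult)
      moreover have "?r (?r s ?y 1) ?y m = ?r s ?y (Suc m)" by simp
      ultimately show ?thesis by (simp del: of_nat_mult fact_Suc add: algebra_simps)
    qed
    then show ?thesis by (simp add: sum_distrib_left del: fact_Suc)
  qed
  \<comment> \<open>The selections that avoid the new row rejoin the term for \<open>m = 0\<close>.
    The term for \<open>m = Suc b\<close> vanishes because of \<open>b choose Suc b = 0\<close>; in
    all others \<open>Suc b - m\<close> is \<open>Suc (b - m)\<close>, ready for the induction
    hypothesis.\<close>
  also have "?E (Suc b) s + ((\<Sum>m\<le>b. ?w b s (Suc m) * ?E (b - m) (?r s ?y (Suc m)))
        + of_nat (s ?y) * c T * edge_sum u c tgt g (Suc T) b (?r s ?y 1))
      = (\<Sum>m\<le>b. ?w b s m * ?E (Suc (b - m)) (?r s ?y m))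
        + of_nat (s ?y) * c T * edge_sum u c tgt g (Suc T) b (?r s ?y 1)"
  proof -
    have "(\<Sum>m\<le>b. ?w b s m * ?E (Suc (b - m)) (?r s ?y m))
        = (\<Sum>m\<le>Suc b. ?w b s m * ?E (Suc b - m) (?r s ?y m))"
      by (simp add: Suc_diff_le binomial_eq_0)
    also have "\<dots> = ?E (Suc b) s + (\<Sum>m\<le>b. ?w b s (Suc m) * ?E (b - m) (?r s ?y (Suc m)))"
      by (simp add: sum.atMost_Suc_shift del: sum.atMost_Suc)
    finally show ?thesis by (simp add: algebra_simps)
  qed
  also have "(\<Sum>m\<le>b. ?w b s m * ?E (Suc (b - m)) (?r s ?y m))
      = u * edge_sum u c tgt g (Suc T) b s +
        (\<Sum>e<T. of_nat (s (tgt e)) * c e * edge_sum u c tgt g (Suc T) b (?r s (tgt e) 1))"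
  proof -
    have swap: "?r (?r s ?y m) (tgt e) 1 = ?r (?r s (tgt e) 1) ?y m" for m e
      by auto
    \<comment> \<open>Lowering along \<open>e\<close> and along the last edge commute. For a common
      target, choosing \<open>m\<close> columns and then one of the rest is the same as choosing the
      single one first.\<close>
    have wt: "?w b s m * (of_nat (?r s ?y m (tgt e)) * c e * X)
        = of_nat (s (tgt e)) * c e * (?w b (?r s (tgt e) 1) m * X)" for m e and X :: 'a
    proof (cases "tgt e = ?y")
      case True
      let ?B = "of_nat ((b choose m) * fact m) * c T ^ m * c e * X"
      have "?w b s m * (of_nat (?r s ?y m (tgt e)) * c e * X)
          = ?B * of_nat ((s ?y choose m) * (s ?y - m))"
        using True by (simp add: mult_ac)
      also have "\<dots> = ?B * of_nat (s ?y * (s ?y - 1 choose m))"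
        by (simp only: choose_diff_mult)
      also have "\<dots> = of_nat (s (tgt e)) * c e * (?w b (?r s (tgt e) 1) m * X)"
        using True by (simp add: mult_ac)
      finally show ?thesis .
    qed (simp add: mult_ac)
    have "?w b s m * ?E (Suc (b - m)) (?r s ?y m) = u * (?w b s m * ?E (b - m) (?r s ?y m)) +
        (\<Sum>e<T. of_nat (s (tgt e)) * c e * (?w b (?r s (tgt e) 1) m * ?E (b - m) (?r (?r s (tgt e) 1) ?y m)))" for m
      unfolding Suc.IH distrib_left sum_distrib_left swap wt by (simp only: mult.left_commute)
    then have "(\<Sum>m\<le>b. ?w b s m * ?E (Suc (b - m)) (?r s ?y m)) =
        u * (\<Sum>m\<le>b. ?w b s m * ?E (b - m) (?r s ?y m)) +
        (\<Sum>m\<le>b. \<Sum>e<T. of_nat (s (tgt e)) * c e * (?w b (?r s (tgt e) 1) m * ?E (b - m) (?r (?r s (tgt e) 1) ?y m)))"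
      by (simp only: sum.distrib sum_distrib_left)
    also have "(\<Sum>m\<le>b. \<Sum>e<T. of_nat (s (tgt e)) * c e * (?w b (?r s (tgt e) 1) m * ?E (b - m) (?r (?r s (tgt e) 1) ?y m)))
       = (\<Sum>e<T. of_nat (s (tgt e)) * c e * edge_sum u c tgt g (Suc T) b (?r s (tgt e) 1))"
      by (subst sum.swap) (simp add: sum_distrib_left)
    finally show ?thesis by (simp only: edge_sum.simps)
  qed
  finally show ?case by (simp only: sum.lessThan_Suc add.assoc)
qed

lemma row_op_funpow: "(row_op u T c tgt ^^ b) g = edge_sum u c tgt g T b"
proof (induction b)
  case 0
  show ?case by (simp add: fun_eq_iff edge_sum_0)
next
  case (Suc b)
  show ?case
    by (rule ext) (simp only: funpow.simps o_apply Suc edge_sum_Suc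
      row_op_def[of u T c tgt "edge_sum u c tgt g T b"])
qed

text \<open>With a common target, an edge finds only the columns that the edges handled before it
  have left, so separate binomial coefficients would overcount. The largest edge index is handled
  first.\<close>

primrec seq_choose :: "(nat \<Rightarrow> nat) \<Rightarrow> nat \<Rightarrow> (nat \<Rightarrow> nat) \<Rightarrow> (nat \<Rightarrow> nat) \<Rightarrow> nat" where
  "seq_choose tgt 0 s q = 1"
| "seq_choose tgt (Suc T) s q =
     (s (tgt T) choose q T) * seq_choose tgt T (s(tgt T := s (tgt T) - q T)) q"

definition use_cols :: "(nat \<Rightarrow> nat) \<Rightarrow> nat \<Rightarrow> (nat \<Rightarrow> nat) \<Rightarrow> (nat \<Rightarrow> nat) \<Rightarrow> nat \<Rightarrow> nat" where
  "use_cols tgt T s q = (\<lambda>y. s y - (\<Sum>i<T. if tgt i = y then q i else 0))"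

text \<open>The falling factorial of \<open>b\<close> of length \<open>m\<close>: the used columns
  are placed injectively into the rows, whichever edges lead to them. The empty rows are marked by
  \<open>u\<close>.\<close>

definition row_wt :: "'b \<Rightarrow> nat \<Rightarrow> nat \<Rightarrow> 'b::comm_ring_1" where
  "row_wt u b m = of_nat (fact m * (b choose m)) * u ^ (b - m)"

text \<open>Falling factorials concatenate: first \<open>m\<close> rows are filled, then
  \<open>l\<close> of the remaining ones.\<close>

lemma row_wt_add:
  "of_nat ((b choose m) * fact m) * row_wt u (b - m) l = row_wt u b (l + m)"
proof (cases "l + m \<le> b")
  case True
  then have "(b choose (l + m)) * ((l + m) choose m) = (b choose m) * (b - m choose l)"
    using choose_mult[of m "l + m" b] by simp
  moreover have "fact m * fact l * ((l + m) choose m) = (fact (l + m) :: nat)"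
    using binomial_fact_lemma[of m "l + m"] by simp
  ultimately have "(b choose m) * fact m * (fact l * (b - m choose l))
      = fact (l + m) * (b choose (l + m))"
    by (metis (no_types, lifting) mult.assoc mult.commute)
  then have "of_nat ((b choose m) * fact m) * of_nat (fact l * (b - m choose l))
      = (of_nat (fact (l + m) * (b choose (l + m))) :: 'a)"
    by (metis of_nat_mult)
  moreover have "b - m - l = b - (l + m)" by simp
  ultimately show ?thesis unfolding row_wt_def by (metis mult.assoc)
next
  case False
  then have "b < m \<or> b - m < l" "b < l + m" by auto
  then show ?thesis by (auto simp: row_wt_def binomial_eq_0)
qed

lemma seq_choose_cong: "(\<And>i. i < T \<Longrightarrow> q i = q' i) \<Longrightarrow> seq_choose tgt T s q = seq_choose tgt T s q'"
  by (induction T arbitrary: s) auto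

text \<open>The box bound \<open>K\<close> is separate from \<open>b\<close> because the recursion
  lowers \<open>b\<close> while all choices must range over one common box. Surplus choices carry a
  vanishing binomial coefficient.\<close>

lemma edge_sum_expand:
  assumes "b \<le> K"
  shows "edge_sum u c tgt g T b s = (\<Sum>q\<in>PiE {..<T} (\<lambda>_. {..K}).
    row_wt u b (\<Sum>i<T. q i) * (\<Prod>i<T. c i ^ q i) * of_nat (seq_choose tgt T s q)
      * g (use_cols tgt T s q))"
  using assms
proof (induction T arbitrary: b s)
  case 0
  show ?case by (simp add: row_wt_def use_cols_def)
next
  case (Suc T)
  let ?t = "\<lambda>T b s q. row_wt u b (\<Sum>i<T. q i) * (\<Prod>i<T. c i ^ q i) * of_nat (seq_choose tgt T s q)
      * g (use_cols tgt T s q)"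
  let ?Q = "PiE {..<T} (\<lambda>_. {..K})"
  have "edge_sum u c tgt g (Suc T) b s = (\<Sum>m\<le>b. of_nat ((b choose m) * (s (tgt T) choose m) * fact m) * c T ^ m *
        (\<Sum>q\<in>?Q. ?t T (b - m) (s(tgt T := s (tgt T) - m)) q))"
    unfolding edge_sum.simps
    by (intro sum.cong refl arg_cong2[where f = "(*)"] Suc.IH) (use Suc.prems in simp)
  also have "\<dots> = (\<Sum>m\<le>K. of_nat ((b choose m) * (s (tgt T) choose m) * fact m) * c T ^ m *
        (\<Sum>q\<in>?Q. ?t T (b - m) (s(tgt T := s (tgt T) - m)) q))"
    by (rule sum.mono_neutral_left) (use Suc.prems in \<open>auto simp: binomial_eq_0\<close>)
  also have "\<dots> = (\<Sum>m\<le>K. \<Sum>q\<in>?Q. ?t (Suc T) b s (q(T := m)))"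
    unfolding sum_distrib_left
  proof (intro sum.cong refl)
    fix m q
    let ?q = "q(T := m)" and ?s = "s(tgt T := s (tgt T) - m)"
    have 1: "(\<Sum>i<Suc T. ?q i) = (\<Sum>i<T. q i) + m" "(\<Prod>i<Suc T. c i ^ ?q i) = (\<Prod>i<T. c i ^ q i) * c T ^ m"
      by simp_all
    have 2: "seq_choose tgt (Suc T) s ?q = (s (tgt T) choose m) * seq_choose tgt T ?s q"
      using seq_choose_cong[of T q ?q] by simp
    have 3: "use_cols tgt (Suc T) s ?q = use_cols tgt T ?s q"
    proof
      fix y
      have "(\<Sum>i<T. if tgt i = y then ?q i else 0) = (\<Sum>i<T. if tgt i = y then q i else 0)"
        by (rule sum.cong) auto
      then show "use_cols tgt (Suc T) s ?q y = use_cols tgt T ?s q y"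
        by (simp add: use_cols_def add.commute)
    qed
    show "of_nat ((b choose m) * (s (tgt T) choose m) * fact m) * c T ^ m * ?t T (b - m) ?s q
        = ?t (Suc T) b s ?q"
      unfolding 1 2 3 row_wt_add[symmetric] of_nat_mult by (simp only: mult_ac)
  qed
  also have "\<dots> = (\<Sum>q\<in>PiE {..<Suc T} (\<lambda>_. {..K}). ?t (Suc T) b s q)"
    unfolding lessThan_Suc by (subst sum_PiE_insert) auto
  finally show ?case .
qed

lemma block_rook_Suc:
  "block_rook u v k T c tgt Y (Suc x) s = (\<Sum>q\<in>PiE {..<T} (\<lambda>_. {..k}).
    row_wt u k (\<Sum>i<T. q i) * (\<Prod>i<T. c i ^ q i) * of_nat (seq_choose (tgt x) T s q)
      * block_rook u v k T c tgt Y x (use_cols (tgt x) T s q))"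
  by (simp add: row_op_funpow edge_sum_expand)

section \<open>The transfer process\<close>

text \<open>
  A state records, for the \<open>t\<close> column blocks in the current window, the number of free columns;
  the block about to enter the window is added at position \<open>0\<close>, always with \<open>k\<close> free columns.
  In one step the block row takes \<open>q i\<close> columns from the block at position \<open>i\<close>, and the block at
  position \<open>t\<close> leaves the window. Rows are processed from the last to the first.
  The weights \<open>u\<close> and \<open>v\<close> of unused rows and columns unify the two matrices:
  \<open>u = v = 1\<close> gives \<open>K\<close>, and \<open>u = v = 0\<close> gives \<open>\<Pi>\<close>.
\<close>

definition states :: "nat \<Rightarrow> nat \<Rightarrow> (nat \<Rightarrow> nat) set" where
  "states k t = {\<alpha>. \<alpha> 0 = k \<and> (\<forall>i. \<alpha> i \<le> k) \<and> (\<forall>i>t. \<alpha> i = 0)}"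

definition choices :: "nat \<Rightarrow> nat \<Rightarrow> (nat \<Rightarrow> nat) set" where
  "choices k t = PiE {..<Suc t} (\<lambda>_. {..k})"

definition step_state :: "nat \<Rightarrow> nat \<Rightarrow> (nat \<Rightarrow> nat) \<Rightarrow> (nat \<Rightarrow> nat) \<Rightarrow> nat \<Rightarrow> nat" where
  "step_state k t \<alpha> q = (\<lambda>i. if i = 0 then k else if i \<le> t then \<alpha> (i - 1) - q (i - 1) else 0)"

definition step_wt :: "'b \<Rightarrow> 'b \<Rightarrow> nat \<Rightarrow> nat \<Rightarrow> (nat \<Rightarrow> 'b) \<Rightarrow> (nat \<Rightarrow> nat) \<Rightarrow> (nat \<Rightarrow> nat) \<Rightarrow>
    'b::comm_ring_1" where
  "step_wt u v k t c \<alpha> q = row_wt u k (\<Sum>i<Suc t. q i) * (\<Prod>i<Suc t. c i ^ q i) *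
     of_nat (\<Prod>i<Suc t. \<alpha> i choose q i) * v ^ (\<alpha> t - q t)"

primrec walk_sum :: "'b \<Rightarrow> 'b \<Rightarrow> nat \<Rightarrow> nat \<Rightarrow> (nat \<Rightarrow> 'b) \<Rightarrow> nat \<Rightarrow> (nat \<Rightarrow> nat) \<Rightarrow>
    (nat \<Rightarrow> nat) \<Rightarrow> 'b::comm_ring_1" where
  "walk_sum u v k t c 0 \<alpha> \<beta> = (if \<alpha> = \<beta> then 1 else 0)"
| "walk_sum u v k t c (Suc n) \<alpha> \<beta> =
     (\<Sum>q\<in>choices k t. step_wt u v k t c \<alpha> q * walk_sum u v k t c n (step_state k t \<alpha> q) \<beta>)"

lemma finite_states [simp]: "finite (states k t)"
proof (rule finite_subset)
  show "states k t \<subseteq> (\<lambda>f i. if i \<le> t then f i else 0) ` PiE {..t} (\<lambda>_. {..k})"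
  proof
    fix \<alpha> assume "\<alpha> \<in> states k t"
    then have "\<alpha> = (\<lambda>f i. if i \<le> t then f i else 0) (restrict \<alpha> {..t})"
      "restrict \<alpha> {..t} \<in> PiE {..t} (\<lambda>_. {..k})"
      by (auto simp: states_def fun_eq_iff not_le)
    then show "\<alpha> \<in> (\<lambda>f i. if i \<le> t then f i else 0) ` PiE {..t} (\<lambda>_. {..k})" by blast
  qed
qed (auto intro: finite_PiE)

lemma finite_choices [simp]: "finite (choices k t)"
  by (auto simp: choices_def intro: finite_PiE)

lemma choices_le: "q \<in> choices k t \<Longrightarrow> i \<le> t \<Longrightarrow> q i \<le> k"
  by (auto simp: choices_def PiE_iff)

lemma step_state_in: "\<alpha> \<in> states k t \<Longrightarrow> step_state k t \<alpha> q \<in> states k t"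
  by (auto simp: states_def step_state_def) (meson diff_le_self le_trans)

section \<open>Open boundary\<close>

lemma seq_choose_inj:
  assumes "inj_on tgt {..<T}"
  shows "seq_choose tgt T s q = (\<Prod>i<T. s (tgt i) choose q i)"
  using assms
proof (induction T arbitrary: s)
  case (Suc T)
  have "tgt i \<noteq> tgt T" if "i < T" for i
    using Suc.prems that by (auto simp: inj_on_def)
  moreover have "inj_on tgt {..<T}" using Suc.prems by (auto simp: inj_on_def)
  ultimately show ?case using Suc.IH by (simp add: mult.commute)
qed simp

lemma use_cols_shift:
  "use_cols (\<lambda>i. x + i) (Suc t) s q = (\<lambda>z. s z - (if x \<le> z \<and> z \<le> x + t then q (z - x) else 0))"
proof
  fix z
  have "(\<Sum>i<Suc t. if x + i = z then q i else 0) = (\<Sum>i<Suc t. if x \<le> z \<and> i = z - x then q i else 0)"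
    by (rule sum.cong) auto
  also have "\<dots> = (if x \<le> z \<and> z \<le> x + t then q (z - x) else 0)"
    by (auto simp: sum.delta)
  finally show "use_cols (\<lambda>i. x + i) (Suc t) s q z = s z - (if x \<le> z \<and> z \<le> x + t then q (z - x) else 0)"
    by (simp add: use_cols_def)
qed

text \<open>No remaining row reaches block \<open>z\<close>, so its free columns only enter the
  final exponent of \<open>v\<close>. This justifies charging a block when it leaves the
  window.\<close>

lemma block_rook_exit:
  assumes "finite Y" "z \<in> Y" "\<And>x' i. x' < x \<Longrightarrow> i < T \<Longrightarrow> tgt x' i \<noteq> z"
  shows "block_rook u v k T c tgt Y x (s(z := d))
    = v ^ d * block_rook u v k T c tgt Y x (s(z := 0))"
  using assms(3)
proof (induction x arbitrary: s)
  case 0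
  have "(\<Sum>y\<in>Y. (s(z := d)) y) = d + (\<Sum>y\<in>Y. (s(z := 0)) y)"
    unfolding sum.remove[OF assms(1,2)] by simp
  then show ?case by (simp only: block_rook.simps power_add)
next
  case (Suc x)
  have ne: "tgt x i \<noteq> z" if "i < T" for i using Suc.prems that by auto
  have ch: "seq_choose (tgt x) T (s(z := e)) q = seq_choose (tgt x) T s q" for e q
  proof -
    have "seq_choose (tgt x) T' (s(z := e)) q = seq_choose (tgt x) T' s q" if "T' \<le> T" for T' s
      using that
    proof (induction T' arbitrary: s)
      case (Suc T')
      have "s(z := e, tgt x T' := s (tgt x T') - q T') = s(tgt x T' := s (tgt x T') - q T', z := e)"
        using ne[of T'] Suc.prems by (auto intro: fun_upd_twist)
      moreover have "seq_choose (tgt x) T' (s(tgt x T' := s (tgt x T') - q T', z := e)) q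
          = seq_choose (tgt x) T' (s(tgt x T' := s (tgt x T') - q T')) q"
        by (rule Suc.IH) (use Suc.prems in simp)
      moreover have "(s(z := e)) (tgt x T') = s (tgt x T')" using ne[of T'] Suc.prems by simp
      ultimately show ?case by (simp only: seq_choose.simps)
    qed simp
    then show ?thesis by simp
  qed
  have us: "use_cols (tgt x) T (s(z := e)) q = (use_cols (tgt x) T s q)(z := e)" for e q
    using ne by (auto simp: use_cols_def fun_eq_iff intro!: sum.neutral)
  show ?case
    unfolding block_rook_Suc ch us sum_distrib_left
    using Suc by (intro sum.cong refl) (simp add: mult_ac del: fun_upd_apply)
qed

text \<open>With \<open>x\<close> block rows left, the next one is row \<open>x - 1\<close>, and
  position \<open>i\<close> of the state is block \<open>x - 1 + i\<close>. Hence block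
  \<open>z\<close> sits at position \<open>z + 1 - x\<close>, and the entering block at position 0
  falls under \<open>z < x\<close>.\<close>

definition window_cols :: "nat \<Rightarrow> nat \<Rightarrow> nat \<Rightarrow> nat \<Rightarrow> (nat \<Rightarrow> nat) \<Rightarrow> nat \<Rightarrow> nat" where
  "window_cols k t r x \<alpha> = (\<lambda>z. if z < r then 0 else if z < x then k
     else if z + 1 - x \<le> t then \<alpha> (z + 1 - x) else 0)"

text \<open>
  Column block \<open>y\<close> of the matrix is \<open>z = y + r\<close> here, so that block row \<open>x\<close> meets the blocks
  \<open>z = x, \<dots>, x + t\<close>. The blocks \<open>z < r\<close> do not exist; the process nevertheless admits them with
  \<open>k\<close> free columns, and the condition on the final state keeps them unused.
\<close>

lemma walk_sum_open:
  assumes r: "r \<le> t" and Y: "finite Y" "{..<n + t} \<subseteq> Y" and x: "x \<le> n" and \<alpha>: "\<alpha> \<in> states k t"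
  shows "(\<Sum>\<gamma> | \<gamma> \<in> states k t \<and> (\<forall>i\<in>{1..r}. \<gamma> i = k).
        v ^ (\<Sum>i=Suc r..t. \<gamma> i) * walk_sum u v k t c x \<alpha> \<gamma>)
    = (if \<forall>i\<in>{1..t}. x + i \<le> r \<longrightarrow> \<alpha> i = k
       then block_rook u v k (Suc t) c (\<lambda>x i. x + i) Y x (window_cols k t r x \<alpha>) else 0)"
  using x \<alpha>
proof (induction x arbitrary: \<alpha>)
  case 0
  have fin: "finite {\<gamma>. \<gamma> \<in> states k t \<and> (\<forall>i\<in>{1..r}. \<gamma> i = k)}"
    by (rule finite_subset[OF _ finite_states]) auto
  have "(\<Sum>y\<in>Y. window_cols k t r 0 \<alpha> y) = (\<Sum>y\<in>{r..<t}. \<alpha> (Suc y))"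
    by (rule sum.mono_neutral_cong_right) (use Y in \<open>auto simp: window_cols_def\<close>)
  also have "\<dots> = (\<Sum>i=Suc r..t. \<alpha> i)"
    by (simp add: sum.shift_bounds_Suc_ivl[symmetric] atLeastLessThanSuc_atLeastAtMost)
  finally have *: "(\<Sum>y\<in>Y. window_cols k t r 0 \<alpha> y) = (\<Sum>i=Suc r..t. \<alpha> i)" .
  have "(\<forall>i\<in>{1..t}. i \<le> r \<longrightarrow> \<alpha> i = k) \<longleftrightarrow> (\<forall>i\<in>{1..r}. \<alpha> i = k)"
    using r by auto
  then show ?case using 0 fin by (simp add: * if_distrib cong: if_cong)
next
  case (Suc x)
  let ?S = "{\<gamma>. \<gamma> \<in> states k t \<and> (\<forall>i\<in>{1..r}. \<gamma> i = k)}"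
  let ?e = "\<lambda>\<gamma>. v ^ (\<Sum>i=Suc r..t. \<gamma> i)" and ?W = "walk_sum u v k t c x"
  let ?R = "block_rook u v k (Suc t) c (\<lambda>x i. x + i) Y x"
  let ?nx = "step_state k t \<alpha>" and ?s = "window_cols k t r (Suc x) \<alpha>"
  \<comment> \<open>\<open>x + i \<le> r\<close> says that position \<open>i\<close> is the
    nonexistent block \<open>x + i - 1 < r\<close>.\<close>
  let ?ok = "\<lambda>x \<alpha>. \<forall>i\<in>{1..t}. x + i \<le> r \<longrightarrow> \<alpha> i = k"
  let ?G = "\<lambda>\<alpha>. if ?ok x \<alpha> then ?R (window_cols k t r x \<alpha>) else 0"
  have \<alpha>0: "\<alpha> 0 = k" and \<alpha>k: "\<And>i. \<alpha> i \<le> k" using Suc.prems by (auto simp: states_def)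
  have "(\<Sum>\<gamma>\<in>?S. ?e \<gamma> * walk_sum u v k t c (Suc x) \<alpha> \<gamma>)
      = (\<Sum>q\<in>choices k t. step_wt u v k t c \<alpha> q * (\<Sum>\<gamma>\<in>?S. ?e \<gamma> * ?W (?nx q) \<gamma>))"
    unfolding walk_sum.simps sum_distrib_left by (subst sum.swap) (simp add: mult.left_commute)
  also have "\<dots> = (\<Sum>q\<in>choices k t. step_wt u v k t c \<alpha> q * ?G (?nx q))"
    using Suc step_state_in by (intro sum.cong refl arg_cong2[where f = "(*)"]) auto
  finally have L: "(\<Sum>\<gamma>\<in>?S. ?e \<gamma> * walk_sum u v k t c (Suc x) \<alpha> \<gamma>)
      = (\<Sum>q\<in>choices k t. step_wt u v k t c \<alpha> q * ?G (?nx q))" .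
  have nx_Suc: "?nx q (Suc i) = \<alpha> i - q i" if "i < t" for i q
    using that by (simp add: step_state_def)
  show ?case
  proof (cases "?ok (Suc x) \<alpha>")
    \<comment> \<open>A nonexistent block that has been used never becomes full again, and because
      of \<open>r \<le> t\<close> it is still in the window at the end. So every final state is
      rejected.\<close>
    case False
    then obtain i where i: "i \<in> {1..t}" "Suc x + i \<le> r" "\<alpha> i < k"
      using \<alpha>k le_neq_implies_less by blast
    have "?nx q (Suc i) < k" for q using nx_Suc[of i q] i r by simp
    moreover have "Suc i \<in> {1..t}" "x + Suc i \<le> r" using i r by auto
    ultimately have "\<not> ?ok x (?nx q)" for q by (metis less_irrefl)
    then have "(\<Sum>q\<in>choices k t. step_wt u v k t c \<alpha> q * ?G (?nx q)) = 0"
      by (simp only: if_False mult_zero_right sum.neutral_const)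
    then show ?thesis using L False by (simp only: if_False)
  next
    case True
    have s: "?s (x + i) = (if x + i < r then 0 else \<alpha> i)" if "i \<le> t" for i
      using that \<alpha>0 by (auto simp: window_cols_def)
    have ch: "seq_choose (\<lambda>i. x + i) (Suc t) ?s q
        = (\<Prod>i<Suc t. (if x + i < r then 0 else \<alpha> i) choose q i)" for q
      unfolding seq_choose_inj[OF inj_on_add] by (intro prod.cong refl) (auto simp: s)
    have "step_wt u v k t c \<alpha> q * ?G (?nx q) = row_wt u k (\<Sum>i<Suc t. q i) * (\<Prod>i<Suc t. c i ^ q i)
        * of_nat (seq_choose (\<lambda>i. x + i) (Suc t) ?s q) * ?R (use_cols (\<lambda>i. x + i) (Suc t) ?s q)"
      if q: "q \<in> choices k t" for q
    \<comment> \<open>A choice that takes columns from a nonexistent block gives zero on both sides: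
      the walk violates the final condition, and the row expansion chooses from \<open>0\<close>
      columns.\<close>
    proof (cases "\<exists>i\<le>t. x + i < r \<and> q i > 0")
      case True
      then obtain i where i: "i \<le> t" "x + i < r" "q i > 0" by blast
      then have "?nx q (Suc i) < k"
        using nx_Suc[of i q] choices_le[OF q, of i] \<alpha>k[of i] r by auto
      moreover have "Suc i \<in> {1..t}" "x + Suc i \<le> r" using i r by auto
      ultimately have "\<not> ?ok x (?nx q)" by (metis less_irrefl)
      then have "?G (?nx q) = 0" by (simp only: if_False)
      moreover have "seq_choose (\<lambda>i. x + i) (Suc t) ?s q = 0"
        unfolding ch by (rule prod_zero) (use i in auto)
      ultimately show ?thesis by (simp only: of_nat_0 mult_zero_left mult_zero_right)
    next
      case False
      have "?nx q i = k" if "i \<in> {1..t}" "x + i \<le> r" for i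
      proof (cases i)
        case (Suc j)
        have "q j = 0" using False that Suc by auto
        moreover have "\<alpha> j = k" using \<open>?ok (Suc x) \<alpha>\<close> \<alpha>0 that Suc by (cases "j = 0") auto
        ultimately show ?thesis using nx_Suc[of j q] that Suc by simp
      qed (use that in simp)
      then have "?G (?nx q) = ?R (window_cols k t r x (?nx q))" by simp
      moreover have "seq_choose (\<lambda>i. x + i) (Suc t) ?s q = (\<Prod>i<Suc t. \<alpha> i choose q i)"
        unfolding ch using False by (intro prod.cong refl) auto
      \<comment> \<open>Block \<open>x + t\<close> has just left the window.
        \<open>window_cols\<close> gives it no columns, so its actual rest
        \<open>\<alpha> t - q t\<close> appears as an explicit update.\<close>
      moreover have "use_cols (\<lambda>i. x + i) (Suc t) ?s q
          = (window_cols k t r x (?nx q))(x + t := \<alpha> t - q t)"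
        unfolding use_cols_shift
      proof
        fix z
        consider "z < x" | i where "z = x + i" "i < t" | "z = x + t" | "z > x + t"
          by (metis add_diff_inverse_nat less_diff_conv2 linorder_neqE_nat nat_add_left_cancel_less not_less)
        then show "?s z - (if x \<le> z \<and> z \<le> x + t then q (z - x) else 0)
            = ((window_cols k t r x (?nx q))(x + t := \<alpha> t - q t)) z"
        proof cases
          case 1
          then show ?thesis by (simp add: window_cols_def)
        next
          case (2 i)
          have "?s z - (if x \<le> z \<and> z \<le> x + t then q (z - x) else 0) = ?s (x + i) - q i"
            using 2 by simp
          also have "\<dots> = (if x + i < r then 0 else \<alpha> i) - q i" using s[of i] 2 by simp
          also have "\<dots> = window_cols k t r x (?nx q) z"
            using 2 nx_Suc[of i q] by (simp add: window_cols_def)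
          finally show ?thesis using 2 by simp
        next
          case 3
          then show ?thesis using s[of t] r by simp
        next
          case 4
          then have "\<not> z - x \<le> t" "\<not> Suc z - x \<le> t" by auto
          then show ?thesis using 4 by (simp add: window_cols_def)
        qed
      qed
      moreover have "(window_cols k t r x (?nx q))(x + t := 0) = window_cols k t r x (?nx q)"
        by (auto simp: window_cols_def fun_eq_iff)
      then have "?R ((window_cols k t r x (?nx q))(x + t := \<alpha> t - q t))
          = v ^ (\<alpha> t - q t) * ?R (window_cols k t r x (?nx q))"
        using block_rook_exit[of Y "x + t" x "Suc t" "\<lambda>x i. x + i" u v k c
            "window_cols k t r x (?nx q)" "\<alpha> t - q t"] Y Suc.prems
        by (auto simp: subset_iff)
      ultimately show ?thesis by (simp add: step_wt_def mult_ac)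
    qed
    then have "(\<Sum>q\<in>choices k t. step_wt u v k t c \<alpha> q * ?G (?nx q))
        = block_rook u v k (Suc t) c (\<lambda>x i. x + i) Y (Suc x) ?s"
      unfolding block_rook_Suc choices_def[symmetric] by (rule sum.cong[OF refl])
    then show ?thesis unfolding L if_P[OF True] .
  qed
qed

section \<open>Expansion over all choices\<close>

text \<open>Time runs downwards like the rows: the walk is at \<open>\<alpha>\<close> at time
  \<open>n\<close>, and the choice \<open>Q x\<close> leads from time \<open>Suc x\<close> to time
  \<open>x\<close>.\<close>

primrec walk_at :: "nat \<Rightarrow> nat \<Rightarrow> nat \<Rightarrow> (nat \<Rightarrow> nat) \<Rightarrow> (nat \<Rightarrow> nat \<Rightarrow> nat) \<Rightarrow> nat \<Rightarrow> nat \<Rightarrow> nat" where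
  "walk_at k t 0 \<alpha> Q x = \<alpha>"
| "walk_at k t (Suc n) \<alpha> Q x =
     (if x = Suc n then \<alpha> else walk_at k t n (step_state k t \<alpha> (Q n)) Q x)"

lemma walk_at_start [simp]: "walk_at k t n \<alpha> Q n = \<alpha>"
  by (cases n) auto

lemma walk_at_step: "x < n \<Longrightarrow> walk_at k t n \<alpha> Q x = step_state k t (walk_at k t n \<alpha> Q (Suc x)) (Q x)"
  by (induction n arbitrary: \<alpha>) (auto simp: less_Suc_eq)

lemma walk_at_cong:
  "(\<And>x. x < n \<Longrightarrow> Q x = Q' x) \<Longrightarrow> walk_at k t n \<alpha> Q x = walk_at k t n \<alpha> Q' x"
  by (induction n arbitrary: \<alpha>) auto

lemma walk_at_unique:
  assumes "\<And>x. x < n \<Longrightarrow> A x = step_state k t (A (Suc x)) (Q x)" "x \<le> n"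
  shows "walk_at k t n (A n) Q x = A x"
  using assms
proof (induction n)
  case (Suc n)
  have "A n = step_state k t (A (Suc n)) (Q n)" using Suc.prems by simp
  then show ?case using Suc by (auto simp: le_Suc_eq)
qed simp

text \<open>Sorting by choices instead of intermediate states: for fixed \<open>Q\<close> the states
  are forced by the start, so the condition that a walk is closed can be solved for the
  start.\<close>

lemma walk_sum_expand:
  "walk_sum u v k t c n \<alpha> \<beta> = (\<Sum>Q\<in>PiE {..<n} (\<lambda>_. choices k t).
     if walk_at k t n \<alpha> Q 0 = \<beta> then \<Prod>x<n. step_wt u v k t c (walk_at k t n \<alpha> Q (Suc x)) (Q x) else 0)"
proof (induction n arbitrary: \<alpha>)
  case (Suc n)
  let ?P = "PiE {..<n} (\<lambda>_. choices k t)"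
  let ?f = "\<lambda>n \<alpha> Q. if walk_at k t n \<alpha> Q 0 = \<beta>
     then \<Prod>x<n. step_wt u v k t c (walk_at k t n \<alpha> Q (Suc x)) (Q x) else 0"
  have "step_wt u v k t c \<alpha> q * ?f n (step_state k t \<alpha> q) Q = ?f (Suc n) \<alpha> (Q(n := q))" for q Q
  proof -
    have 1: "walk_at k t n \<alpha>' (Q(n := q)) x = walk_at k t n \<alpha>' Q x" for \<alpha>' x
      by (rule walk_at_cong) simp
    then have 2: "walk_at k t (Suc n) \<alpha> (Q(n := q)) x = walk_at k t n (step_state k t \<alpha> q) Q x"
      if "x \<le> n" for x using that by simp
    have "(\<Prod>x<Suc n. step_wt u v k t c (walk_at k t (Suc n) \<alpha> (Q(n := q)) (Suc x)) ((Q(n := q)) x))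
        = step_wt u v k t c \<alpha> q *
          (\<Prod>x<n. step_wt u v k t c (walk_at k t n (step_state k t \<alpha> q) Q (Suc x)) (Q x))"
      unfolding prod.lessThan_Suc mult.commute[of _ "step_wt u v k t c _ ((Q(n := q)) n)"]
      by (intro arg_cong2[where f = "(*)"] prod.cong refl) (simp_all add: 1)
    then show ?thesis using 2[of 0] by simp
  qed
  then have "walk_sum u v k t c (Suc n) \<alpha> \<beta> = (\<Sum>q\<in>choices k t. \<Sum>Q\<in>?P. ?f (Suc n) \<alpha> (Q(n := q)))"
    unfolding walk_sum.simps Suc sum_distrib_left by simp
  also have "\<dots> = (\<Sum>Q\<in>PiE {..<Suc n} (\<lambda>_. choices k t). ?f (Suc n) \<alpha> Q)"
    unfolding lessThan_Suc by (rule sum_PiE_insert[symmetric]) simp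
  finally show ?case .
qed simp

definition load :: "nat \<Rightarrow> (nat \<Rightarrow> nat \<Rightarrow> nat) \<Rightarrow> nat \<Rightarrow> (nat \<Rightarrow> nat \<Rightarrow> nat) \<Rightarrow> nat \<Rightarrow> nat" where
  "load T tgt n Q y = (\<Sum>x<n. \<Sum>i<T. if tgt x i = y then Q x i else 0)"

primrec rows_choose :: "nat \<Rightarrow> (nat \<Rightarrow> nat \<Rightarrow> nat) \<Rightarrow> nat \<Rightarrow> (nat \<Rightarrow> nat) \<Rightarrow>
    (nat \<Rightarrow> nat \<Rightarrow> nat) \<Rightarrow> nat" where
  "rows_choose T tgt 0 s Q = 1"
| "rows_choose T tgt (Suc n) s Q =
     seq_choose (tgt n) T s (Q n) * rows_choose T tgt n (use_cols (tgt n) T s (Q n)) Q"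

lemma rows_choose_cong:
  "(\<And>x. x < n \<Longrightarrow> Q x = Q' x) \<Longrightarrow> rows_choose T tgt n s Q = rows_choose T tgt n s Q'"
  by (induction n arbitrary: s) auto

lemma load_cong: "(\<And>x. x < n \<Longrightarrow> Q x = Q' x) \<Longrightarrow> load T tgt n Q y = load T tgt n Q' y"
  unfolding load_def by (intro sum.cong) auto

lemma block_rook_expand:
  "block_rook u v k T c tgt Y n s = (\<Sum>Q\<in>PiE {..<n} (\<lambda>_. PiE {..<T} (\<lambda>_. {..k})).
     (\<Prod>x<n. row_wt u k (\<Sum>i<T. Q x i) * (\<Prod>i<T. c i ^ Q x i)) *
     of_nat (rows_choose T tgt n s Q) * v ^ (\<Sum>y\<in>Y. s y - load T tgt n Q y))"
proof (induction n arbitrary: s)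
  case 0
  show ?case by (simp add: load_def)
next
  case (Suc n)
  let ?C = "PiE {..<T} (\<lambda>_. {..k})"
  let ?r = "\<lambda>q. row_wt u k (\<Sum>i<T. q i) * (\<Prod>i<T. c i ^ q i)"
  let ?f = "\<lambda>n s Q. (\<Prod>x<n. ?r (Q x)) * of_nat (rows_choose T tgt n s Q)
     * v ^ (\<Sum>y\<in>Y. s y - load T tgt n Q y)"
  have "?r q * of_nat (seq_choose (tgt n) T s q) * ?f n (use_cols (tgt n) T s q) Q
      = ?f (Suc n) s (Q(n := q))" for q Q
  proof -
    let ?Q = "Q(n := q)"
    have 1: "rows_choose T tgt n s' ?Q = rows_choose T tgt n s' Q" for s'
      by (rule rows_choose_cong) simp
    have "load T tgt n ?Q y = load T tgt n Q y" for y by (rule load_cong) simp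
    then have 2: "s y - load T tgt (Suc n) ?Q y = use_cols (tgt n) T s q y - load T tgt n Q y" for y
      by (simp add: load_def use_cols_def add.commute cong: if_cong)
    have 3: "(\<Prod>x<Suc n. ?r (?Q x)) = ?r q * (\<Prod>x<n. ?r (Q x))"
      unfolding prod.lessThan_Suc by (simp add: mult.commute)
    show ?thesis unfolding 2 3 by (simp add: 1 mult_ac)
  qed
  then have "block_rook u v k T c tgt Y (Suc n) s
      = (\<Sum>q\<in>?C. \<Sum>Q\<in>PiE {..<n} (\<lambda>_. ?C). ?f (Suc n) s (Q(n := q)))"
    unfolding block_rook_Suc Suc sum_distrib_left by simp
  also have "\<dots> = (\<Sum>Q\<in>PiE {..<Suc n} (\<lambda>_. ?C). ?f (Suc n) s Q)"
    unfolding lessThan_Suc by (rule sum_PiE_insert[symmetric]) simp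
  finally show ?case .
qed

text \<open>
  Both products of binomial coefficients telescope after multiplication by the factorials of
  all choices, so neither depends on the order in which a column block is used.
\<close>

lemma choose_mult_fact: "m \<le> s \<Longrightarrow> (s choose m) * fact m * fact (s - m) = (fact s :: nat)"
  using binomial_fact_lemma[of m s] by (simp add: mult_ac)

lemma prod_fact_upd:
  assumes "finite Y" "z \<in> Y" "m \<le> s z"
  shows "(s z choose m) * fact m * (\<Prod>y\<in>Y. fact ((s(z := s z - m)) y)) = (\<Prod>y\<in>Y. fact (s y) :: nat)"
proof -
  have "(\<Prod>y\<in>Y. fact ((s(z := s z - m)) y)) = fact (s z - m) * (\<Prod>y\<in>Y - {z}. fact (s y) :: nat)"
    unfolding prod.remove[OF assms(1,2)] by (intro arg_cong2[where f = "(*)"] prod.cong) auto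
  then show ?thesis
    unfolding prod.remove[OF assms(1,2), of "\<lambda>y. fact (s y)"]
    by (simp add: choose_mult_fact[OF assms(3), symmetric] mult_ac)
qed

lemma seq_choose_telescope:
  assumes "finite Y" "\<And>i. i < T \<Longrightarrow> tgt i \<in> Y"
    and "\<And>y. y \<in> Y \<Longrightarrow> (\<Sum>i<T. if tgt i = y then q i else 0) \<le> s y"
  shows "seq_choose tgt T s q * (\<Prod>i<T. fact (q i)) * (\<Prod>y\<in>Y. fact (use_cols tgt T s q y))
    = (\<Prod>y\<in>Y. fact (s y))"
  using assms(2,3)
proof (induction T arbitrary: s)
  case 0
  show ?case by (simp add: use_cols_def)
next
  case (Suc T)
  let ?z = "tgt T" and ?s = "s(tgt T := s (tgt T) - q T)"
  have z: "?z \<in> Y" using Suc.prems by simp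
  have le: "q T + (\<Sum>i<T. if tgt i = ?z then q i else 0) \<le> s ?z"
    using Suc.prems(2)[OF z] by simp
  have "use_cols tgt (Suc T) s q = use_cols tgt T ?s q"
    by (auto simp: use_cols_def fun_eq_iff add.commute)
  moreover have "seq_choose tgt T ?s q * (\<Prod>i<T. fact (q i)) * (\<Prod>y\<in>Y. fact (use_cols tgt T ?s q y))
      = (\<Prod>y\<in>Y. fact (?s y))"
  proof (rule Suc.IH)
    fix y assume "y \<in> Y"
    then show "(\<Sum>i<T. if tgt i = y then q i else 0) \<le> ?s y"
      using Suc.prems(2)[of y] le by (cases "y = ?z") auto
  qed (use Suc.prems in simp)
  ultimately have "seq_choose tgt (Suc T) s q * (\<Prod>i<Suc T. fact (q i))
        * (\<Prod>y\<in>Y. fact (use_cols tgt (Suc T) s q y))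
      = (s ?z choose q T) * fact (q T) * (\<Prod>y\<in>Y. fact (?s y))"
    by (simp add: mult_ac del: fun_upd_apply)
  also have "\<dots> = (\<Prod>y\<in>Y. fact (s y))"
    by (rule prod_fact_upd) (use assms(1) z le in auto)
  finally show ?case .
qed

lemma seq_choose_eq_0:
  assumes "(\<Sum>i<T. if tgt i = y then q i else 0) > s y"
  shows "seq_choose tgt T s q = 0"
  using assms
proof (induction T arbitrary: s)
  case (Suc T)
  show ?case
  proof (cases "s (tgt T) < q T")
    case False
    have "seq_choose tgt T (s(tgt T := s (tgt T) - q T)) q = 0"
      by (rule Suc.IH) (use Suc.prems False in \<open>auto split: if_splits\<close>)
    then show ?thesis by simp
  qed (simp add: binomial_eq_0)
qed simp

lemma rows_choose_telescope:
  assumes Y: "finite Y" "\<And>x i. x < n \<Longrightarrow> i < T \<Longrightarrow> tgt x i \<in> Y"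
    and "\<And>y. y \<in> Y \<Longrightarrow> load T tgt n Q y \<le> s y"
  shows "rows_choose T tgt n s Q * (\<Prod>x<n. \<Prod>i<T. fact (Q x i)) * (\<Prod>y\<in>Y. fact (s y - load T tgt n Q y))
    = (\<Prod>y\<in>Y. fact (s y))"
  using assms(2,3)
proof (induction n arbitrary: s)
  case 0
  show ?case by (simp add: load_def)
next
  case (Suc n)
  let ?s = "use_cols (tgt n) T s (Q n)"
  have load: "load T tgt (Suc n) Q y = load T tgt n Q y + (\<Sum>i<T. if tgt n i = y then Q n i else 0)" for y
    by (simp add: load_def)
  have "s y - load T tgt (Suc n) Q y = ?s y - load T tgt n Q y" for y
    by (simp add: load use_cols_def)
  moreover have "rows_choose T tgt n ?s Q * (\<Prod>x<n. \<Prod>i<T. fact (Q x i)) * (\<Prod>y\<in>Y. fact (?s y - load T tgt n Q y))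
      = (\<Prod>y\<in>Y. fact (?s y))"
  proof (rule Suc.IH)
    fix y assume "y \<in> Y"
    then show "load T tgt n Q y \<le> ?s y"
      using Suc.prems(2)[of y] by (simp add: load use_cols_def)
  qed (use Suc.prems in simp)
  ultimately have "rows_choose T tgt (Suc n) s Q * (\<Prod>x<Suc n. \<Prod>i<T. fact (Q x i))
        * (\<Prod>y\<in>Y. fact (s y - load T tgt (Suc n) Q y))
      = seq_choose (tgt n) T s (Q n) * (\<Prod>i<T. fact (Q n i)) * (\<Prod>y\<in>Y. fact (?s y))"
    by (simp add: mult_ac)
  also have "\<dots> = (\<Prod>y\<in>Y. fact (s y))"
  proof (rule seq_choose_telescope[OF Y(1)])
    fix y assume "y \<in> Y"
    then show "(\<Sum>i<T. if tgt n i = y then Q n i else 0) \<le> s y"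
      using Suc.prems(2)[of y] by (simp add: load)
  qed (use Suc.prems in simp)
  finally show ?case .
qed

text \<open>The complement of the telescoping case. The identity with factorials fails for an
  overdrawn block, but there some binomial coefficient has a lower index exceeding its upper
  one.\<close>

lemma rows_choose_eq_0:
  assumes "load T tgt n Q y > s y"
  shows "rows_choose T tgt n s Q = 0"
  using assms
proof (induction n arbitrary: s)
  case (Suc n)
  let ?m = "\<Sum>i<T. if tgt n i = y then Q n i else 0"
  have load: "load T tgt (Suc n) Q y = load T tgt n Q y + ?m"
    by (simp add: load_def)
  show ?case
  proof (cases "s y < ?m")
    case False
    have "rows_choose T tgt n (use_cols (tgt n) T s (Q n)) Q = 0"
      by (rule Suc.IH) (use Suc.prems False in \<open>simp add: load use_cols_def\<close>)
    then show ?thesis by simp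
  qed (simp add: seq_choose_eq_0)
qed (simp add: load_def)

section \<open>Cyclic boundary\<close>

text \<open>The only candidate for a closed walk with choices \<open>Q\<close>.\<close>

definition cyc_state :: "nat \<Rightarrow> nat \<Rightarrow> nat \<Rightarrow> (nat \<Rightarrow> nat \<Rightarrow> nat) \<Rightarrow> nat \<Rightarrow> nat \<Rightarrow> nat" where
  "cyc_state k t n Q x = (\<lambda>i. if i \<le> t then k - (\<Sum>s<i. Q ((x + (i - Suc s)) mod n) s) else 0)"

lemma cyc_state_in: "cyc_state k t n Q x \<in> states k t"
  by (auto simp: cyc_state_def states_def)

lemma cyc_state_step:
  assumes "x < n"
  shows "cyc_state k t n Q x = step_state k t (cyc_state k t n Q (Suc x)) (Q x)"
proof
  fix i
  show "cyc_state k t n Q x i = step_state k t (cyc_state k t n Q (Suc x)) (Q x) i"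
  proof (cases i)
    case (Suc j)
    have "(\<Sum>s<j. Q ((x + (Suc j - Suc s)) mod n) s) = (\<Sum>s<j. Q ((Suc x + (j - Suc s)) mod n) s)"
      by (intro sum.cong refl) (simp add: Suc_diff_Suc)
    then show ?thesis using Suc assms by (simp add: cyc_state_def step_state_def)
  qed (simp add: cyc_state_def step_state_def)
qed

lemma cyc_state_closed: "cyc_state k t n Q n = cyc_state k t n Q 0"
  unfolding cyc_state_def mod_add_self1 add_0 ..

text \<open>Position 0 is always \<open>k\<close>, and position \<open>i + 1\<close> is position
  \<open>i\<close> one step earlier minus a choice. Induction on the position therefore fixes the
  state at all times below \<open>n\<close>, and closedness carries the value at time 0 back to the
  start. As the induction is on positions and not on time, a window longer than the walk does no
  harm.\<close>

lemma closed_walk_iff: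
  assumes \<alpha>: "\<alpha> \<in> states k t"
  shows "walk_at k t n \<alpha> Q 0 = \<alpha> \<longleftrightarrow> n = 0 \<or> \<alpha> = cyc_state k t n Q n"
proof -
  let ?A = "cyc_state k t n Q" and ?B = "walk_at k t n \<alpha> Q"
  have 1: "\<alpha> = ?A n" if closed: "?B 0 = \<alpha>" and n: "n > 0"
  proof -
    have eq: "\<forall>x\<le>n. ?B x i = ?A x i" if "i \<le> t" for i
      using that
    proof (induction i)
      case 0
      have "?B x 0 = k" if "x \<le> n" for x
        using that \<alpha> walk_at_step[of x n k t \<alpha> Q]
        by (cases "x = n") (auto simp: states_def step_state_def)
      then show ?case by (simp add: cyc_state_def)
    next
      case (Suc i)
      have lt: "?B x (Suc i) = ?A x (Suc i)" if "x < n" for x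
        using that Suc walk_at_step[OF that, of k t \<alpha> Q] cyc_state_step[OF that, of k t Q]
        by (simp add: step_state_def)
      moreover have "?B n (Suc i) = ?A n (Suc i)"
        using lt[of 0] n closed by (simp add: cyc_state_closed)
      ultimately show ?case by (auto simp: le_less)
    qed
    have "\<alpha> i = ?A n i" if "i \<le> t" for i using eq[OF that] by auto
    moreover have "\<alpha> i = ?A n i" if "i > t" for i
      using that \<alpha> by (auto simp: states_def cyc_state_def)
    ultimately show ?thesis by (metis ext not_le)
  qed
  have "walk_at k t n (?A n) Q 0 = ?A 0"
    by (rule walk_at_unique, erule cyc_state_step, simp)
  then have 2: "\<alpha> = ?A n \<Longrightarrow> ?B 0 = \<alpha>"
    using cyc_state_closed[of k t n Q] by (metis (no_types))
  have 3: "n = 0 \<Longrightarrow> ?B 0 = \<alpha>" by simp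
  show ?thesis using 1 2 3 by blast
qed

lemma sum_mod_delta:
  fixes f :: "nat \<Rightarrow> nat"
  assumes "s \<le> t" "0 < (n::nat)"
  shows "(\<Sum>x'<n. if (x' + s) mod n = (x + t) mod n then f x' else 0) = f ((x + (t - s)) mod n)"
proof -
  have "(x' + s) mod n = (x + t) mod n \<longleftrightarrow> x' = (x + (t - s)) mod n" if "x' < n" for x'
  proof -
    have "(x' + s) mod n = (x + t) mod n \<longleftrightarrow> (x' + s) mod n = (x + (t - s) + s) mod n"
      using assms by simp
    also have "\<dots> \<longleftrightarrow> x' mod n = (x + (t - s)) mod n"
      using cong_add_rcancel_nat unfolding cong_def by blast
    finally show ?thesis using that by simp
  qed
  then have "(\<Sum>x'<n. if (x' + s) mod n = (x + t) mod n then f x' else 0)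
      = (\<Sum>x'<n. if x' = (x + (t - s)) mod n then f x' else 0)"
    by (intro sum.cong refl) auto
  then show ?thesis using assms by simp
qed

text \<open>For each edge, exactly one block row reaches a given column block. So the load of a
  class modulo \<open>n\<close> consists of the \<open>t + 1\<close> choices made while one lifted
  block passes through the window.\<close>

lemma load_cyclic:
  assumes "x < n"
  shows "load (Suc t) (\<lambda>x i. (x + i) mod n) n Q ((x + t) mod n)
    = (\<Sum>s<t. Q ((Suc x + (t - Suc s)) mod n) s) + Q x t"
proof -
  have "load (Suc t) (\<lambda>x i. (x + i) mod n) n Q ((x + t) mod n)
      = (\<Sum>s<Suc t. \<Sum>x'<n. if (x' + s) mod n = (x + t) mod n then Q x' s else 0)"
    unfolding load_def by (rule sum.swap)
  also have "\<dots> = (\<Sum>s<Suc t. Q ((x + (t - s)) mod n) s)"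
    by (intro sum.cong refl sum_mod_delta) (use assms in auto)
  also have "\<dots> = (\<Sum>s<t. Q ((Suc x + (t - Suc s)) mod n) s) + Q x t"
    using assms by (simp add: Suc_diff_Suc)
  finally show ?thesis .
qed

lemma cyc_exit:
  assumes "x < n"
  shows "cyc_state k t n Q (Suc x) t - Q x t = k - load (Suc t) (\<lambda>x i. (x + i) mod n) n Q ((x + t) mod n)"
  unfolding load_cyclic[OF assms] by (simp add: cyc_state_def)

lemma bij_betw_add_mod: "bij_betw (\<lambda>x. (x + t) mod n) {..<n} {..<n :: nat}"
proof (cases "n = 0")
  case False
  have "inj_on (\<lambda>x. (x + t) mod n) {..<n}"
    using cong_add_rcancel_nat unfolding cong_def inj_on_def by (metis lessThan_iff mod_less)
  moreover have "(\<lambda>x. (x + t) mod n) ` {..<n} \<subseteq> {..<n}" using False by auto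
  ultimately show ?thesis by (simp add: bij_betw_def endo_inj_surj)
qed (simp add: bij_betw_def)

text \<open>Multiplied by the factorials of all choices and of the columns left in each block, both
  sides give \<open>fact k ^ n\<close>. For the walk this is a telescoping product in which the
  factorials of the states cancel around the cycle. If some choice exceeds the available columns,
  both sides vanish.\<close>

lemma cyc_choose_eq:
  fixes k t n Q
  defines "A \<equiv> cyc_state k t n Q" and "tgt \<equiv> \<lambda>x i. (x + i) mod n"
  assumes n: "n > 0"
  shows "(\<Prod>x<n. \<Prod>i<Suc t. A (Suc x) i choose Q x i)
    = rows_choose (Suc t) tgt n (\<lambda>y. if y < n then k else 0) Q"
proof -
  let ?s = "\<lambda>y. if y < n then k else 0"
  let ?M = "load (Suc t) tgt n Q" and ?P = "\<Prod>x<n. \<Prod>i<Suc t. A (Suc x) i choose Q x i"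
  let ?F = "\<Prod>x<n. \<Prod>i<Suc t. fact (Q x i) :: nat"
  let ?ok = "\<forall>x<n. \<forall>i\<le>t. Q x i \<le> A (Suc x) i"
  have M: "?M ((x + t) mod n) = (\<Sum>s<t. Q ((Suc x + (t - Suc s)) mod n) s) + Q x t" if "x < n" for x
    unfolding tgt_def by (rule load_cyclic[OF that])
  have exit: "A (Suc x) t - Q x t = k - ?M ((x + t) mod n)" if "x < n" for x
    unfolding A_def tgt_def by (rule cyc_exit[OF that])
  show ?thesis
  proof (cases ?ok)
    case True
    \<comment> \<open>\<open>cyc_state\<close> subtracts with truncation. The bound shows that
      nothing has been cut off; its last case \<open>i = Suc t\<close> bounds the loads.\<close>
    have bnd: "(\<Sum>s<i. Q ((x + (i - Suc s)) mod n) s) \<le> k" if "i \<le> Suc t" for i x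
      using that
    proof (induction i arbitrary: x)
      case (Suc i)
      let ?x = "x mod n"
      have "Q ?x i \<le> A (Suc ?x) i" using True Suc.prems n by auto
      also have "\<dots> = k - (\<Sum>s<i. Q ((Suc ?x + (i - Suc s)) mod n) s)"
        using Suc.prems by (simp add: A_def cyc_state_def)
      finally have "(\<Sum>s<i. Q ((Suc ?x + (i - Suc s)) mod n) s) + Q ?x i \<le> k"
        using Suc.IH[of "Suc ?x"] Suc.prems by simp
      moreover have "(\<Sum>s<i. Q ((Suc ?x + (i - Suc s)) mod n) s) = (\<Sum>s<i. Q ((x + (Suc i - Suc s)) mod n) s)"
      proof (intro sum.cong refl)
        fix s assume "s \<in> {..<i}"
        then have "Suc ?x + (i - Suc s) = x mod n + (Suc i - Suc s)" by simp
        then show "Q ((Suc ?x + (i - Suc s)) mod n) s = Q ((x + (Suc i - Suc s)) mod n) s"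
          by (simp only: mod_add_left_eq)
      qed
      ultimately show ?case by simp
    qed simp
    have Mk: "?M y \<le> k" if y: "y < n" for y
    proof -
      obtain x where x: "x < n" "y = (x + t) mod n"
        using bij_betw_add_mod[of t n] y unfolding bij_betw_def by auto
      have "?M y = (\<Sum>s<Suc t. Q ((x + (Suc t - Suc s)) mod n) s)"
        using M[OF x(1)] x by (simp add: Suc_diff_Suc)
      then show ?thesis using bnd[of "Suc t" x] by simp
    qed
    have "rows_choose (Suc t) tgt n ?s Q * ?F * (\<Prod>y<n. fact (?s y - ?M y)) = (\<Prod>y<n. fact (?s y))"
      by (rule rows_choose_telescope) (use n Mk in \<open>auto simp: tgt_def\<close>)
    then have R: "rows_choose (Suc t) tgt n ?s Q * ?F * (\<Prod>y<n. fact (k - ?M y)) = fact k ^ n"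
      by simp
    \<comment> \<open>\<open>?\<Phi> x\<close> collects the factorials of positions 1 to
      \<open>t\<close>. Position 0 contributes the \<open>fact k\<close> of the entering block, and
      \<open>?E x\<close> belongs to the leaving block.\<close>
    let ?E = "\<lambda>x. fact (A (Suc x) t - Q x t) :: nat" and ?\<Phi> = "\<lambda>x. \<Prod>i<t. fact (A x (Suc i)) :: nat"
    have row: "(\<Prod>i<Suc t. A (Suc x) i choose Q x i) * (\<Prod>i<Suc t. fact (Q x i)) * (?\<Phi> x * ?E x)
        = fact k * ?\<Phi> (Suc x)" if x: "x < n" for x
    proof -
      have "A x (Suc i) = A (Suc x) i - Q x i" if "i < t" for i
        unfolding A_def cyc_state_step[OF x] using that by (simp add: step_state_def)
      then have "?\<Phi> x * ?E x = (\<Prod>i<Suc t. fact (A (Suc x) i - Q x i))" by simp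
      then have "(\<Prod>i<Suc t. A (Suc x) i choose Q x i) * (\<Prod>i<Suc t. fact (Q x i)) * (?\<Phi> x * ?E x)
          = (\<Prod>i<Suc t. (A (Suc x) i choose Q x i) * fact (Q x i) * fact (A (Suc x) i - Q x i))"
        by (simp only: prod.distrib)
      also have "\<dots> = (\<Prod>i<Suc t. fact (A (Suc x) i))"
        using True x by (intro prod.cong refl choose_mult_fact) auto
      also have "\<dots> = fact k * ?\<Phi> (Suc x)"
        unfolding prod.lessThan_Suc_shift by (simp add: A_def cyc_state_def)
      finally show ?thesis .
    qed
    have "?P * ?F * ((\<Prod>x<n. ?\<Phi> x) * (\<Prod>x<n. ?E x)) = fact k ^ n * (\<Prod>x<n. ?\<Phi> (Suc x))"
    proof -
      have "?P * ?F * ((\<Prod>x<n. ?\<Phi> x) * (\<Prod>x<n. ?E x))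
          = (\<Prod>x<n. (\<Prod>i<Suc t. A (Suc x) i choose Q x i) * (\<Prod>i<Suc t. fact (Q x i)) * (?\<Phi> x * ?E x))"
        by (simp only: prod.distrib)
      also have "\<dots> = (\<Prod>x<n. fact k * ?\<Phi> (Suc x))"
        by (intro prod.cong refl row) auto
      finally show ?thesis by (simp add: prod.distrib)
    qed
    \<comment> \<open>Shifting the time index exchanges \<open>?\<Phi> 0\<close> for
      \<open>?\<Phi> n\<close>, and these agree because the walk is closed.\<close>
    moreover have "(\<Prod>x<n. ?\<Phi> (Suc x)) = (\<Prod>x<n. ?\<Phi> x)"
    proof -
      have "(\<Prod>x<n. ?\<Phi> (Suc x)) * ?\<Phi> 0 = (\<Prod>x<n. ?\<Phi> x) * ?\<Phi> n"
        using prod.lessThan_Suc_shift[of ?\<Phi> n] prod.lessThan_Suc[of ?\<Phi> n]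
        unfolding mult.commute[of "?\<Phi> 0"] by (rule trans[OF sym])
      moreover have "A n = A 0" unfolding A_def by (rule cyc_state_closed)
      moreover have "?\<Phi> 0 \<noteq> 0" by simp
      ultimately show ?thesis by (simp only: mult_cancel2 simp_thms)
    qed
    ultimately have "(?P * ?F * (\<Prod>x<n. ?E x)) * (\<Prod>x<n. ?\<Phi> x) = fact k ^ n * (\<Prod>x<n. ?\<Phi> x)"
      by (simp only: mult_ac)
    moreover have "(\<Prod>x<n. ?\<Phi> x) \<noteq> 0" by simp
    ultimately have "?P * ?F * (\<Prod>x<n. ?E x) = fact k ^ n"
      by (simp only: mult_cancel2 simp_thms)
    moreover have "(\<Prod>x<n. ?E x) = (\<Prod>y<n. fact (k - ?M y))"
    proof -
      have "(\<Prod>x<n. ?E x) = (\<Prod>x<n. fact (k - ?M ((x + t) mod n)))"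
        by (intro prod.cong refl) (simp add: exit)
      also have "\<dots> = (\<Prod>y<n. fact (k - ?M y))"
        by (rule prod.reindex_bij_betw[OF bij_betw_add_mod])
      finally show ?thesis .
    qed
    ultimately have "?P * (?F * (\<Prod>y<n. fact (k - ?M y)))
        = rows_choose (Suc t) tgt n ?s Q * (?F * (\<Prod>y<n. fact (k - ?M y)))"
      using R by (simp only: mult.assoc)
    moreover have "?F * (\<Prod>y<n. fact (k - ?M y)) \<noteq> 0" by simp
    ultimately show ?thesis by (simp only: mult_cancel2 simp_thms)
  next
    case False
    then obtain x i where xi: "x < n" "i \<le> t" "A (Suc x) i < Q x i" by (auto simp: not_le)
    have "(\<Prod>i<Suc t. A (Suc x) i choose Q x i) = 0"
      by (rule prod_zero) (use xi in \<open>auto intro!: bexI[of _ i] binomial_eq_0\<close>)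
    then have "?P = 0" using xi by (intro prod_zero) auto
    define y where "y = (x + i) mod n"
    \<comment> \<open>An overdraft at position \<open>i\<close> involves only the edges up to
      \<open>i\<close>; the later edges can only increase the load of the same column block.\<close>
    have "k < (\<Sum>s<i. Q ((Suc x + (i - Suc s)) mod n) s) + Q x i"
      using xi by (auto simp: A_def cyc_state_def)
    also have "\<dots> = (\<Sum>s<Suc i. Q ((x + (i - s)) mod n) s)"
      using xi by (simp add: Suc_diff_Suc)
    also have "\<dots> = (\<Sum>s<Suc i. \<Sum>x'<n. if (x' + s) mod n = (x + i) mod n then Q x' s else 0)"
      by (intro sum.cong refl sum_mod_delta[symmetric]) (use n in auto)
    also have "\<dots> \<le> (\<Sum>s<Suc t. \<Sum>x'<n. if (x' + s) mod n = (x + i) mod n then Q x' s else 0)"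
      by (rule sum_mono2) (use xi in auto)
    also have "\<dots> = ?M y"
      unfolding load_def tgt_def y_def by (rule sum.swap)
    finally have "?s y < ?M y" using n by (simp add: y_def)
    then have "rows_choose (Suc t) tgt n ?s Q = 0" by (rule rows_choose_eq_0)
    then show ?thesis using \<open>?P = 0\<close> by simp
  qed
qed

text \<open>Each \<open>Q\<close> belongs to one closed walk, and its contributions to both sides
  agree factor by factor: the binomial coefficients by \<open>cyc_choose_eq\<close>, the exponents
  of \<open>v\<close> because every column block leaves the window exactly once in \<open>n\<close>
  steps.\<close>

lemma walk_sum_cyclic:
  assumes n: "n > 0"
  shows "(\<Sum>\<alpha>\<in>states k t. walk_sum u v k t c n \<alpha> \<alpha>)
    = block_rook u v k (Suc t) c (\<lambda>x i. (x + i) mod n) {..<n} n (\<lambda>y. if y < n then k else 0)"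
proof -
  let ?P = "PiE {..<n} (\<lambda>_. choices k t)" and ?tgt = "\<lambda>x i. (x + i) mod n"
  let ?A = "\<lambda>Q. cyc_state k t n Q" and ?s = "\<lambda>y. if y < n then k else 0"
  have "(\<Sum>\<alpha>\<in>states k t. walk_sum u v k t c n \<alpha> \<alpha>) = (\<Sum>Q\<in>?P. \<Sum>\<alpha>\<in>states k t.
      if \<alpha> = ?A Q n then \<Prod>x<n. step_wt u v k t c (walk_at k t n \<alpha> Q (Suc x)) (Q x) else 0)"
    unfolding walk_sum_expand by (subst sum.swap) (use n in \<open>simp add: closed_walk_iff cong: sum.cong\<close>)
  also have "\<dots> = (\<Sum>Q\<in>?P. \<Prod>x<n. step_wt u v k t c (?A Q (Suc x)) (Q x))"
  proof (intro sum.cong refl)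
    fix Q
    have "walk_at k t n (?A Q n) Q (Suc x) = ?A Q (Suc x)" if "x < n" for x
      by (rule walk_at_unique) (use that cyc_state_step in auto)
    then show "(\<Sum>\<alpha>\<in>states k t. if \<alpha> = ?A Q n
          then \<Prod>x<n. step_wt u v k t c (walk_at k t n \<alpha> Q (Suc x)) (Q x) else 0)
        = (\<Prod>x<n. step_wt u v k t c (?A Q (Suc x)) (Q x))"
      by (simp add: cyc_state_in cong: prod.cong_simp)
  qed
  also have "\<dots> = (\<Sum>Q\<in>?P. (\<Prod>x<n. row_wt u k (\<Sum>i<Suc t. Q x i) * (\<Prod>i<Suc t. c i ^ Q x i)) *
     of_nat (rows_choose (Suc t) ?tgt n ?s Q) * v ^ (\<Sum>y<n. ?s y - load (Suc t) ?tgt n Q y))"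
  proof (intro sum.cong refl)
    fix Q
    have "(\<Prod>x<n. v ^ (?A Q (Suc x) t - Q x t)) = v ^ (\<Sum>x<n. ?A Q (Suc x) t - Q x t)"
      by (simp add: power_sum)
    also have "(\<Sum>x<n. ?A Q (Suc x) t - Q x t) = (\<Sum>x<n. k - load (Suc t) ?tgt n Q ((x + t) mod n))"
      by (intro sum.cong refl cyc_exit) simp
    also have "\<dots> = (\<Sum>y<n. k - load (Suc t) ?tgt n Q y)"
      by (rule sum.reindex_bij_betw[OF bij_betw_add_mod])
    also have "\<dots> = (\<Sum>y<n. ?s y - load (Suc t) ?tgt n Q y)"
      by (intro sum.cong refl) simp
    finally have v: "(\<Prod>x<n. v ^ (?A Q (Suc x) t - Q x t)) = v ^ (\<Sum>y<n. ?s y - load (Suc t) ?tgt n Q y)" .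
    show "(\<Prod>x<n. step_wt u v k t c (?A Q (Suc x)) (Q x))
        = (\<Prod>x<n. row_wt u k (\<Sum>i<Suc t. Q x i) * (\<Prod>i<Suc t. c i ^ Q x i)) *
     of_nat (rows_choose (Suc t) ?tgt n ?s Q) * v ^ (\<Sum>y<n. ?s y - load (Suc t) ?tgt n Q y)"
      unfolding step_wt_def prod.distrib v of_nat_prod[symmetric] cyc_choose_eq[OF n] ..
  qed
  also have "\<dots> = block_rook u v k (Suc t) c ?tgt {..<n} n ?s"
    unfolding block_rook_expand choices_def ..
  finally show ?thesis .
qed

section \<open>The matrices as transfer matrices\<close>

lemma pow_mat_Suc_left:
  assumes "A \<in> carrier_mat n n"
  shows "A ^\<^sub>m Suc m = A * A ^\<^sub>m m"
proof (induction m)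
  case 0
  show ?case using assms by simp
next
  case (Suc m)
  have "A ^\<^sub>m Suc (Suc m) = A * A ^\<^sub>m m * A" using Suc by simp
  also have "\<dots> = A * (A ^\<^sub>m m * A)"
    by (rule assoc_mult_mat) (use assms in \<open>auto intro: pow_carrier_mat\<close>)
  finally show ?case by simp
qed

lemma index_mult_mat_sum:
  assumes "A \<in> carrier_mat N N" "B \<in> carrier_mat N N" "i < N" "j < N"
  shows "(A * B) $$ (i, j) = (\<Sum>l<N. A $$ (i, l) * B $$ (l, j))"
  using assms by (auto simp: scalar_prod_def atLeast0LessThan intro!: sum.cong)

lemma indexed_mat_carrier: "indexed_mat L X f \<in> carrier_mat (card X) (card X)"
  by (simp add: indexed_mat_def)

lemma indexed_mat_index:
  assumes L: "bij_betw L X {..<card X}" and "a \<in> X" "b \<in> X"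
  shows "indexed_mat L X f $$ (L a, L b) = f a b"
proof -
  have "L a < card X" "L b < card X" using assms bij_betwE by fastforce+
  then show ?thesis using assms by (simp add: indexed_mat_def bij_betw_inv_into_left)
qed

text \<open>\<open>S\<close> is closed only under steps of nonzero weight, which admits the level
  sets of \<open>state_size\<close>: the matrices \<open>\<Pi>\<close> for different totals are
  diagonal blocks of one transfer matrix.\<close>

lemma indexed_mat_pow_walk_sum:
  assumes L: "bij_betw L (rep_vec t ` S) {..<card (rep_vec t ` S)}"
    and inj: "inj_on (rep_vec t) S" and S: "finite S"
    and f: "\<And>\<alpha> \<beta>. \<alpha> \<in> S \<Longrightarrow> \<beta> \<in> S \<Longrightarrow> f (rep_vec t \<alpha>) (rep_vec t \<beta>)
      = (\<Sum>q\<in>choices k t. if step_state k t \<alpha> q = \<beta> then step_wt u v k t c \<alpha> q else 0)"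
    and closed: "\<And>\<alpha> q. \<alpha> \<in> S \<Longrightarrow> q \<in> choices k t \<Longrightarrow> step_wt u v k t c \<alpha> q \<noteq> 0 \<Longrightarrow> step_state k t \<alpha> q \<in> S"
    and "\<alpha> \<in> S" "\<beta> \<in> S"
  shows "(indexed_mat L (rep_vec t ` S) f ^\<^sub>m n) $$ (L (rep_vec t \<alpha>), L (rep_vec t \<beta>))
    = walk_sum u v k t c n \<alpha> \<beta>"
  using \<open>\<alpha> \<in> S\<close>
proof (induction n arbitrary: \<alpha>)
  let ?X = "rep_vec t ` S" and ?A = "indexed_mat L (rep_vec t ` S) f"
  have lt: "L (rep_vec t \<gamma>) < card ?X" if "\<gamma> \<in> S" for \<gamma>
    using bij_betwE[OF L] that by fastforce
  {
    case 0
    have "L (rep_vec t \<alpha>) = L (rep_vec t \<beta>) \<longleftrightarrow> \<alpha> = \<beta>"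
      using 0 \<open>\<beta> \<in> S\<close> L inj by (auto simp: bij_betw_def inj_on_def)
    then show ?case using 0 \<open>\<beta> \<in> S\<close> lt by (simp add: indexed_mat_def)
  next
    case (Suc n)
    have "(?A ^\<^sub>m Suc n) $$ (L (rep_vec t \<alpha>), L (rep_vec t \<beta>))
        = (\<Sum>l<card ?X. ?A $$ (L (rep_vec t \<alpha>), l) * (?A ^\<^sub>m n) $$ (l, L (rep_vec t \<beta>)))"
      unfolding pow_mat_Suc_left[OF indexed_mat_carrier] using lt Suc.prems \<open>\<beta> \<in> S\<close>
      by (intro index_mult_mat_sum) (auto intro: indexed_mat_carrier pow_carrier_mat)
    also have "\<dots> = (\<Sum>g\<in>?X. ?A $$ (L (rep_vec t \<alpha>), L g) * (?A ^\<^sub>m n) $$ (L g, L (rep_vec t \<beta>)))"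
      by (rule sum.reindex_bij_betw[OF L, symmetric])
    also have "\<dots> = (\<Sum>\<gamma>\<in>S. ?A $$ (L (rep_vec t \<alpha>), L (rep_vec t \<gamma>))
        * (?A ^\<^sub>m n) $$ (L (rep_vec t \<gamma>), L (rep_vec t \<beta>)))"
      by (simp add: sum.reindex[OF inj])
    also have "\<dots> = (\<Sum>\<gamma>\<in>S. (\<Sum>q\<in>choices k t. if step_state k t \<alpha> q = \<gamma> then step_wt u v k t c \<alpha> q else 0)
        * walk_sum u v k t c n \<gamma> \<beta>)"
      using Suc by (intro sum.cong refl) (simp add: indexed_mat_index[OF L] f)
    also have "\<dots> = (\<Sum>q\<in>choices k t. \<Sum>\<gamma>\<in>S. if step_state k t \<alpha> q = \<gamma>
        then step_wt u v k t c \<alpha> q * walk_sum u v k t c n \<gamma> \<beta> else 0)"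
      unfolding sum_distrib_right by (subst sum.swap) (intro sum.cong refl, simp)
    also have "\<dots> = (\<Sum>q\<in>choices k t. step_wt u v k t c \<alpha> q * walk_sum u v k t c n (step_state k t \<alpha> q) \<beta>)"
    proof (intro sum.cong refl)
      fix q assume q: "q \<in> choices k t"
      show "(\<Sum>\<gamma>\<in>S. if step_state k t \<alpha> q = \<gamma> then step_wt u v k t c \<alpha> q * walk_sum u v k t c n \<gamma> \<beta> else 0)
          = step_wt u v k t c \<alpha> q * walk_sum u v k t c n (step_state k t \<alpha> q) \<beta>"
        using closed[OF Suc.prems q] S by (cases "step_wt u v k t c \<alpha> q = 0") auto
    qed
    finally show ?case by simp
  }
qed

lemma trace_indexed_mat_pow:
  assumes L: "bij_betw L X {..<card X}"
  shows "trace_mat (indexed_mat L X f ^\<^sub>m n) = (\<Sum>g\<in>X. (indexed_mat L X f ^\<^sub>m n) $$ (L g, L g))"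
proof -
  have "indexed_mat L X f ^\<^sub>m n \<in> carrier_mat (card X) (card X)"
    by (intro pow_carrier_mat indexed_mat_carrier)
  then have "trace_mat (indexed_mat L X f ^\<^sub>m n) = (\<Sum>i<card X. (indexed_mat L X f ^\<^sub>m n) $$ (i, i))"
    by (auto simp: trace_mat_def)
  then show ?thesis by (simp add: sum.reindex_bij_betw[OF L, symmetric])
qed

subsection \<open>Vectors of the index sets and states\<close>

definition state_size :: "nat \<Rightarrow> (nat \<Rightarrow> nat) \<Rightarrow> nat" where
  "state_size t \<alpha> = (\<Sum>i=1..t. \<alpha> i)"

lemma rep_vec_cong: "(\<And>i. 1 \<le> i \<Longrightarrow> i \<le> t \<Longrightarrow> l i = l' i) \<Longrightarrow> rep_vec t l = rep_vec t l'"
  unfolding rep_vec_def by (intro arg_cong[where f = concat] map_cong) auto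

lemma count_list_rep_vec': "count_list (rep_vec t l) i = (if 1 \<le> i \<and> i \<le> t then l i else 0)"
proof (cases "1 \<le> i \<and> i \<le> t")
  case False
  then have "i \<notin> set (rep_vec t l)" by (auto simp: rep_vec_def)
  then show ?thesis using False by (auto simp: count_list_0_iff)
qed (simp add: count_list_rep_vec)

lemma rep_vec_extend:
  assumes "r \<le> t"
  shows "rep_vec t (\<lambda>i. if i \<le> r then l i else 0) = rep_vec r l"
proof -
  have "[1..<Suc t] = [1..<Suc r] @ [Suc r..<Suc t]"
    using assms by (metis Suc_le_mono le_add1 le_Suc_ex plus_1_eq_Suc upt_add_eq_append)
  moreover have "concat (map (\<lambda>i. replicate (if i \<le> r then l i else 0) i) [Suc r..<Suc t]) = []"
    by simp
  moreover have "map (\<lambda>i. replicate (if i \<le> r then l i else 0) i) [1..<Suc r]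
      = map (\<lambda>i. replicate (l i) i) [1..<Suc r]"
    by (rule map_cong) auto
  ultimately show ?thesis unfolding rep_vec_def by (simp only: map_append concat_append append_Nil2)
qed

lemma inj_on_rep_vec: "inj_on (rep_vec t) (states k t)"
proof (rule inj_onI)
  fix \<alpha> \<beta> assume ab: "\<alpha> \<in> states k t" "\<beta> \<in> states k t" "rep_vec t \<alpha> = rep_vec t \<beta>"
  show "\<alpha> = \<beta>"
  proof
    fix i
    consider "i = 0" | "1 \<le> i" "i \<le> t" | "i > t" by linarith
    then show "\<alpha> i = \<beta> i"
      using ab rep_vec_eqD[OF ab(3)] by cases (auto simp: states_def)
  qed
qed

lemma rep_vec_image:
  "rep_vec t ` {\<alpha> \<in> states k t. P \<alpha>}
     = {rep_vec t l | l. (\<forall>i\<in>{1..t}. l i \<le> k) \<and> P l}"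
  if P: "\<And>\<alpha> \<beta>. (\<And>i. 1 \<le> i \<Longrightarrow> i \<le> t \<Longrightarrow> \<alpha> i = \<beta> i) \<Longrightarrow> P \<alpha> \<Longrightarrow> P \<beta>"
proof (intro equalityI subsetI)
  fix g assume "g \<in> {rep_vec t l | l. (\<forall>i\<in>{1..t}. l i \<le> k) \<and> P l}"
  then obtain l where l: "g = rep_vec t l" "\<forall>i\<in>{1..t}. l i \<le> k" "P l" by blast
  define \<alpha> where "\<alpha> = (\<lambda>i. if i = 0 then k else if i \<le> t then l i else 0)"
  have "g = rep_vec t \<alpha>" unfolding l(1) by (rule rep_vec_cong) (simp add: \<alpha>_def)
  moreover have "\<alpha> \<in> states k t" using l(2) by (auto simp: states_def \<alpha>_def)
  moreover have "P \<alpha>" using l(3) by (rule P[rotated]) (simp add: \<alpha>_def)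
  ultimately show "g \<in> rep_vec t ` {\<alpha> \<in> states k t. P \<alpha>}" by blast
qed (auto simp: states_def)

lemma G_set_eq: "G_set t k = rep_vec t ` states k t"
  using rep_vec_image[of t "\<lambda>_. True" k] by (simp add: G_set_def)

lemma G_sub_eq: "G_sub l t k = rep_vec t ` {\<alpha> \<in> states k t. state_size t \<alpha> = l}"
proof -
  have "rep_vec t ` {\<alpha> \<in> states k t. state_size t \<alpha> = l}
     = {rep_vec t \<alpha> | \<alpha>. (\<forall>i\<in>{1..t}. \<alpha> i \<le> k) \<and> state_size t \<alpha> = l}"
    by (rule rep_vec_image) (auto simp: state_size_def intro!: sum.cong)
  then show ?thesis by (simp add: G_sub_def state_size_def)
qed

lemma state_size_le: "\<alpha> \<in> states k t \<Longrightarrow> state_size t \<alpha> \<le> k * t"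
  using sum_bounded_above[of "{1..t}" \<alpha> k] by (simp add: state_size_def states_def mult.commute)

subsection \<open>Entries\<close>

lemma split_first_last:
  assumes "t > 0"
  shows "(\<Prod>i<Suc t. f i) = f 0 * (\<Prod>i=1..<t. f i) * f t"
    and "(\<Sum>i<Suc t. g i) = g 0 + (\<Sum>i=1..<t. g i) + g t"
proof -
  have "{..<t} = insert 0 {1..<t}" using assms by auto
  then show "(\<Prod>i<Suc t. f i) = f 0 * (\<Prod>i=1..<t. f i) * f t"
    and "(\<Sum>i<Suc t. g i) = g 0 + (\<Sum>i=1..<t. g i) + g t"
    by simp_all
qed

lemma states_0: "states k 0 = {\<lambda>i. if i = 0 then k else 0}"
  by (auto simp: states_def)

text \<open>A binomial coefficient vanishes at every overdraft. There is no converse in a general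
  commutative ring, where an admissible step may also have weight zero.\<close>

lemma step_wt_nonzeroD:
  fixes c :: "nat \<Rightarrow> 'b::comm_ring_1"
  assumes "step_wt u v k t c \<alpha> q \<noteq> 0"
  shows "(\<Sum>i<Suc t. q i) \<le> k" "i \<le> t \<Longrightarrow> q i \<le> \<alpha> i"
proof -
  have nz: "row_wt u k (\<Sum>i<Suc t. q i) \<noteq> 0" "(\<Prod>i<Suc t. \<alpha> i choose q i) \<noteq> 0"
    using assms unfolding step_wt_def by (metis mult_zero_left mult_zero_right of_nat_0)+
  show "(\<Sum>i<Suc t. q i) \<le> k"
  proof (rule ccontr)
    assume "\<not> (\<Sum>i<Suc t. q i) \<le> k"
    then have "k choose (\<Sum>i<Suc t. q i) = 0" by (intro binomial_eq_0) simp
    then show False using nz(1) by (simp only: row_wt_def mult_zero_right of_nat_0 mult_zero_left simp_thms)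
  qed
  show "q i \<le> \<alpha> i" if "i \<le> t"
  proof (rule ccontr)
    assume "\<not> q i \<le> \<alpha> i"
    then have "\<alpha> i choose q i = 0" by (intro binomial_eq_0) simp
    then have "(\<Prod>i<Suc t. \<alpha> i choose q i) = 0" by (intro prod_zero) (use that in auto)
    then show False using nz(2) by contradiction
  qed
qed

lemma step_state_eqI:
  assumes "\<beta> \<in> states k t" "\<And>i. i < t \<Longrightarrow> \<alpha> i - q i = \<beta> (Suc i)"
  shows "step_state k t \<alpha> q = \<beta>"
proof
  fix i
  show "step_state k t \<alpha> q i = \<beta> i"
    using assms by (cases i) (auto simp: step_state_def states_def)
qed

text \<open>Given \<open>\<alpha>\<close> and \<open>\<beta>\<close>, the choices at positions below
  \<open>t\<close> are differences of their components; only the number \<open>d\<close> taken from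
  the leaving block is free, which gives the inner sum of \<open>K\<close>. The parameter
  \<open>v\<close> is the number of columns taken at positions below \<open>t\<close>, so
  \<open>v - (\<Sum>i=1..<t. p i)\<close> come from the entering block.\<close>

lemma K_entry_eq_step_sum:
  assumes \<alpha>: "\<alpha> \<in> states k t" and \<beta>: "\<beta> \<in> states k t"
  shows "K_entry k t a (rep_vec t \<alpha>) (rep_vec t \<beta>)
    = (\<Sum>q\<in>choices k t. if step_state k t \<alpha> q = \<beta> then step_wt 1 1 k t a \<alpha> q else 0)"
proof (cases "t = 0")
  case True
  have "step_state k 0 \<alpha> q = \<beta>" for q
    using \<beta> True by (auto simp: states_0 step_state_def)
  then have "(\<Sum>q\<in>choices k t. if step_state k t \<alpha> q = \<beta> then step_wt 1 1 k t a \<alpha> q else 0)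
      = (\<Sum>q\<in>PiE (insert 0 {}) (\<lambda>_. {..k}). step_wt 1 1 k 0 a \<alpha> q)"
    using True by (simp add: choices_def lessThan_Suc)
  also have "\<dots> = (\<Sum>d\<le>k. of_nat (fact d * (k choose d) ^ 2) * a 0 ^ d)"
    using \<alpha> True by (subst sum_PiE_insert) (auto simp: step_wt_def row_wt_def states_0 power2_eq_square
      mult_ac intro!: sum.cong)
  finally show ?thesis using True by (simp add: K_entry_def atMost_atLeast0)
next
  case False
  then have t: "t > 0" by simp
  have cnt: "count_list (rep_vec t \<alpha>) i = \<alpha> i" if "1 \<le> i" "i \<le> t" for i
    using that by (rule count_list_rep_vec)
  have \<alpha>0: "\<alpha> 0 = k" using \<alpha> by (simp add: states_def)
  let ?w = "step_wt 1 1 k t a \<alpha>"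
  let ?f = "\<lambda>q. if step_state k t \<alpha> q = \<beta> then ?w q else 0"
  show ?thesis
  proof (cases "\<exists>p v. K_cond k t (rep_vec t \<alpha>) (rep_vec t \<beta>) p v")
    case True
    then obtain p v where pv: "K_cond k t (rep_vec t \<alpha>) (rep_vec t \<beta>) p v" by blast
    let ?s = "\<Sum>i=1..<t. p i"
    have p: "p i \<le> \<alpha> i" if "1 \<le> i" "i < t" for i
      using pv that cnt unfolding K_cond_def by auto
    have sv: "?s \<le> v" "v \<le> k" using pv unfolding K_cond_def by auto
    have "rep_vec t \<beta> = rep_vec t (\<lambda>i. if i = 1 then k - v + ?s else
        count_list (rep_vec t \<alpha>) (i - 1) - p (i - 1))"
      using pv unfolding K_cond_def by blast
    note eq = rep_vec_eqD[OF this]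
    have \<beta>1: "\<beta> 1 = k - v + ?s" using eq[of 1] t by simp
    have \<beta>i: "\<beta> (Suc i) = \<alpha> i - p i" if "1 \<le> i" "i < t" for i
      using eq[of "Suc i"] that cnt by simp
    define Q where "Q d = (\<lambda>i\<in>{..<Suc t}. if i = 0 then v - ?s else if i < t then p i else d)" for d
    have Q: "Q d 0 = v - ?s" "1 \<le> i \<Longrightarrow> i < t \<Longrightarrow> Q d i = p i" "Q d t = d" for d i
      using t by (auto simp: Q_def)
    have \<alpha>k: "\<alpha> i \<le> k" for i using \<alpha> by (simp add: states_def)
    let ?D = "{0..min (\<alpha> t) (k - v)}"
    \<comment> \<open>Under truncated subtraction an overdrawn choice may also lead to
      \<open>\<beta>\<close>. Such choices have weight zero, so the bijection is set up between the
      supports only.\<close>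
    have "(\<Sum>q\<in>choices k t. ?f q) = (\<Sum>q | q \<in> choices k t \<and> ?f q \<noteq> 0. ?f q)"
      by (rule sum.mono_neutral_right) auto
    also have "\<dots> = (\<Sum>d | d \<in> ?D \<and> ?w (Q d) \<noteq> 0. ?w (Q d))"
    proof (rule sum.reindex_bij_witness[where i = Q and j = "\<lambda>q. q t"])
      fix q assume "q \<in> {q. q \<in> choices k t \<and> ?f q \<noteq> 0}"
      then have q: "q \<in> choices k t" "step_state k t \<alpha> q = \<beta>" "?w q \<noteq> 0"
        by (auto split: if_splits)
      note le = step_wt_nonzeroD(2)[OF q(3)] and sum_le = step_wt_nonzeroD(1)[OF q(3)]
      have st: "\<beta> (Suc i) = \<alpha> i - q i" if "i < t" for i
        using q(2) that by (auto simp: step_state_def)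
      have qi: "q i = p i" if "1 \<le> i" "i < t" for i
        using st[of i] \<beta>i[OF that] le[of i] p[OF that] that by auto
      have q0: "q 0 = v - ?s" using st[of 0] \<beta>1 sv le[of 0] \<alpha>0 t by auto
      have "(\<Sum>i<Suc t. q i) = v - ?s + ?s + q t"
        unfolding split_first_last(2)[OF t] q0 by (simp add: qi)
      then have D: "q t \<in> ?D" using sum_le sv le[of t] by auto
      show Qq: "Q (q t) = q"
        using q(1) qi q0 t by (auto simp: Q_def choices_def PiE_iff extensional_def fun_eq_iff less_Suc_eq)
      show "q t \<in> {d. d \<in> ?D \<and> ?w (Q d) \<noteq> 0}" using D Qq q(3) by simp
      show "?w (Q (q t)) = ?f q" using Qq q by simp
    next
      fix d assume "d \<in> {d. d \<in> ?D \<and> ?w (Q d) \<noteq> 0}"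
      then have d: "d \<in> ?D" and nz: "?w (Q d) \<noteq> 0" by auto
      show "Q d t = d" by (rule Q)
      have "p i \<le> k" if "1 \<le> i" "i < t" for i using p[OF that] \<alpha>k[of i] by linarith
      then have "Q d \<in> choices k t"
        using d sv by (auto simp: choices_def Q_def)
      moreover have "step_state k t \<alpha> (Q d) = \<beta>"
      proof (rule step_state_eqI[OF \<beta>])
        fix i assume "i < t"
        then show "\<alpha> i - Q d i = \<beta> (Suc i)"
          using \<beta>1 \<beta>i[of i] Q sv \<alpha>0 by (cases "i = 0") auto
      qed
      ultimately show "Q d \<in> {q. q \<in> choices k t \<and> ?f q \<noteq> 0}" using nz by simp
    qed
    also have "\<dots> = (\<Sum>d\<in>?D. ?w (Q d))"
      by (rule sum.mono_neutral_left) auto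
    also have "\<dots> = K_val k t a (rep_vec t \<alpha>) p v"
    proof -
      have "?w (Q d) = (\<Prod>i=1..<t. of_nat (\<alpha> i choose p i)) * of_nat (k choose (v - ?s)) *
         a 0 ^ (v - ?s) * (\<Prod>i=1..<t. a i ^ p i) *
         (of_nat (fact (d + v) * (k choose (d + v)) * (\<alpha> t choose d)) * a t ^ d)" for d
      proof -
        have "(\<Sum>i<Suc t. Q d i) = d + v" unfolding split_first_last(2)[OF t] using Q sv by simp
        then show ?thesis
          unfolding step_wt_def split_first_last(1)[OF t] row_wt_def using Q \<alpha>0 by (simp add: mult_ac add.commute)
      qed
      then show ?thesis
        using cnt t by (simp add: K_val_def sum_distrib_left)
    qed
    finally show ?thesis using K_entry_eq[OF pv t] by simp
  next
    case False
    have "?f q = 0" if q: "q \<in> choices k t" for q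
    proof (rule ccontr)
      assume "?f q \<noteq> 0"
      then have st: "step_state k t \<alpha> q = \<beta>" and nz: "?w q \<noteq> 0" by (auto split: if_splits)
      note le = step_wt_nonzeroD(2)[OF nz]
      have sum_le: "q 0 + (\<Sum>i=1..<t. q i) + q t \<le> k"
        using step_wt_nonzeroD(1)[OF nz] unfolding split_first_last(2)[OF t] .
      have "K_cond k t (rep_vec t \<alpha>) (rep_vec t \<beta>) q (q 0 + (\<Sum>i=1..<t. q i))"
        unfolding K_cond_def
      proof (intro conjI)
        show "rep_vec t \<beta> = rep_vec t (\<lambda>i. if i = 1 then k - (q 0 + (\<Sum>i=1..<t. q i)) + (\<Sum>j=1..<t. q j)
            else count_list (rep_vec t \<alpha>) (i - 1) - q (i - 1))"
          using sum_le by (intro rep_vec_cong) (auto simp: st[symmetric] step_state_def \<alpha>0 cnt)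
      qed (use le sum_le cnt in auto)
      then show False using False by blast
    qed
    then have "(\<Sum>q\<in>choices k t. ?f q) = 0" by (intro sum.neutral) auto
    then show ?thesis using False t by (auto simp: K_entry_def)
  qed
qed

lemma step_wt_00_nonzeroD:
  fixes c :: "nat \<Rightarrow> 'b::comm_ring_1"
  assumes "step_wt 0 0 k t c \<alpha> q \<noteq> 0"
  shows "(\<Sum>i<Suc t. q i) = k" "q t = \<alpha> t"
proof -
  have "row_wt 0 k (\<Sum>i<Suc t. q i) \<noteq> (0 :: 'b)" "(0 :: 'b) ^ (\<alpha> t - q t) \<noteq> 0"
    using assms unfolding step_wt_def by (metis mult_zero_left mult_zero_right)+
  then have "k - (\<Sum>i<Suc t. q i) = 0" "\<alpha> t - q t = 0"
    unfolding row_wt_def by (metis mult_zero_right zero_power gr0I)+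
  then show "(\<Sum>i<Suc t. q i) = k" "q t = \<alpha> t"
    using step_wt_nonzeroD(1)[OF assms] step_wt_nonzeroD(2)[OF assms, of t] by auto
qed

text \<open>Now the leaving block must be emptied and all \<open>k\<close> rows be used, which fixes
  the remaining two choices as well. So at most one choice contributes and no inner sum
  appears.\<close>

lemma Pi_entry_eq_step_sum:
  assumes \<alpha>: "\<alpha> \<in> states k t" and \<beta>: "\<beta> \<in> states k t"
  shows "Pi_entry k t a (rep_vec t \<alpha>) (rep_vec t \<beta>)
    = (\<Sum>q\<in>choices k t. if step_state k t \<alpha> q = \<beta> then step_wt 0 0 k t a \<alpha> q else 0)"
proof (cases "t = 0")
  case True
  have "step_state k 0 \<alpha> q = \<beta>" for q
    using \<beta> True by (auto simp: states_0 step_state_def)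
  then have "(\<Sum>q\<in>choices k t. if step_state k t \<alpha> q = \<beta> then step_wt 0 0 k t a \<alpha> q else 0)
      = (\<Sum>q\<in>PiE (insert 0 {}) (\<lambda>_. {..k}). step_wt 0 0 k 0 a \<alpha> q)"
    using True by (simp add: choices_def lessThan_Suc)
  also have "\<dots> = (\<Sum>d\<le>k. step_wt 0 0 k 0 a \<alpha> ((\<lambda>_. undefined)(0 := d)))"
    by (subst sum_PiE_insert) (simp_all del: fun_upd_apply)
  also have "\<dots> = (\<Sum>d\<le>k. if d = k then of_nat (fact k) * a 0 ^ k else 0)"
    using \<alpha> True by (intro sum.cong refl) (auto simp: step_wt_def row_wt_def states_0 power_0_left)
  finally show ?thesis using True by (simp add: Pi_entry_def)
next
  case False
  then have t: "t > 0" by simp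
  have cnt: "count_list (rep_vec t \<alpha>) i = \<alpha> i" if "1 \<le> i" "i \<le> t" for i
    using that by (rule count_list_rep_vec)
  have \<alpha>0: "\<alpha> 0 = k" and \<alpha>k: "\<alpha> i \<le> k" for i using \<alpha> by (simp_all add: states_def)
  let ?w = "step_wt 0 0 k t a \<alpha>"
  let ?f = "\<lambda>q. if step_state k t \<alpha> q = \<beta> then ?w q else 0"
  show ?thesis
  proof (cases "\<exists>p. Pi_cond k t (rep_vec t \<alpha>) (rep_vec t \<beta>) p")
    case True
    then obtain p where p': "Pi_cond k t (rep_vec t \<alpha>) (rep_vec t \<beta>) p" by blast
    let ?s = "\<Sum>i=1..<t. p i"
    have p: "p i \<le> \<alpha> i" if "1 \<le> i" "i < t" for i
      using p' that cnt unfolding Pi_cond_def by auto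
    have s: "?s \<le> k - \<alpha> t" using p' cnt t unfolding Pi_cond_def by auto
    have "rep_vec t \<beta> = rep_vec t (\<lambda>i. if i = 1 then count_list (rep_vec t \<alpha>) t + ?s else
        count_list (rep_vec t \<alpha>) (i - 1) - p (i - 1))"
      using p' unfolding Pi_cond_def by blast
    note eq = rep_vec_eqD[OF this]
    have \<beta>1: "\<beta> 1 = \<alpha> t + ?s" using eq[of 1] t cnt by simp
    have \<beta>i: "\<beta> (Suc i) = \<alpha> i - p i" if "1 \<le> i" "i < t" for i
      using eq[of "Suc i"] that cnt by simp
    define Q where "Q = (\<lambda>i\<in>{..<Suc t}. if i = 0 then k - \<alpha> t - ?s else if i < t then p i else \<alpha> t)"
    have Q: "Q 0 = k - \<alpha> t - ?s" "1 \<le> i \<Longrightarrow> i < t \<Longrightarrow> Q i = p i" "Q t = \<alpha> t" for i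
      using t by (auto simp: Q_def)
    have "p i \<le> k" if "1 \<le> i" "i < t" for i using p[OF that] \<alpha>k[of i] by linarith
    then have Qin: "Q \<in> choices k t" using \<alpha>k by (auto simp: choices_def Q_def)
    have "?f q = 0" if "q \<in> choices k t - {Q}" for q
    proof (rule ccontr)
      assume "?f q \<noteq> 0"
      then have st: "step_state k t \<alpha> q = \<beta>" and nz: "?w q \<noteq> 0" by (auto split: if_splits)
      note le = step_wt_nonzeroD(2)[OF nz] and qt = step_wt_00_nonzeroD(2)[OF nz]
      have st: "\<beta> (Suc i) = \<alpha> i - q i" if "i < t" for i
        using st that by (auto simp: step_state_def)
      have "q i = p i" if "1 \<le> i" "i < t" for i
        using st[of i] \<beta>i[OF that] le[of i] p[OF that] that by auto
      moreover have "q 0 = k - \<alpha> t - ?s" using st[of 0] \<beta>1 s le[of 0] \<alpha>0 t by auto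
      ultimately have "q = Q"
        using that qt t by (auto simp: Q_def choices_def PiE_iff extensional_def fun_eq_iff less_Suc_eq)
      then show False using that by simp
    qed
    then have "(\<Sum>q\<in>choices k t. ?f q) = (\<Sum>q\<in>{Q}. ?f q)"
      using Qin by (intro sum.mono_neutral_right) auto
    also have "step_state k t \<alpha> Q = \<beta>"
    proof (rule step_state_eqI[OF \<beta>])
      fix i assume "i < t"
      then show "\<alpha> i - Q i = \<beta> (Suc i)"
        using \<beta>1 \<beta>i[of i] Q s \<alpha>0 \<alpha>k[of t] by (cases "i = 0") auto
    qed
    then have "(\<Sum>q\<in>{Q}. ?f q) = ?w Q" by simp
    also have "\<dots> = Pi_val k t a (rep_vec t \<alpha>) p"
    proof -
      have "(\<Sum>i<Suc t. Q i) = k" unfolding split_first_last(2)[OF t] using Q s \<alpha>k[of t] by simp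
      \<comment> \<open>The step selects the columns of the entering block that are used, the entry
        of \<open>\<Pi>\<close> those that stay free.\<close>
      moreover have "k choose (k - \<alpha> t - ?s) = k choose (\<alpha> t + ?s)"
        using binomial_symmetric[of "\<alpha> t + ?s" k] s \<alpha>k[of t] by simp
      ultimately show ?thesis
        unfolding step_wt_def split_first_last(1)[OF t] row_wt_def Pi_val_def
        using Q \<alpha>0 cnt t by (simp add: mult_ac)
    qed
    finally show ?thesis using Pi_entry_eq[OF p' t] by simp
  next
    case False
    have "?f q = 0" if q: "q \<in> choices k t" for q
    proof (rule ccontr)
      assume "?f q \<noteq> 0"
      then have st: "step_state k t \<alpha> q = \<beta>" and nz: "?w q \<noteq> 0" by (auto split: if_splits)
      note le = step_wt_nonzeroD(2)[OF nz] and qs = step_wt_00_nonzeroD[OF nz]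
      have sum: "q 0 + (\<Sum>i=1..<t. q i) + \<alpha> t = k"
        using qs unfolding split_first_last(2)[OF t] by simp
      have "Pi_cond k t (rep_vec t \<alpha>) (rep_vec t \<beta>) q"
        unfolding Pi_cond_def
      proof (intro conjI)
        show "rep_vec t \<beta> = rep_vec t (\<lambda>i. if i = 1 then count_list (rep_vec t \<alpha>) t + (\<Sum>j=1..<t. q j)
            else count_list (rep_vec t \<alpha>) (i - 1) - q (i - 1))"
          using sum t by (intro rep_vec_cong) (auto simp: st[symmetric] step_state_def \<alpha>0 cnt)
      qed (use le sum cnt t in auto)
      then show False using False by blast
    qed
    then have "(\<Sum>q\<in>choices k t. ?f q) = 0" by (intro sum.neutral) auto
    then show ?thesis using False t by (auto simp: Pi_entry_def)
  qed
qed

text \<open>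
  When every row is used and no column is left behind, a step raises the first moment of the
  state by the number of free columns, up to the contribution of the choices.
\<close>

lemma step_state_00:
  fixes c :: "nat \<Rightarrow> 'b::comm_ring_1"
  assumes \<alpha>: "\<alpha> \<in> states k t" and nz: "step_wt 0 0 k t c \<alpha> q \<noteq> 0"
  shows "state_size t (step_state k t \<alpha> q) = state_size t \<alpha>"
    and "(\<Sum>i<Suc t. i * q i) + (\<Sum>i<Suc t. i * step_state k t \<alpha> q i)
      = (\<Sum>i<Suc t. i * \<alpha> i) + state_size t \<alpha>"
proof -
  note le = step_wt_nonzeroD(2)[OF nz] and qs = step_wt_00_nonzeroD[OF nz]
  let ?\<beta> = "step_state k t \<alpha> q"
  have \<beta>: "?\<beta> (Suc i) = \<alpha> i - q i" if "i < t" for i using that by (simp add: step_state_def)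
  have size: "(\<Sum>i<t. g (Suc i)) = (\<Sum>i=1..t. g i)" for g :: "nat \<Rightarrow> nat"
    by (metis One_nat_def atLeast0LessThan atLeastLessThanSuc_atLeastAtMost sum.shift_bounds_Suc_ivl)
  have "state_size t ?\<beta> + k = (\<Sum>i<t. \<alpha> i - q i) + (\<Sum>i<Suc t. q i)"
    unfolding state_size_def size[symmetric] using \<beta> qs by simp
  also have "\<dots> = (\<Sum>i<t. \<alpha> i - q i + q i) + \<alpha> t"
    using qs(2) by (simp only: sum.distrib sum.lessThan_Suc add.assoc)
  also have "\<dots> = (\<Sum>i<Suc t. \<alpha> i)" using le by simp
  also have "\<dots> = state_size t \<alpha> + k"
    unfolding state_size_def size[symmetric] sum.lessThan_Suc_shift using \<alpha> by (simp add: states_def)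
  finally show 1: "state_size t ?\<beta> = state_size t \<alpha>" by simp
  \<comment> \<open>A column that survives the row moves from position \<open>i\<close> to
    \<open>i + 1\<close> and adds one to the moment; the moment of the columns taken is the first
    sum.\<close>
  have "(\<Sum>i<Suc t. i * q i) + (\<Sum>i<Suc t. i * ?\<beta> i) = (\<Sum>i<Suc t. i * q i) + (\<Sum>i<t. Suc i * (\<alpha> i - q i))"
    unfolding sum.lessThan_Suc_shift[of "\<lambda>i. i * ?\<beta> i"] by (simp add: \<beta>)
  also have "\<dots> = (\<Sum>i<Suc t. i * q i) + (\<Sum>i<Suc t. i * (\<alpha> i - q i)) + (\<Sum>i<t. \<alpha> i - q i)"
    using qs(2) by (simp add: sum.distrib)
  also have "(\<Sum>i<Suc t. i * q i) + (\<Sum>i<Suc t. i * (\<alpha> i - q i)) = (\<Sum>i<Suc t. i * \<alpha> i)"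
    unfolding sum.distrib[symmetric] add_mult_distrib2[symmetric] using le by (intro sum.cong) auto
  also have "(\<Sum>i<t. \<alpha> i - q i) = state_size t ?\<beta>"
    unfolding state_size_def size[symmetric] by (simp add: \<beta>)
  finally show "(\<Sum>i<Suc t. i * q i) + (\<Sum>i<Suc t. i * ?\<beta> i) = (\<Sum>i<Suc t. i * \<alpha> i) + state_size t \<alpha>"
    unfolding 1 .
qed

section \<open>Powers and traces of the two matrices as walk sums\<close>

lemma K_mat_pow:
  assumes "\<And>X. finite X \<Longrightarrow> bij_betw (L X) X {..<card X}" "\<alpha> \<in> states k t" "\<beta> \<in> states k t"
  shows "(K_mat L k t a ^\<^sub>m n) $$ (L (G_set t k) (rep_vec t \<alpha>), L (G_set t k) (rep_vec t \<beta>))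
    = walk_sum 1 1 k t a n \<alpha> \<beta>"
  unfolding K_mat_def G_set_eq
  by (rule indexed_mat_pow_walk_sum)
    (use assms in \<open>auto intro: inj_on_rep_vec step_state_in simp: K_entry_eq_step_sum\<close>)

lemma Pi_mat_pow:
  assumes "\<And>X. finite X \<Longrightarrow> bij_betw (L X) X {..<card X}" "\<alpha> \<in> states k t" "\<beta> \<in> states k t"
    "state_size t \<alpha> = l" "state_size t \<beta> = l"
  shows "(Pi_mat L k l t a ^\<^sub>m n) $$ (L (G_sub l t k) (rep_vec t \<alpha>), L (G_sub l t k) (rep_vec t \<beta>))
    = walk_sum 0 0 k t a n \<alpha> \<beta>"
  unfolding Pi_mat_def G_sub_eq
  by (rule indexed_mat_pow_walk_sum)
    (use assms in \<open>auto intro: inj_on_subset[OF inj_on_rep_vec] step_state_in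
      simp: Pi_entry_eq_step_sum step_state_00(1)\<close>)

lemma trace_K_mat_pow:
  assumes L: "\<And>X. finite X \<Longrightarrow> bij_betw (L X) X {..<card X}"
  shows "trace_mat (K_mat L k t a ^\<^sub>m n) = (\<Sum>\<alpha>\<in>states k t. walk_sum 1 1 k t a n \<alpha> \<alpha>)"
proof -
  have "finite (G_set t k)" by (simp add: G_set_eq)
  then have "trace_mat (K_mat L k t a ^\<^sub>m n)
      = (\<Sum>g\<in>G_set t k. (K_mat L k t a ^\<^sub>m n) $$ (L (G_set t k) g, L (G_set t k) g))"
    unfolding K_mat_def by (intro trace_indexed_mat_pow L)
  also have "\<dots> = (\<Sum>\<alpha>\<in>states k t. (K_mat L k t a ^\<^sub>m n)
      $$ (L (G_set t k) (rep_vec t \<alpha>), L (G_set t k) (rep_vec t \<alpha>)))"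
    unfolding G_set_eq sum.reindex[OF inj_on_rep_vec] by simp
  finally show ?thesis by (simp add: K_mat_pow[OF L])
qed

lemma trace_Pi_mat_pow:
  assumes L: "\<And>X. finite X \<Longrightarrow> bij_betw (L X) X {..<card X}"
  shows "trace_mat (Pi_mat L k l t a ^\<^sub>m n)
    = (\<Sum>\<alpha> | \<alpha> \<in> states k t \<and> state_size t \<alpha> = l. walk_sum 0 0 k t a n \<alpha> \<alpha>)"
proof -
  let ?S = "{\<alpha> \<in> states k t. state_size t \<alpha> = l}"
  have "finite (G_sub l t k)" by (simp add: G_sub_eq)
  then have "trace_mat (Pi_mat L k l t a ^\<^sub>m n)
      = (\<Sum>g\<in>G_sub l t k. (Pi_mat L k l t a ^\<^sub>m n) $$ (L (G_sub l t k) g, L (G_sub l t k) g))"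
    unfolding Pi_mat_def by (intro trace_indexed_mat_pow L)
  also have "\<dots> = (\<Sum>\<alpha>\<in>?S. (Pi_mat L k l t a ^\<^sub>m n)
      $$ (L (G_sub l t k) (rep_vec t \<alpha>), L (G_sub l t k) (rep_vec t \<alpha>)))"
    unfolding G_sub_eq by (subst sum.reindex) (auto intro: inj_on_subset[OF inj_on_rep_vec])
  finally show ?thesis by (simp add: Pi_mat_pow[OF L])
qed

section \<open>Rook polynomials and permanents as rook sums\<close>

lemma monom_prod: "(\<Prod>i\<in>S. monom (f i) (d i)) = monom (\<Prod>i\<in>S. f i) (\<Sum>i\<in>S. d i)"
  by (induction S rule: infinite_finite_induct) (simp_all add: mult_monom)

lemma monom_sum: "monom (\<Sum>i\<in>S. f i) d = (\<Sum>i\<in>S. monom (f i) d)"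
  by (induction S rule: infinite_finite_induct) (simp_all add: add_monom[symmetric])

text \<open>Moving the variable into the entries lets the product over \<open>S\<close> carry the
  degree \<open>card S\<close>; the summand 1 is the empty placement.\<close>

lemma rook_poly_eq_rook_sum:
  "rook_poly A = rook_sum 1 1 {..<dim_row A} {..<dim_col A} (\<lambda>i j. monom (A $$ (i, j)) 1)"
proof -
  let ?N = "dim_row A" and ?J = "{..<dim_col A}"
  let ?g = "\<lambda>S. monom (\<Sum>\<sigma>\<in>inj_maps S ?J. \<Prod>i\<in>S. A $$ (i, \<sigma> i)) (card S)"
  have fin: "finite {S. S \<subseteq> {..<?N} \<and> card S = j}" for j
    by (rule finite_subset[of _ "Pow {..<?N}"]) auto
  have "rook_sum 1 1 {..<?N} ?J (\<lambda>i j. monom (A $$ (i, j)) 1) = (\<Sum>S\<in>Pow {..<?N}. ?g S)"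
    by (simp add: rook_sum_def monom_prod monom_sum)
  also have "\<dots> = (\<Sum>j\<in>{0..?N}. \<Sum>S\<in>{S \<in> Pow {..<?N}. card S = j}. ?g S)"
    by (rule sum.group[symmetric]) (auto dest: card_mono[rotated])
  also have "\<dots> = (\<Sum>S\<in>{S \<in> Pow {..<?N}. card S = 0}. ?g S)
      + (\<Sum>j=1..?N. \<Sum>S\<in>{S \<in> Pow {..<?N}. card S = j}. ?g S)"
    by (simp add: sum.atLeast_Suc_atMost)
  also have "{S \<in> Pow {..<?N}. card S = 0} = {{}}"
    by (auto simp: card_eq_0_iff dest: finite_subset)
  also have "(\<Sum>j=1..?N. \<Sum>S\<in>{S \<in> Pow {..<?N}. card S = j}. ?g S)
      = (\<Sum>j=1..?N. monom (\<Sum>S | S \<subseteq> {..<?N} \<and> card S = j.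
          \<Sum>\<sigma>\<in>inj_maps S ?J. \<Prod>i\<in>S. A $$ (i, \<sigma> i)) j)"
    unfolding monom_sum[of _ "{S. _ S}"] by (intro sum.cong) auto
  finally show ?thesis by (simp add: rook_poly_def inj_maps_def)
qed

lemma per_eq_rook_sum:
  assumes "dim_col A = dim_row A"
  shows "per A = rook_sum 0 0 {..<dim_row A} {..<dim_col A} (\<lambda>i j. A $$ (i, j))"
proof -
  let ?I = "{..<dim_row A}"
  have surj: "\<sigma> ` ?I = ?I" if "\<sigma> \<in> inj_maps ?I ?I" for \<sigma>
    using that by (intro endo_inj_surj) (auto simp: inj_maps_def)
  have "rook_sum 0 0 ?I ?I (\<lambda>i j. A $$ (i, j)) = (\<Sum>S\<in>{?I}. \<Sum>\<sigma>\<in>inj_maps S ?I.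
     0 ^ card (?I - S) * 0 ^ card (?I - \<sigma> ` S) * (\<Prod>i\<in>S. A $$ (i, \<sigma> i)))"
    unfolding rook_sum_def
  proof (rule sum.mono_neutral_right)
    show "\<forall>S\<in>Pow ?I - {?I}. (\<Sum>\<sigma>\<in>inj_maps S ?I.
       0 ^ card (?I - S) * 0 ^ card (?I - \<sigma> ` S) * (\<Prod>i\<in>S. A $$ (i, \<sigma> i))) = 0"
    proof
      fix S assume "S \<in> Pow ?I - {?I}"
      then have "card (?I - S) > 0" by (auto simp: card_gt_0_iff)
      then show "(\<Sum>\<sigma>\<in>inj_maps S ?I.
         0 ^ card (?I - S) * 0 ^ card (?I - \<sigma> ` S) * (\<Prod>i\<in>S. A $$ (i, \<sigma> i))) = 0"
        by (simp add: zero_power)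
    qed
  qed auto
  also have "\<dots> = (\<Sum>\<sigma>\<in>inj_maps ?I ?I. \<Prod>i<dim_row A. A $$ (i, \<sigma> i))"
    by (simp add: surj)
  also have "\<dots> = per A"
    unfolding per_def
  \<comment> \<open>Two encodings of a bijection of the index set: a permutation is the identity
    outside, an extensional map is \<open>undefined\<close> there.\<close>
  proof (rule sum.reindex_bij_witness[where
        i = "\<lambda>\<pi>. restrict \<pi> ?I" and j = "\<lambda>\<sigma> x. if x \<in> ?I then \<sigma> x else x"])
    fix \<sigma> assume s: "\<sigma> \<in> inj_maps ?I ?I"
    then have "bij_betw \<sigma> ?I ?I" using surj[OF s] by (simp add: inj_maps_def bij_betw_def)
    then have "bij_betw (\<lambda>x. if x \<in> ?I then \<sigma> x else x) ?I ?I"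
      by (rule bij_betw_cong[THEN iffD1, rotated]) simp
    then show "(\<lambda>x. if x \<in> ?I then \<sigma> x else x) \<in> {\<sigma>. \<sigma> permutes ?I}"
      by (auto intro!: bij_imp_permutes split: if_splits)
    show "restrict (\<lambda>x. if x \<in> ?I then \<sigma> x else x) ?I = \<sigma>"
      by (rule ext) (use s in \<open>auto simp: inj_maps_def PiE_iff extensional_def\<close>)
  next
    fix \<pi> assume "\<pi> \<in> {\<sigma>. \<sigma> permutes ?I}"
    then have p: "\<pi> permutes ?I" by simp
    then show "(\<lambda>x. if x \<in> ?I then restrict \<pi> ?I x else x) = \<pi>"
      by (intro ext) (simp add: permutes_not_in[OF p])
    have "restrict \<pi> ?I \<in> ?I \<rightarrow>\<^sub>E ?I" using permutes_in_image[OF p] by auto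
    moreover have "inj_on (restrict \<pi> ?I) ?I" using permutes_inj_on[OF p] by (simp add: inj_on_def)
    ultimately show "restrict \<pi> ?I \<in> inj_maps ?I ?I" by (simp add: inj_maps_def)
  qed (auto intro!: prod.cong)
  finally show ?thesis using assms by simp
qed

section \<open>Block structure of Kronecker products with the all-ones matrix\<close>

lemma div_block_set: "{j. j < n * k \<and> j div k = y} = (if y < n then {y * k..<y * k + k} else {})" for y k n :: nat
proof (cases "k = 0")
  case False
  have iff: "j div k = y \<longleftrightarrow> y * k \<le> j \<and> j < y * k + k" for j
  proof
    assume "j div k = y"
    then show "y * k \<le> j \<and> j < y * k + k"
      using False dividend_less_div_times[of k j] by (auto simp: add.commute)
  next
    assume "y * k \<le> j \<and> j < y * k + k"
    then show "j div k = y" by (intro div_nat_eqI) (auto simp: mult.commute)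
  qed
  show ?thesis
  proof (cases "y < n")
    case True
    then have "y * k + k \<le> n * k" using mult_le_mono1[of "Suc y" n k] by simp
    then have "{j. j < n * k \<and> j div k = y} = {y * k..<y * k + k}"
      unfolding iff by auto
    then show ?thesis by (simp only: True if_True)
  next
    case False
    then have "{j. j < n * k \<and> j div k = y} = {}"
      using less_mult_imp_div_less by blast
    then show ?thesis by (simp only: False if_False)
  qed
qed simp

lemma block_count_blocks:
  assumes f: "inj_on f {..<n}"
  shows "block_count (\<lambda>j. f (j div k)) {..<n * k} z = (if z \<in> f ` {..<n} then k else 0)"
proof -
  have "f (j div k) = z \<longleftrightarrow> z \<in> f ` {..<n} \<and> j div k = inv_into {..<n} f z" if "j < n * k" for j
  proof -
    have "j div k \<in> {..<n}" using less_mult_imp_div_less[OF that] by simp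
    then show ?thesis using f by (auto simp: f_inv_into_f)
  qed
  then have "{j \<in> {..<n * k}. f (j div k) = z} = (if z \<in> f ` {..<n} then
      {j. j < n * k \<and> j div k = inv_into {..<n} f z} else {})"
    by auto
  moreover have "inv_into {..<n} f z < n" if "z \<in> f ` {..<n}"
    using inv_into_into[OF that] by simp
  ultimately show ?thesis by (simp add: block_count_def div_block_set)
qed

lemma kronecker_J:
  assumes "M \<in> carrier_mat n n"
  shows "M \<otimes>\<^sub>K J_mat k \<in> carrier_mat (n * k) (n * k)"
    and "i < n * k \<Longrightarrow> j < n * k \<Longrightarrow> (M \<otimes>\<^sub>K J_mat k) $$ (i, j) = M $$ (i div k, j div k)"
proof -
  show "M \<otimes>\<^sub>K J_mat k \<in> carrier_mat (n * k) (n * k)"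
    using assms by (simp add: kronecker_def J_mat_def)
  assume ij: "i < n * k" "j < n * k"
  then have "k > 0" by (cases k) auto
  then show "(M \<otimes>\<^sub>K J_mat k) $$ (i, j) = M $$ (i div k, j div k)"
    using assms ij by (simp add: kronecker_def J_mat_def)
qed

lemma rook_sum_cong:
  assumes "\<And>i j. i \<in> I \<Longrightarrow> j \<in> J \<Longrightarrow> b i j = b' i j"
  shows "rook_sum u v I J b = rook_sum u v I J b'"
  unfolding rook_sum_def
proof (intro sum.cong refl)
  fix S \<sigma> assume "S \<in> Pow I" "\<sigma> \<in> inj_maps S J"
  then have "(\<Prod>i\<in>S. b i (\<sigma> i)) = (\<Prod>i\<in>S. b' i (\<sigma> i))"
    by (intro prod.cong refl assms) (auto simp: inj_maps_def)
  then show "u ^ card (I - S) * v ^ card (J - \<sigma> ` S) * (\<Prod>i\<in>S. b i (\<sigma> i))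
      = u ^ card (I - S) * v ^ card (J - \<sigma> ` S) * (\<Prod>i\<in>S. b' i (\<sigma> i))"
    by (rule arg_cong)
qed

text \<open>\<open>h\<close> covers both entry maps, the identity for permanents and multiplication
  by the variable for rook polynomials. \<open>f\<close> renames the column blocks so that edge
  \<open>e\<close> of row \<open>x\<close> aims at \<open>x + e\<close>, possibly modulo
  \<open>n\<close>.\<close>

lemma rook_sum_kronecker_J:
  fixes M :: "'a::comm_ring_1 mat" and c :: "nat \<Rightarrow> 'b::comm_ring_1"
  assumes M: "M \<in> carrier_mat n n" and f: "inj_on f {..<n}" "f ` {..<n} \<subseteq> Y" "finite Y"
    and b: "\<And>x y. x < n \<Longrightarrow> y < n \<Longrightarrow> h (M $$ (x, y)) = (\<Sum>e<T. if tgt x e = f y then c e else 0)"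
  shows "rook_sum u v {..<n * k} {..<n * k} (\<lambda>i j. h ((M \<otimes>\<^sub>K J_mat k) $$ (i, j)))
    = block_rook u v k T c tgt Y n (\<lambda>z. if z \<in> f ` {..<n} then k else 0)"
proof -
  have "rook_sum u v {..<n * k} {..<n * k} (\<lambda>i j. h ((M \<otimes>\<^sub>K J_mat k) $$ (i, j)))
      = rook_sum u v {..<n * k} {..<n * k} (\<lambda>i j. \<Sum>e<T. if tgt (i div k) e = f (j div k) then c e else 0)"
    by (rule rook_sum_cong) (simp add: kronecker_J[OF M] b less_mult_imp_div_less)
  also have "\<dots> = block_rook u v k T c tgt Y n (block_count (\<lambda>j. f (j div k)) {..<n * k})"
    by (rule rook_sum_eq_block_rook) (use f in \<open>auto dest: less_mult_imp_div_less\<close>)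
  also have "block_count (\<lambda>j. f (j div k)) {..<n * k} = (\<lambda>z. if z \<in> f ` {..<n} then k else 0)"
    by (rule ext) (rule block_count_blocks[OF f(1)])
  finally show ?thesis .
qed

section \<open>Sums of shift matrices\<close>

lemma finsum_ring_mat:
  fixes B :: "nat \<Rightarrow> 'a::comm_ring_1 mat"
  assumes "finite I" "\<And>i. i \<in> I \<Longrightarrow> B i \<in> carrier_mat n n"
  shows "(\<Oplus>\<^bsub>ring_mat TYPE('a) n ()\<^esub> i\<in>I. B i) \<in> carrier_mat n n"
    and "x < n \<Longrightarrow> y < n \<Longrightarrow> (\<Oplus>\<^bsub>ring_mat TYPE('a) n ()\<^esub> i\<in>I. B i) $$ (x, y) = (\<Sum>i\<in>I. B i $$ (x, y))"
proof -
  interpret R: ring "ring_mat TYPE('a) n ()" by (rule ring_mat)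
  note [simp] = ring_mat_simps
  have "(\<Oplus>\<^bsub>ring_mat TYPE('a) n ()\<^esub> i\<in>I. B i) \<in> carrier_mat n n \<and>
    (x < n \<longrightarrow> y < n \<longrightarrow> (\<Oplus>\<^bsub>ring_mat TYPE('a) n ()\<^esub> i\<in>I. B i) $$ (x, y) = (\<Sum>i\<in>I. B i $$ (x, y)))"
    using assms
  proof (induction I)
    case (insert i I)
    have "B \<in> I \<rightarrow> carrier (ring_mat TYPE('a) n ())" "B i \<in> carrier (ring_mat TYPE('a) n ())"
      using insert by auto
    then have "(\<Oplus>\<^bsub>ring_mat TYPE('a) n ()\<^esub> i\<in>insert i I. B i) = B i + (\<Oplus>\<^bsub>ring_mat TYPE('a) n ()\<^esub> i\<in>I. B i)"
      using insert by simp
    then show ?case using insert by auto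
  qed simp
  then show "(\<Oplus>\<^bsub>ring_mat TYPE('a) n ()\<^esub> i\<in>I. B i) \<in> carrier_mat n n"
    and "x < n \<Longrightarrow> y < n \<Longrightarrow> (\<Oplus>\<^bsub>ring_mat TYPE('a) n ()\<^esub> i\<in>I. B i) $$ (x, y) = (\<Sum>i\<in>I. B i $$ (x, y))"
    by auto
qed

text \<open>The regular representation of the integers modulo \<open>n\<close>; as a homomorphism it
  gives all powers of \<open>P_mat\<close>, including the negative ones.\<close>

definition cyc_mat :: "nat \<Rightarrow> int \<Rightarrow> 'a::comm_ring_1 mat" where
  "cyc_mat n s = mat n n (\<lambda>(i, j). if (int j - int i) mod int n = s mod int n then 1 else 0)"

lemma cyc_mat_mult: "cyc_mat n s * cyc_mat n s' = cyc_mat n (s + s')"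
proof (rule eq_matI)
  fix i j assume "i < dim_row (cyc_mat n (s + s') :: 'a mat)" "j < dim_col (cyc_mat n (s + s') :: 'a mat)"
  then have ij: "i < n" "j < n" by (auto simp: cyc_mat_def)
  then have n: "int n > 0" by simp
  define m where "m = nat ((int i + s) mod int n)"
  have m: "m < n" "int m = (int i + s) mod int n"
    using n by (simp_all add: m_def nat_less_iff)
  have iff: "(int l - int i) mod int n = s mod int n \<longleftrightarrow> l = m" if "l < n" for l
  proof -
    have "(int l - int i) mod int n = s mod int n \<longleftrightarrow> int l mod int n = (int i + s) mod int n"
      by (simp add: mod_eq_dvd_iff algebra_simps)
    also have "\<dots> \<longleftrightarrow> int l = int m" using that m by simp
    finally show ?thesis by simp
  qed
  have iff2: "(int j - int m) mod int n = s' mod int n \<longleftrightarrow> (int j - int i) mod int n = (s + s') mod int n"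
  proof -
    have "(int j - int m) mod int n = s' mod int n \<longleftrightarrow> int n dvd (int j - s') - int m"
      by (simp add: mod_eq_dvd_iff algebra_simps)
    also have "\<dots> \<longleftrightarrow> (int j - s') mod int n = (int i + s) mod int n"
      by (simp add: mod_eq_dvd_iff[symmetric] m)
    also have "\<dots> \<longleftrightarrow> (int j - int i) mod int n = (s + s') mod int n"
      by (simp add: mod_eq_dvd_iff algebra_simps)
    finally show ?thesis .
  qed
  have "(cyc_mat n s * cyc_mat n s' :: 'a mat) $$ (i, j)
      = (\<Sum>l<n. (if (int l - int i) mod int n = s mod int n then 1 else 0) *
          (if (int j - int l) mod int n = s' mod int n then 1 else 0))"
    using ij by (auto simp: cyc_mat_def scalar_prod_def atLeast0LessThan intro!: sum.cong)
  also have "\<dots> = (\<Sum>l<n. if l = m then if (int j - int m) mod int n = s' mod int n then 1 else 0 else 0)"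
    by (intro sum.cong refl) (auto simp: iff)
  also have "\<dots> = (if (int j - int m) mod int n = s' mod int n then 1 else 0)"
    using m by simp
  also have "\<dots> = cyc_mat n (s + s') $$ (i, j)"
    using ij by (simp add: iff2 cyc_mat_def)
  finally show "(cyc_mat n s * cyc_mat n s' :: 'a mat) $$ (i, j) = cyc_mat n (s + s') $$ (i, j)" .
qed (simp_all add: cyc_mat_def)

lemma cyc_mat_0: "cyc_mat n 0 = 1\<^sub>m n"
proof (rule eq_matI)
  fix i j assume "i < dim_row (1\<^sub>m n :: 'a mat)" "j < dim_col (1\<^sub>m n :: 'a mat)"
  moreover from this have "(int j - int i) mod int n = 0 \<longleftrightarrow> i = j"
    by (auto simp: mod_eq_dvd_iff[symmetric] simp flip: dvd_eq_mod_eq_0)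
  ultimately show "cyc_mat n 0 $$ (i, j) = (1\<^sub>m n :: 'a mat) $$ (i, j)"
    by (simp add: cyc_mat_def)
qed (simp_all add: cyc_mat_def)

lemma P_pow_eq_cyc_mat: "(P_pow n s :: 'a::comm_ring_1 mat) = cyc_mat n s"
proof -
  interpret R: ring "ring_mat TYPE('a) n ()" by (rule ring_mat)
  note [simp] = ring_mat_simps
  have carr: "cyc_mat n s \<in> carrier_mat n n" for s by (simp add: cyc_mat_def)
  have nat: "P_mat n [^]\<^bsub>ring_mat TYPE('a) n ()\<^esub> m = cyc_mat n (int m)" for m :: nat
  proof (induction m)
    case (Suc m)
    have "(P_mat n :: 'a mat) = cyc_mat n 1" by (simp add: P_mat_def cyc_mat_def)
    then show ?case using Suc by (simp add: cyc_mat_mult add.commute)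
  qed (simp add: cyc_mat_0)
  have inv: "inv\<^bsub>ring_mat TYPE('a) n ()\<^esub> (cyc_mat n s) = cyc_mat n (- s)" for s
    by (rule R.inv_char) (use carr in \<open>simp_all add: cyc_mat_mult cyc_mat_0\<close>)
  show ?thesis
    by (cases "s < 0") (simp_all add: P_pow_def int_pow_def2 nat inv)
qed

lemma T_sum_index:
  fixes c :: "nat \<Rightarrow> 'a::comm_ring_1" and n r t :: nat
  defines "M \<equiv> \<Oplus>\<^bsub>ring_mat TYPE('a) n ()\<^esub> i\<in>{0..t}. c i \<cdot>\<^sub>m T_mat n (int i - int r)"
  shows "M \<in> carrier_mat n n"
    and "x < n \<Longrightarrow> y < n \<Longrightarrow> M $$ (x, y) = (\<Sum>e<Suc t. if x + e = y + r then c e else 0)"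
proof -
  show "M \<in> carrier_mat n n"
    unfolding M_def by (rule finsum_ring_mat) (auto simp: T_mat_def)
  assume xy: "x < n" "y < n"
  then have "M $$ (x, y) = (\<Sum>e\<in>{0..t}. (c e \<cdot>\<^sub>m T_mat n (int e - int r)) $$ (x, y))"
    unfolding M_def by (intro finsum_ring_mat) (auto simp: T_mat_def)
  also have "\<dots> = (\<Sum>e<Suc t. if x + e = y + r then c e else 0)"
    using xy by (intro sum.cong) (auto simp: T_mat_def)
  finally show "M $$ (x, y) = (\<Sum>e<Suc t. if x + e = y + r then c e else 0)" .
qed

lemma P_sum_index:
  fixes c :: "nat \<Rightarrow> 'a::comm_ring_1" and n r t :: nat
  defines "M \<equiv> \<Oplus>\<^bsub>ring_mat TYPE('a) n ()\<^esub> i\<in>{0..t}. c i \<cdot>\<^sub>m P_pow n (int i - int r)"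
  shows "M \<in> carrier_mat n n"
    and "x < n \<Longrightarrow> y < n \<Longrightarrow> M $$ (x, y) = (\<Sum>e<Suc t. if (x + e) mod n = (y + r) mod n then c e else 0)"
proof -
  show "M \<in> carrier_mat n n"
    unfolding M_def by (rule finsum_ring_mat) (auto simp: P_pow_eq_cyc_mat cyc_mat_def)
  assume xy: "x < n" "y < n"
  then have "M $$ (x, y) = (\<Sum>e\<in>{0..t}. (c e \<cdot>\<^sub>m P_pow n (int e - int r)) $$ (x, y))"
    unfolding M_def by (intro finsum_ring_mat) (auto simp: P_pow_eq_cyc_mat cyc_mat_def)
  also have "\<dots> = (\<Sum>e<Suc t. if (x + e) mod n = (y + r) mod n then c e else 0)"
  proof (intro sum.cong)
    fix e
    have "(int y - int x) mod int n = (int e - int r) mod int n \<longleftrightarrow> int (y + r) mod int n = int (x + e) mod int n"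
      by (simp add: mod_eq_dvd_iff algebra_simps)
    also have "\<dots> \<longleftrightarrow> (x + e) mod n = (y + r) mod n"
      by (metis of_nat_eq_iff zmod_int)
    finally show "(c e \<cdot>\<^sub>m P_pow n (int e - int r)) $$ (x, y) = (if (x + e) mod n = (y + r) mod n then c e else 0)"
      using xy by (simp add: P_pow_eq_cyc_mat cyc_mat_def)
  qed auto
  finally show "M $$ (x, y) = (\<Sum>e<Suc t. if (x + e) mod n = (y + r) mod n then c e else 0)" .
qed

section \<open>Band and circulant matrices\<close>

text \<open>Before the last row \<open>n - 1\<close>, position \<open>i\<close> is block
  \<open>n - 1 + i\<close> in shifted numbering. The matrix ends with block
  \<open>n + r - 1\<close>, so positions up to \<open>r\<close> start full and the others without
  columns.\<close>

lemma rook_sum_band: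
  fixes M :: "'a::comm_ring_1 mat" and c :: "nat \<Rightarrow> 'b::comm_ring_1"
  assumes r: "r \<le> t" and M: "M \<in> carrier_mat n n"
    and h: "\<And>x y. x < n \<Longrightarrow> y < n \<Longrightarrow> h (M $$ (x, y)) = (\<Sum>e<Suc t. if x + e = y + r then c e else 0)"
  shows "rook_sum u v {..<n * k} {..<n * k} (\<lambda>i j. h ((M \<otimes>\<^sub>K J_mat k) $$ (i, j)))
    = (\<Sum>\<gamma> | \<gamma> \<in> states k t \<and> (\<forall>i\<in>{1..r}. \<gamma> i = k).
        v ^ (\<Sum>i=Suc r..t. \<gamma> i) * walk_sum u v k t c n (\<lambda>i. if i \<le> r then k else 0) \<gamma>)"
proof -
  let ?\<epsilon> = "\<lambda>i. if i \<le> r then k else 0"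
  have \<epsilon>: "?\<epsilon> \<in> states k t" using r by (auto simp: states_def)
  have "rook_sum u v {..<n * k} {..<n * k} (\<lambda>i j. h ((M \<otimes>\<^sub>K J_mat k) $$ (i, j)))
      = block_rook u v k (Suc t) c (\<lambda>x i. x + i) {..<n + t} n
          (\<lambda>z. if z \<in> (\<lambda>y. y + r) ` {..<n} then k else 0)"
    by (rule rook_sum_kronecker_J[OF M]) (use r h in auto)
  also have "(\<lambda>z. if z \<in> (\<lambda>y. y + r) ` {..<n} then k else 0) = window_cols k t r n ?\<epsilon>"
  proof
    fix z
    have "z \<in> (\<lambda>y. y + r) ` {..<n} \<longleftrightarrow> r \<le> z \<and> z < n + r"
      by (auto intro!: image_eqI[of _ _ "z - r"])
    then show "(if z \<in> (\<lambda>y. y + r) ` {..<n} then k else 0) = window_cols k t r n ?\<epsilon> z"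
      using r by (auto simp: window_cols_def)
  qed
  also have "block_rook u v k (Suc t) c (\<lambda>x i. x + i) {..<n + t} n (window_cols k t r n ?\<epsilon>)
      = (\<Sum>\<gamma> | \<gamma> \<in> states k t \<and> (\<forall>i\<in>{1..r}. \<gamma> i = k).
        v ^ (\<Sum>i=Suc r..t. \<gamma> i) * walk_sum u v k t c n ?\<epsilon> \<gamma>)"
    using walk_sum_open[OF r, of "{..<n + t}" n n ?\<epsilon> k v u c] \<epsilon> by simp
  finally show ?thesis .
qed

text \<open>The shift by \<open>r\<close> renames the column blocks by a bijection modulo
  \<open>n\<close>, which leaves every block with \<open>k\<close> columns.\<close>

lemma rook_sum_cyclic:
  fixes M :: "'a::comm_ring_1 mat" and c :: "nat \<Rightarrow> 'b::comm_ring_1"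
  assumes n: "n > 0" and M: "M \<in> carrier_mat n n"
    and h: "\<And>x y. x < n \<Longrightarrow> y < n \<Longrightarrow>
      h (M $$ (x, y)) = (\<Sum>e<Suc t. if (x + e) mod n = (y + r) mod n then c e else 0)"
  shows "rook_sum u v {..<n * k} {..<n * k} (\<lambda>i j. h ((M \<otimes>\<^sub>K J_mat k) $$ (i, j)))
    = (\<Sum>\<alpha>\<in>states k t. walk_sum u v k t c n \<alpha> \<alpha>)"
proof -
  let ?f = "\<lambda>y. (y + r) mod n"
  have f: "inj_on ?f {..<n}" "?f ` {..<n} = {..<n}"
    using bij_betw_add_mod[of r n] by (auto simp: bij_betw_def)
  have "rook_sum u v {..<n * k} {..<n * k} (\<lambda>i j. h ((M \<otimes>\<^sub>K J_mat k) $$ (i, j)))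
      = block_rook u v k (Suc t) c (\<lambda>x i. (x + i) mod n) {..<n} n (\<lambda>z. if z \<in> ?f ` {..<n} then k else 0)"
    by (rule rook_sum_kronecker_J[OF M f(1)]) (use f h in auto)
  then show ?thesis unfolding f(2) walk_sum_cyclic[OF n] by simp
qed

text \<open>The degree of one step is \<open>\<Sum>i<Suc t. i * q i\<close>, and by
  \<open>step_state_00\<close> it is the conserved size plus the drop of the first moment, so the
  degrees telescope along the walk. The moment of the end is put on the left as a monomial because
  exponents cannot be negative.\<close>

lemma walk_sum_00_monom:
  fixes c :: "nat \<Rightarrow> 'a::comm_ring_1"
  assumes "\<alpha> \<in> states k t"
  shows "monom 1 (\<Sum>i<Suc t. i * \<beta> i) * walk_sum 0 0 k t (\<lambda>i. monom (c i) i) n \<alpha> \<beta>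
    = monom (walk_sum 0 0 k t c n \<alpha> \<beta>) ((\<Sum>i<Suc t. i * \<alpha> i) + n * state_size t \<alpha>)"
  using assms
proof (induction n arbitrary: \<alpha>)
  case 0
  show ?case by simp
next
  case (Suc n)
  let ?p = "\<lambda>\<alpha>. \<Sum>i<Suc t. i * \<alpha> i"
  let ?W = "walk_sum 0 0 k t c n" and ?W' = "walk_sum 0 0 k t (\<lambda>i. monom (c i) i) n"
  let ?w = "step_wt 0 0 k t c \<alpha>" and ?w' = "step_wt 0 0 k t (\<lambda>i. monom (c i) i) \<alpha>"
  have wt: "?w' q = monom (?w q) (?p q)" for q
  proof -
    have mon: "(0 :: 'a poly) ^ m = monom (0 ^ m) 0" "of_nat m = monom (of_nat m :: 'a) 0" for m
      by (cases m) (simp_all add: of_nat_monom)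
    have "(\<Prod>i<Suc t. monom (c i) i ^ q i) = monom (\<Prod>i<Suc t. c i ^ q i) (?p q)"
      by (simp only: monom_power monom_prod)
    then show ?thesis
      unfolding step_wt_def row_wt_def mon by (simp only: mult_monom add_0 add_0_right)
  qed
  have "monom 1 (?p \<beta>) * walk_sum 0 0 k t (\<lambda>i. monom (c i) i) (Suc n) \<alpha> \<beta>
      = (\<Sum>q\<in>choices k t. ?w' q * (monom 1 (?p \<beta>) * ?W' (step_state k t \<alpha> q) \<beta>))"
    unfolding walk_sum.simps sum_distrib_left by (simp only: mult.left_commute)
  also have "\<dots> = (\<Sum>q\<in>choices k t. monom (?w q * ?W (step_state k t \<alpha> q) \<beta>)
      (?p \<alpha> + Suc n * state_size t \<alpha>))"
  proof (intro sum.cong refl)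
    fix q
    let ?\<beta> = "step_state k t \<alpha> q"
    show "?w' q * (monom 1 (?p \<beta>) * ?W' ?\<beta> \<beta>) = monom (?w q * ?W ?\<beta> \<beta>) (?p \<alpha> + Suc n * state_size t \<alpha>)"
    proof (cases "?w q = 0")
      case False
      note st = step_state_00[OF Suc.prems False]
      have "?p q + (?p ?\<beta> + n * state_size t ?\<beta>) = ?p \<alpha> + Suc n * state_size t \<alpha>"
        using st by simp
      then show ?thesis
        unfolding wt Suc.IH[OF step_state_in[OF Suc.prems]] mult_monom by (simp only:)
    qed (simp add: wt)
  qed
  also have "\<dots> = monom (walk_sum 0 0 k t c (Suc n) \<alpha> \<beta>) (?p \<alpha> + Suc n * state_size t \<alpha>)"
    by (simp only: walk_sum.simps monom_sum)
  finally show ?case .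
qed

text \<open>The moments of both ends agree, so the common power of the variable is removed by
  comparing shifted coefficients.\<close>

lemma closed_walk_sum_00_monom:
  assumes "\<alpha> \<in> states k t"
  shows "walk_sum 0 0 k t (\<lambda>i. monom (c i) i) n \<alpha> \<alpha>
    = monom (walk_sum 0 0 k t c n \<alpha> \<alpha>) (state_size t \<alpha> * n)"
proof (rule poly_eqI)
  fix d
  let ?p = "\<Sum>i<Suc t. i * \<alpha> i"
  have "coeff (monom 1 ?p * walk_sum 0 0 k t (\<lambda>i. monom (c i) i) n \<alpha> \<alpha>) (?p + d)
      = coeff (monom (walk_sum 0 0 k t c n \<alpha> \<alpha>) (?p + n * state_size t \<alpha>)) (?p + d)"
    by (simp only: walk_sum_00_monom[OF assms])
  then show "coeff (walk_sum 0 0 k t (\<lambda>i. monom (c i) i) n \<alpha> \<alpha>) d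
      = coeff (monom (walk_sum 0 0 k t c n \<alpha> \<alpha>) (state_size t \<alpha> * n)) d"
    by (simp add: coeff_monom_mult mult.commute del: sum.lessThan_Suc)
qed

section \<open>Initial and final vectors of the open process\<close>

lemma mset_rep_vec_subset_iff:
  assumes "r \<le> t" "\<gamma> \<in> states k t"
  shows "mset (rep_vec r (\<lambda>_. k)) \<subseteq># mset (rep_vec t \<gamma>) \<longleftrightarrow> (\<forall>i\<in>{1..r}. \<gamma> i = k)"
proof -
  have "mset (rep_vec r (\<lambda>_. k)) \<subseteq># mset (rep_vec t \<gamma>)
      \<longleftrightarrow> (\<forall>i. (if 1 \<le> i \<and> i \<le> r then k else 0) \<le> (if 1 \<le> i \<and> i \<le> t then \<gamma> i else 0))"
    unfolding subseteq_mset_def count_mset count_list_rep_vec' ..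
  also have "\<dots> \<longleftrightarrow> (\<forall>i\<in>{1..r}. \<gamma> i = k)"
  proof
    assume le: "\<forall>i. (if 1 \<le> i \<and> i \<le> r then k else 0) \<le> (if 1 \<le> i \<and> i \<le> t then \<gamma> i else 0)"
    show "\<forall>i\<in>{1..r}. \<gamma> i = k"
    proof
      fix i assume "i \<in> {1..r}"
      then have "k \<le> \<gamma> i" using le[rule_format, of i] assms(1) by simp
      moreover have "\<gamma> i \<le> k" using assms(2) by (simp add: states_def)
      ultimately show "\<gamma> i = k" by simp
    qed
  qed (use assms(1) in auto)
  finally show ?thesis .
qed

lemma state_size_initial: "r \<le> t \<Longrightarrow> state_size t (\<lambda>i. if i \<le> r then k else 0) = r * k"
proof -
  assume "r \<le> t"
  then have "state_size t (\<lambda>i. if i \<le> r then k else 0) = (\<Sum>i\<in>{1..r}. k)"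
    unfolding state_size_def by (intro sum.mono_neutral_cong_right) auto
  then show ?thesis by simp
qed

text \<open>A vector containing the prescribed multiset has at least \<open>r * k\<close>
  components, and no vector has more than \<open>k * t\<close>. So the range of \<open>l\<close>
  agrees with the inclusion condition.\<close>

lemma final_vectors_eq:
  assumes r: "r \<le> t"
  shows "{\<gamma>. \<gamma> \<in> (\<Union>l\<in>{r * k..k * t}. G_sub l t k) \<and> mset (rep_vec r (\<lambda>_. k)) \<subseteq># mset \<gamma>}
    = rep_vec t ` {\<gamma>. \<gamma> \<in> states k t \<and> (\<forall>i\<in>{1..r}. \<gamma> i = k)}"
proof (intro equalityI subsetI)
  fix g assume "g \<in> {\<gamma>. \<gamma> \<in> (\<Union>l\<in>{r * k..k * t}. G_sub l t k) \<and> mset (rep_vec r (\<lambda>_. k)) \<subseteq># mset \<gamma>}"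
  then obtain \<gamma> where "\<gamma> \<in> states k t" "g = rep_vec t \<gamma>" "mset (rep_vec r (\<lambda>_. k)) \<subseteq># mset (rep_vec t \<gamma>)"
    unfolding G_sub_eq by auto
  then show "g \<in> rep_vec t ` {\<gamma>. \<gamma> \<in> states k t \<and> (\<forall>i\<in>{1..r}. \<gamma> i = k)}"
    using mset_rep_vec_subset_iff[OF r] by auto
next
  fix g assume "g \<in> rep_vec t ` {\<gamma>. \<gamma> \<in> states k t \<and> (\<forall>i\<in>{1..r}. \<gamma> i = k)}"
  then obtain \<gamma> where g: "g = rep_vec t \<gamma>" and \<gamma>: "\<gamma> \<in> states k t" "\<forall>i\<in>{1..r}. \<gamma> i = k" by auto
  have "r * k = (\<Sum>i\<in>{1..r}. \<gamma> i)" using \<gamma>(2) by simp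
  also have "\<dots> \<le> state_size t \<gamma>"
    unfolding state_size_def by (rule sum_mono2) (use r in auto)
  finally have "g \<in> (\<Union>l\<in>{r * k..k * t}. G_sub l t k)"
    using g \<gamma>(1) state_size_le[OF \<gamma>(1)] by (auto simp: G_sub_eq)
  then show "g \<in> {\<gamma>. \<gamma> \<in> (\<Union>l\<in>{r * k..k * t}. G_sub l t k) \<and> mset (rep_vec r (\<lambda>_. k)) \<subseteq># mset \<gamma>}"
    using g \<gamma> mset_rep_vec_subset_iff[OF r] by auto
qed

theorem theorem3:
  fixes a :: "int \<Rightarrow> 'a::comm_ring_1"
    and k r t n :: nat
    and L :: "nat list set \<Rightarrow> nat list \<Rightarrow> nat"
  assumes "k \<ge> 1" and "r \<le> t" and "n \<ge> 1"
    and L: "\<And>X. finite X \<Longrightarrow> bij_betw (L X) X {..<card X}"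
  defines "\<epsilon> \<equiv> rep_vec r (\<lambda>_. k)"
    and "coef \<equiv> (\<lambda>i::nat. a (int i - int r))"
  shows
    "rook_poly
       ((\<Oplus>\<^bsub>ring_mat TYPE('a) n ()\<^esub> i\<in>{0..t}. coef i \<cdot>\<^sub>m T_mat n (int i - int r)) \<otimes>\<^sub>K J_mat k)
     = (\<Sum>\<gamma> | \<gamma> \<in> (\<Union>l\<in>{r * k..k * t}. G_sub l t k) \<and> mset \<epsilon> \<subseteq># mset \<gamma>.
          (K_mat L k t (\<lambda>i. monom (coef i) 1) ^\<^sub>m n) $$ (L (G_set t k) \<epsilon>, L (G_set t k) \<gamma>))
     \<and>
     per ((\<Oplus>\<^bsub>ring_mat TYPE('a) n ()\<^esub> i\<in>{0..t}. coef i \<cdot>\<^sub>m T_mat n (int i - int r)) \<otimes>\<^sub>K J_mat k)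
     = (Pi_mat L k (r * k) t coef ^\<^sub>m n)
         $$ (L (G_sub (r * k) t k) \<epsilon>, L (G_sub (r * k) t k) \<epsilon>)
     \<and>
     rook_poly
       ((\<Oplus>\<^bsub>ring_mat TYPE('a) n ()\<^esub> i\<in>{0..t}. coef i \<cdot>\<^sub>m P_pow n (int i - int r)) \<otimes>\<^sub>K J_mat k)
     = trace_mat (K_mat L k t (\<lambda>i. monom (coef i) 1) ^\<^sub>m n)
     \<and>
     per ((\<Oplus>\<^bsub>ring_mat TYPE('a poly) n ()\<^esub> i\<in>{0..t}.
             monom (coef i) i \<cdot>\<^sub>m P_pow n (int i - int r)) \<otimes>\<^sub>K J_mat k)
     = (\<Sum>l=0..k * t. monom (trace_mat (Pi_mat L k l t coef ^\<^sub>m n)) (l * n))"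
    (is "rook_poly (?T \<otimes>\<^sub>K _) = _ \<and> _ \<and> rook_poly (?P \<otimes>\<^sub>K _) = _ \<and> per (?Px \<otimes>\<^sub>K _) = _")
proof (intro conjI)
  let ?c = "\<lambda>i. monom (coef i) 1"
  let ?\<Gamma> = "{\<gamma>. \<gamma> \<in> states k t \<and> (\<forall>i\<in>{1..r}. \<gamma> i = k)}"
  let ?\<epsilon> = "\<lambda>i. if i \<le> r then k else 0"
  have n: "n > 0" using assms by simp
  have \<epsilon>: "\<epsilon> = rep_vec t ?\<epsilon>"
    unfolding \<epsilon>_def by (rule rep_vec_extend[OF \<open>r \<le> t\<close>, symmetric])
  have \<epsilon>_in: "?\<epsilon> \<in> states k t" using \<open>r \<le> t\<close> by (auto simp: states_def)
  have fin: "finite ?\<Gamma>" by (rule finite_subset[OF _ finite_states]) auto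
  note T = T_sum_index[where n = n and c = coef and r = r and t = t] and P = P_sum_index[where n = n and c = coef and r = r and t = t]
    and Px = P_sum_index[where n = n and c = "\<lambda>i. monom (coef i) i" and r = r and t = t]
  have monom_if: "monom (\<Sum>e<Suc t. if Q e then coef e else 0) 1 = (\<Sum>e<Suc t. if Q e then ?c e else 0)" for Q
    unfolding monom_sum by (intro sum.cong) auto

  have "rook_poly (?T \<otimes>\<^sub>K J_mat k)
      = rook_sum 1 1 {..<n * k} {..<n * k} (\<lambda>i j. monom ((?T \<otimes>\<^sub>K J_mat k) $$ (i, j)) 1)"
    using kronecker_J(1)[OF T(1), of k] by (simp add: rook_poly_eq_rook_sum)
  also have "\<dots> = (\<Sum>\<gamma>\<in>?\<Gamma>. 1 ^ (\<Sum>i=Suc r..t. \<gamma> i) * walk_sum 1 1 k t ?c n ?\<epsilon> \<gamma>)"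
    by (rule rook_sum_band[OF \<open>r \<le> t\<close> T(1)]) (simp only: T(2) monom_if)
  also have "\<dots> = (\<Sum>\<gamma>\<in>?\<Gamma>. (K_mat L k t ?c ^\<^sub>m n) $$ (L (G_set t k) \<epsilon>, L (G_set t k) (rep_vec t \<gamma>)))"
    by (intro sum.cong refl) (simp add: \<epsilon> K_mat_pow[OF L] \<epsilon>_in)
  also have "\<dots> = (\<Sum>\<gamma>\<in>rep_vec t ` ?\<Gamma>. (K_mat L k t ?c ^\<^sub>m n) $$ (L (G_set t k) \<epsilon>, L (G_set t k) \<gamma>))"
    by (subst sum.reindex) (auto intro: inj_on_subset[OF inj_on_rep_vec])
  finally show "rook_poly (?T \<otimes>\<^sub>K J_mat k)
      = (\<Sum>\<gamma> | \<gamma> \<in> (\<Union>l\<in>{r * k..k * t}. G_sub l t k) \<and> mset \<epsilon> \<subseteq># mset \<gamma>.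
          (K_mat L k t ?c ^\<^sub>m n) $$ (L (G_set t k) \<epsilon>, L (G_set t k) \<gamma>))"
    unfolding \<epsilon>_def final_vectors_eq[OF \<open>r \<le> t\<close>] .

  have "per (?T \<otimes>\<^sub>K J_mat k)
      = rook_sum 0 0 {..<n * k} {..<n * k} (\<lambda>i j. (?T \<otimes>\<^sub>K J_mat k) $$ (i, j))"
    using kronecker_J(1)[OF T(1), of k] by (subst per_eq_rook_sum) auto
  also have "\<dots> = (\<Sum>\<gamma>\<in>?\<Gamma>. 0 ^ (\<Sum>i=Suc r..t. \<gamma> i) * walk_sum 0 0 k t coef n ?\<epsilon> \<gamma>)"
    by (rule rook_sum_band[OF \<open>r \<le> t\<close> T(1), where h = "\<lambda>x. x"]) (rule T(2))
  \<comment> \<open>The mark 0 forbids free columns beyond position \<open>r\<close>; with the first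
    \<open>r\<close> positions full, only the initial state remains as final state.\<close>
  also have "\<dots> = (\<Sum>\<gamma>\<in>{?\<epsilon>}. 0 ^ (\<Sum>i=Suc r..t. \<gamma> i) * walk_sum 0 0 k t coef n ?\<epsilon> \<gamma>)"
  proof (rule sum.mono_neutral_right[OF fin])
    show "\<forall>\<gamma>\<in>?\<Gamma> - {?\<epsilon>}. 0 ^ (\<Sum>i=Suc r..t. \<gamma> i) * walk_sum 0 0 k t coef n ?\<epsilon> \<gamma> = 0"
    proof
      fix \<gamma> assume \<gamma>: "\<gamma> \<in> ?\<Gamma> - {?\<epsilon>}"
      have "\<gamma> = ?\<epsilon>" if "\<forall>i\<in>{Suc r..t}. \<gamma> i = 0"
      proof
        fix i
        consider "i = 0" | "i \<in> {1..r}" | "i \<in> {Suc r..t}" | "i > t" by fastforce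
        then show "\<gamma> i = ?\<epsilon> i"
          using \<gamma> that \<open>r \<le> t\<close> by cases (auto simp: states_def)
      qed
      then have "(\<Sum>i=Suc r..t. \<gamma> i) \<noteq> 0" using \<gamma> by (auto simp: sum_eq_0_iff)
      then show "0 ^ (\<Sum>i=Suc r..t. \<gamma> i) * walk_sum 0 0 k t coef n ?\<epsilon> \<gamma> = 0"
        by (simp only: power_0_left if_False mult_zero_left)
    qed
  qed (use \<epsilon>_in \<open>r \<le> t\<close> in auto)
  also have "\<dots> = walk_sum 0 0 k t coef n ?\<epsilon> ?\<epsilon>" by simp
  finally show "per (?T \<otimes>\<^sub>K J_mat k) = (Pi_mat L k (r * k) t coef ^\<^sub>m n)
      $$ (L (G_sub (r * k) t k) \<epsilon>, L (G_sub (r * k) t k) \<epsilon>)"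
    unfolding \<epsilon> by (simp only: Pi_mat_pow[OF L \<epsilon>_in \<epsilon>_in] state_size_initial[OF \<open>r \<le> t\<close>])

  have "rook_poly (?P \<otimes>\<^sub>K J_mat k)
      = rook_sum 1 1 {..<n * k} {..<n * k} (\<lambda>i j. monom ((?P \<otimes>\<^sub>K J_mat k) $$ (i, j)) 1)"
    using kronecker_J(1)[OF P(1), of k] by (simp add: rook_poly_eq_rook_sum)
  also have "\<dots> = (\<Sum>\<alpha>\<in>states k t. walk_sum 1 1 k t ?c n \<alpha> \<alpha>)"
    by (rule rook_sum_cyclic[OF n P(1)]) (simp only: P(2) monom_if)
  finally show "rook_poly (?P \<otimes>\<^sub>K J_mat k) = trace_mat (K_mat L k t ?c ^\<^sub>m n)"
    by (simp only: trace_K_mat_pow[OF L])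

  have "per (?Px \<otimes>\<^sub>K J_mat k)
      = rook_sum 0 0 {..<n * k} {..<n * k} (\<lambda>i j. (?Px \<otimes>\<^sub>K J_mat k) $$ (i, j))"
    using kronecker_J(1)[OF Px(1), of k] by (subst per_eq_rook_sum) auto
  also have "\<dots> = (\<Sum>\<alpha>\<in>states k t. walk_sum 0 0 k t (\<lambda>i. monom (coef i) i) n \<alpha> \<alpha>)"
    by (rule rook_sum_cyclic[OF n Px(1), where h = "\<lambda>x. x"]) (rule Px(2))
  also have "\<dots> = (\<Sum>\<alpha>\<in>states k t. monom (walk_sum 0 0 k t coef n \<alpha> \<alpha>) (state_size t \<alpha> * n))"
    by (intro sum.cong refl closed_walk_sum_00_monom)
  also have "\<dots> = (\<Sum>l=0..k * t. \<Sum>\<alpha> | \<alpha> \<in> states k t \<and> state_size t \<alpha> = l.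
      monom (walk_sum 0 0 k t coef n \<alpha> \<alpha>) (state_size t \<alpha> * n))"
    by (rule sum.group[symmetric]) (auto simp: state_size_le)
  also have "\<dots> = (\<Sum>l=0..k * t. monom (trace_mat (Pi_mat L k l t coef ^\<^sub>m n)) (l * n))"
    by (intro sum.cong refl) (simp add: trace_Pi_mat_pow[OF L] monom_sum)
  finally show "per (?Px \<otimes>\<^sub>K J_mat k)
      = (\<Sum>l=0..k * t. monom (trace_mat (Pi_mat L k l t coef ^\<^sub>m n)) (l * n))" .
qed

end
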